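(* Let $j$ be an odd prime other than $3$. Let $\mathbb{A}:\mathbb{R}\times L^2_{\mathbb{Z}_2\times\mathbb{Z}_1}\to\mathbb{R}\times H^l_{\mathbb{Z}_2\times\mathbb{Z}_1}$ be a bounded linear operator, let $\mathcal{Y}_0,\mathcal{Y}_s,\mathcal{Z}_1,\mathcal{Z}_s$ be non-negative constants, and let $\mathcal{Z}_2:[0,\infty)\to(0,\infty)$ be a function such that for all $r>0$ \begin{align*} \left\|\mathbb{A}\begin{bmatrix}0\\ \mathbf{f}(0,u_0)\end{bmatrix}\right\|_{H_1}&\le\mathcal{Y}_0,\\ \left\|\mathbb{A}\begin{bmatrix}0\\ \tilde{\mathbb{G}}(u_0)\end{bmatrix}\right\|_{H_1}&\le\mathcal{Y}_s,\\ \|I_d-\mathbb{A}\mathbb{Q}(0,u_0)\|_{H_1}&\le\mathcal{Z}_1,\\ \|\mathbb{A}(\mathbb{Q}(0,u_0)-D\mathbb{F}(0,w_0))\|_{H_1}&\le\mathcal{Z}_s,\\ \|\mathbb{A}(D\mathbb{F}(0,w_0)-D\mathbb{F}(h))\|_{H_1}&\le\mathcal{Z}_2(r)\|h-(0,w_0)\|_{H_1}\quad\text{for all }h\in B_r(0,w_0). \end{align*} If there exists $r>0$ such that $$\tfrac12\mathcal{Z}_2(r)r^2-(1-\mathcal{Z}_1-\mathcal{Z}_s)r+\mathcal{Y}_0+\mathcal{Y}_s<0\quad\text{and}\quad\mathcal{Z}_2(r)r<1-\mathcal{Z}_1-\mathcal{Z}_s,$$ then there exists a unique $(0,\tilde w)\in\overline{B_r(0,w_0)}\subset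 H_1$ such that $\mathbb{F}(0,\tilde w)=0$, where $\overline{B_r(0,w_0)}$ is the closed ball of $H_1$ of radius $r$ centered at $(0,w_0)$.
   Context: Functions are real-valued on $\mathbb{R}^2$, $L^2=L^2(\mathbb{R}^2)$ with inner product $(\cdot,\cdot)_2$, $\hat f(\xi)=\int f(x)e^{-2\pi ix\cdot\xi}dx$. Operators. $\mathbb{L}$ is a linear differential operator with constant coefficients and polynomial symbol $l$ ($\widehat{\mathbb{L}u}=l\hat u$), $|l(\xi)|>0$ for all $\xi$. $\mathbb{G}(u)=\sum_{i=2}^{N_{\mathbb{G}}}\mathbb{G}_i(u)$, $N_{\mathbb G}\ge2$, where $\mathbb{G}_i$ is a sum of monomials of degree $i$ in $u$ and its partial derivatives, decomposed as $\mathbb{G}_i(u)=(\mathbb{G}_{i,1}u)\cdots(\mathbb{G}_{i,i}u)$ with constant-coefficient linear differential operators $\mathbb{G}_{i,p}$ whose symbols $g_{i,p}$ satisfy $g_{i,p}/l\in L^1$. $H^l=\{u\in L^2: l\hat u\in L^2\}$ with norm $\|u\|_l=\|\mathbb{L}u\|_2$; $\mathbb{G}:H^l\to L^2$ is smooth. Symmetry. $D_j$ is the dihedral group (symmetry group of the regular $j$-gon centered at the origin) generated by the rotation of angle $2\pi/j$ and the reflection $(x_1,x_2)\mapsto(-x_1,x_2)$. $\mathbb{Z}_2\times\mathbb{Z}_1$ is the subgroup generated by that reflection. For a group $\mathcal{K}$, $L^2_{\mathcal{K}},H^l_{\mathcal{K}}$ are the subspaces of functions with $u(gx)=u(x)$,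 $g\in\mathcal{K}$. $(R_\theta u)(x)=u(R_\theta x)$ where $R_\theta$ is rotation by $\theta$. The problem is Euclidean invariant: $\mathbb{L}$ and $\mathbb{G}$ commute with translations, rotations, and the reflection above; in particular they map $H^l_{\mathcal{K}}$ to $L^2_{\mathcal{K}}$ for $\mathcal{K}=D_j$ and $\mathcal{K}=\mathbb{Z}_2\times\mathbb{Z}_1$. Approximate solutions. $u_0\in H^l_{\mathbb{Z}_2\times\mathbb{Z}_1}$ is supported in $\overline{\Omega_0}$, $\Omega_0=(-d,d)^2$, and is a trigonometric polynomial in $e^{2\pi i\frac{n}{2d}\cdot x}$, $n\in\mathbb{Z}^2$, on $\Omega_0$; $w_0=\frac1j\sum_{k=0}^{j-1}R_{2\pi k/j}u_0\in H^l_{D_j}$ (this equals the average of $u_0$ over $D_j$). $\tilde{\mathbb{G}}(u_0)=\mathbb{G}(w_0)-\frac1j\sum_{k=0}^{j-1}R_{2\pi k/j}\mathbb{G}(u_0)$. Augmented problem. Fix $\rho>0$. For $(\beta,w)$ let $$\mathbf{f}(\beta,w)=\mathbb{L}w+\mathbb{G}(w)+\beta\frac{\partial_{x_2}w_0}{\rho},\qquad \mathbb{F}(\beta,w)=\begin{bmatrix}\frac1\rho(\mathbb{L}(w-w_0),\partial_{x_2}w_0)_2\\ \mathbf{f}(\beta,w)\end{bmatrix}.$$ $H_1=\mathbb{R}\times H^l_{D_j}$ with norm $\|(\beta,w)\|_{H_1}=(|\beta|^2+\|w\|_l^2)^{1/2}$; the same formula is used as the norm on $\mathbb{R}\times H^l_{\mathbb{Z}_2\times\mathbb{Z}_1}$,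 and $\|\cdot\|_{H_1}$ of an operator is its operator norm on $\mathbb{R}\times H^l_{\mathbb{Z}_2\times\mathbb{Z}_1}$ (the derivatives $D\mathbb{F}(h)$, $h\in H_1$, being viewed as bounded operators $\mathbb{R}\times H^l_{\mathbb{Z}_2\times\mathbb{Z}_1}\to\mathbb{R}\times L^2_{\mathbb{Z}_2\times\mathbb{Z}_1}$). $B_r(0,w_0)$ is the open ball of $H_1$. $$\mathbb{Q}(0,u_0)=\begin{bmatrix}0&\left(\frac{\partial_{x_2}u_0}{\rho}\right)^*\mathbb{L}\\ \frac{\partial_{x_2}u_0}{\rho}&\mathbb{L}+D\mathbb{G}(u_0)\end{bmatrix},$$ where, for $u\in L^2$, $u^*\mathbb{L}v=(u,\mathbb{L}v)_2$. *)

theory Defs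
  imports "HOL-Analysis.Analysis" "HOL-Computational_Algebra.Primes"
begin

definition sq_integrable :: "(real^2 \<Rightarrow> 'b::euclidean_space) \<Rightarrow> bool" where
  "sq_integrable f \<longleftrightarrow> f \<in> borel_measurable lborel \<and> integrable lborel (\<lambda>x. (norm (f x))\<^sup>2)"

lemma sq_integrable_zero: "sq_integrable (\<lambda>x. 0)"
  by (simp add: sq_integrable_def)

lemma sq_integrable_scaleR: "sq_integrable f \<Longrightarrow> sq_integrable (\<lambda>x. c *\<^sub>R f x)"
  by (auto simp: sq_integrable_def power_mult_distrib)

lemma sq_integrable_add:
  assumes f: "sq_integrable f" and g: "sq_integrable g"
  shows "sq_integrable (\<lambda>x. f x + g x)"
proof -
  have m: "f \<in> borel_measurable lborel" "g \<in> borel_measurable lborel"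
    using f g by (auto simp: sq_integrable_def)
  have "integrable lborel (\<lambda>x. 2 * (norm (f x))\<^sup>2 + 2 * (norm (g x))\<^sup>2)"
    using f g by (auto simp: sq_integrable_def)
  then have "integrable lborel (\<lambda>x. (norm (f x + g x))\<^sup>2)"
  proof (rule Bochner_Integration.integrable_bound)
    show "(\<lambda>x. (norm (f x + g x))\<^sup>2) \<in> borel_measurable lborel"
      using m by measurable
    show "AE x in lborel. norm ((norm (f x + g x))\<^sup>2)
            \<le> norm (2 * (norm (f x))\<^sup>2 + 2 * (norm (g x))\<^sup>2)"
    proof (rule AE_I2)
      fix x
      have "(norm (f x + g x))\<^sup>2 \<le> (norm (f x) + norm (g x))\<^sup>2"
        by (intro power_mono norm_triangle_ineq norm_ge_zero)
      also have "\<dots> \<le> 2 * (norm (f x))\<^sup>2 + 2 * (norm (g x))\<^sup>2"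
        using sum_squares_bound[of "norm (f x)" "norm (g x)"]
        by (simp add: power2_sum)
      finally show "norm ((norm (f x + g x))\<^sup>2)
            \<le> norm (2 * (norm (f x))\<^sup>2 + 2 * (norm (g x))\<^sup>2)"
        by simp
    qed
  qed
  then show ?thesis using m by (simp add: sq_integrable_def)
qed

lemma sq_integrable_uminus: "sq_integrable f \<Longrightarrow> sq_integrable (\<lambda>x. - f x)"
  by (auto simp: sq_integrable_def)

lemma sq_integrable_diff:
  "sq_integrable f \<Longrightarrow> sq_integrable g \<Longrightarrow> sq_integrable (\<lambda>x. f x - g x)"
  using sq_integrable_add[of f "\<lambda>x. - g x"] sq_integrable_uminus[of g] by simp

lemma sq_integrable_inner:
  assumes f: "sq_integrable f" and g: "sq_integrable g"
  shows "integrable lborel (\<lambda>x. f x \<bullet> g x)"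
proof -
  have m: "f \<in> borel_measurable lborel" "g \<in> borel_measurable lborel"
    using f g by (auto simp: sq_integrable_def)
  have "integrable lborel (\<lambda>x. (norm (f x))\<^sup>2 + (norm (g x))\<^sup>2)"
    using f g by (auto simp: sq_integrable_def)
  then show ?thesis
  proof (rule Bochner_Integration.integrable_bound)
    show "(\<lambda>x. f x \<bullet> g x) \<in> borel_measurable lborel" using m by measurable
    show "AE x in lborel. norm (f x \<bullet> g x) \<le> norm ((norm (f x))\<^sup>2 + (norm (g x))\<^sup>2)"
    proof (rule AE_I2)
      fix x
      have a: "\<bar>f x \<bullet> g x\<bar> \<le> norm (f x) * norm (g x)" by (rule Cauchy_Schwarz_ineq2)
      have b: "2 * (norm (f x) * norm (g x)) \<le> (norm (f x))\<^sup>2 + (norm (g x))\<^sup>2"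
        using sum_squares_bound[of "norm (f x)" "norm (g x)"] by simp
      have c: "0 \<le> norm (f x) * norm (g x)" by simp
      show "norm (f x \<bullet> g x) \<le> norm ((norm (f x))\<^sup>2 + (norm (g x))\<^sup>2)"
        using a b c by simp
    qed
  qed
qed

definition L2_rel :: "(real^2 \<Rightarrow> 'b::euclidean_space) \<Rightarrow> (real^2 \<Rightarrow> 'b) \<Rightarrow> bool" where
  "L2_rel f g \<longleftrightarrow> sq_integrable f \<and> sq_integrable g \<and> (AE x in lborel. f x = g x)"

quotient_type (overloaded) 'b L2 = "real^2 \<Rightarrow> 'b::euclidean_space" / partial: L2_rel
proof (rule part_equivpI)
  show "\<exists>f::real^2 \<Rightarrow> 'b. L2_rel f f"
    by (rule exI[of _ "\<lambda>x. 0"]) (simp add: L2_rel_def sq_integrable_zero)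
  show "symp (L2_rel :: (real^2 \<Rightarrow> 'b) \<Rightarrow> _)"
    by (rule sympI) (auto simp: L2_rel_def)
  show "transp (L2_rel :: (real^2 \<Rightarrow> 'b) \<Rightarrow> _)"
    by (rule transpI) (auto simp: L2_rel_def)
qed

lemma L2_rel_refl: "L2_rel f f \<longleftrightarrow> sq_integrable f"
  by (auto simp: L2_rel_def)

instantiation L2 :: (euclidean_space) real_inner
begin

lift_definition zero_L2 :: "'a L2" is "\<lambda>x. 0"
  by (simp add: L2_rel_def sq_integrable_zero)

lift_definition plus_L2 :: "'a L2 \<Rightarrow> 'a L2 \<Rightarrow> 'a L2" is "\<lambda>f g x. f x + g x"
  by (auto simp: L2_rel_def intro: sq_integrable_add)

lift_definition minus_L2 :: "'a L2 \<Rightarrow> 'a L2 \<Rightarrow> 'a L2" is "\<lambda>f g x. f x - g x"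
  by (auto simp: L2_rel_def intro: sq_integrable_diff)

lift_definition uminus_L2 :: "'a L2 \<Rightarrow> 'a L2" is "\<lambda>f x. - f x"
  by (auto simp: L2_rel_def intro: sq_integrable_uminus)

lift_definition scaleR_L2 :: "real \<Rightarrow> 'a L2 \<Rightarrow> 'a L2" is "\<lambda>c f x. c *\<^sub>R f x"
  by (auto simp: L2_rel_def intro: sq_integrable_scaleR)

lift_definition inner_L2 :: "'a L2 \<Rightarrow> 'a L2 \<Rightarrow> real" is "\<lambda>f g. LINT x|lborel. f x \<bullet> g x"
proof -
  fix f f' g g' :: "real^2 \<Rightarrow> 'a"
  assume a: "L2_rel f f'" and b: "L2_rel g g'"
  then have m: "f \<in> borel_measurable lborel" "g \<in> borel_measurable lborel"
    "f' \<in> borel_measurable lborel" "g' \<in> borel_measurable lborel"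
    by (auto simp: L2_rel_def sq_integrable_def)
  show "(LINT x|lborel. f x \<bullet> g x) = (LINT x|lborel. f' x \<bullet> g' x)"
  proof (rule integral_cong_AE)
    show "(\<lambda>x. f x \<bullet> g x) \<in> borel_measurable lborel"
      "(\<lambda>x. f' x \<bullet> g' x) \<in> borel_measurable lborel"
      using m by measurable
    show "AE x in lborel. f x \<bullet> g x = f' x \<bullet> g' x"
      using a b by (auto simp: L2_rel_def)
  qed
qed

definition norm_L2 :: "'a L2 \<Rightarrow> real" where "norm_L2 u = sqrt (inner u u)"

definition dist_L2 :: "'a L2 \<Rightarrow> 'a L2 \<Rightarrow> real" where "dist_L2 u v = norm (u - v)"

definition sgn_L2 :: "'a L2 \<Rightarrow> 'a L2" where "sgn_L2 u = inverse (norm u) *\<^sub>R u"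

definition uniformity_L2 :: "('a L2 \<times> 'a L2) filter" where
  "uniformity_L2 = (INF e\<in>{0<..}. principal {(u, v). dist u v < e})"

definition open_L2 :: "'a L2 set \<Rightarrow> bool" where
  "open_L2 U = (\<forall>x\<in>U. eventually (\<lambda>(x', y). x' = x \<longrightarrow> y \<in> U) uniformity)"

instance
proof
  fix u v w :: "'a L2" and a b :: real and U :: "'a L2 set"
  show "u + v + w = u + (v + w)"
    by transfer (auto simp: L2_rel_def add.assoc intro!: sq_integrable_add)
  show "u + v = v + u"
    by transfer (auto simp: L2_rel_def add.commute intro!: sq_integrable_add)
  show "0 + u = u"
    by transfer (auto simp: L2_rel_def)
  show "- u + u = 0"
    by transfer (auto simp: L2_rel_def sq_integrable_zero)
  show "u - v = u + - v"
    by transfer (auto simp: L2_rel_def intro: sq_integrable_diff)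
  show "a *\<^sub>R (u + v) = a *\<^sub>R u + a *\<^sub>R v"
    by transfer (auto simp: L2_rel_def scaleR_add_right[symmetric]
        intro!: sq_integrable_add sq_integrable_scaleR simp del: scaleR_add_right)
  show "(a + b) *\<^sub>R u = a *\<^sub>R u + b *\<^sub>R u"
    by transfer (auto simp: L2_rel_def scaleR_add_left[symmetric]
        intro!: sq_integrable_scaleR simp del: scaleR_add_left)
  show "a *\<^sub>R b *\<^sub>R u = (a * b) *\<^sub>R u"
    by transfer (auto simp: L2_rel_def intro!: sq_integrable_scaleR)
  show "1 *\<^sub>R u = u"
    by transfer (auto simp: L2_rel_def)
  show "dist u v = norm (u - v)" by (rule dist_L2_def)
  show "sgn u = inverse (norm u) *\<^sub>R u" by (rule sgn_L2_def)
  show "uniformity = (INF e\<in>{0<..}. principal {(x :: 'a L2, y). dist x y < e})"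
    by (rule uniformity_L2_def)
  show "open U = (\<forall>x\<in>U. \<forall>\<^sub>F (x', y) in uniformity. x' = x \<longrightarrow> y \<in> U)"
    by (rule open_L2_def)
  show "norm u = sqrt (inner u u)" by (rule norm_L2_def)
  show "inner u v = inner v u"
    by transfer (simp add: inner_commute)
  show "inner (u + v) w = inner u w + inner v w"
    by transfer (simp add: inner_add_left L2_rel_refl sq_integrable_inner)
  show "inner (a *\<^sub>R u) v = a * inner u v"
    by transfer simp
  show "0 \<le> inner u u"
    by transfer simp
  show "(inner u u = 0) = (u = 0)"
  proof transfer
    fix f :: "real^2 \<Rightarrow> 'a"
    assume "L2_rel f f"
    then have f: "sq_integrable f" by (simp add: L2_rel_refl)
    have "(LINT x|lborel. f x \<bullet> f x) = 0 \<longleftrightarrow> (AE x in lborel. f x \<bullet> f x = 0)"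
      by (rule integral_nonneg_eq_0_iff_AE) (auto simp: sq_integrable_inner f)
    then show "((LINT x|lborel. f x \<bullet> f x) = 0) = L2_rel f (\<lambda>x. 0)"
      using f by (simp add: L2_rel_def sq_integrable_zero)
  qed
qed

end

text \<open>The class of a square-integrable function; every other function is sent to \<open>0\<close>.\<close>

definition mk_L2 :: "(real^2 \<Rightarrow> 'b::euclidean_space) \<Rightarrow> 'b L2" where
  "mk_L2 f = (if sq_integrable f then abs_L2 f else 0)"

definition fourier_integral :: "(real^2 \<Rightarrow> complex) \<Rightarrow> real^2 \<Rightarrow> complex" where
  "fourier_integral f \<xi> =
     (LINT x|lborel. f x * exp (- 2 * complex_of_real pi * \<i> * complex_of_real (x \<bullet> \<xi>)))"

text \<open>The Plancherel extension to \<open>L\<^sup>2\<close>: the \<open>L\<^sup>2\<close>-limit of the Fourier integrals of the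
  truncations of \<open>u\<close> to the balls of radius \<open>n\<close>, which are integrable.\<close>

definition fourier_L2 :: "real L2 \<Rightarrow> complex L2" where
  "fourier_L2 u =
     lim (\<lambda>n::nat. mk_L2 (fourier_integral
            (\<lambda>x. if norm x \<le> real n then complex_of_real (rep_L2 u x) else 0)))"

text \<open>Symbols \<open>\<Sum> c\<^bsub>ab\<^esub> (2\<pi>i\<xi>\<^sub>1)\<^sup>a (2\<pi>i\<xi>\<^sub>2)\<^sup>b\<close> of the operators
  \<open>\<Sum> c\<^bsub>ab\<^esub> \<partial>\<^sub>1\<^sup>a \<partial>\<^sub>2\<^sup>b\<close>. The coefficients are real because the
  operators act on real-valued functions.\<close>

definition diffop_symbol :: "(real^2 \<Rightarrow> complex) \<Rightarrow> bool" where
  "diffop_symbol p \<longleftrightarrow>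
     (\<exists>(S :: (nat \<times> nat) set) (c :: nat \<times> nat \<Rightarrow> real). finite S \<and>
        p = (\<lambda>\<xi>. \<Sum>(a, b)\<in>S. complex_of_real (c (a, b))
                 * (2 * complex_of_real pi * \<i> * complex_of_real (\<xi> $ 1)) ^ a
                 * (2 * complex_of_real pi * \<i> * complex_of_real (\<xi> $ 2)) ^ b))"

text \<open>The space of those \<open>u\<close> for which the operator with symbol \<open>p\<close> yields an \<open>L\<^sup>2\<close> function,
  and that operator (with value \<open>0\<close> outside this space).\<close>

definition H_space :: "(real^2 \<Rightarrow> complex) \<Rightarrow> real L2 set" where
  "H_space p = {u. sq_integrable (\<lambda>\<xi>. p \<xi> * rep_L2 (fourier_L2 u) \<xi>)}"

definition diffop :: "(real^2 \<Rightarrow> complex) \<Rightarrow> real L2 \<Rightarrow> real L2" where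
  "diffop p u =
     (if u \<in> H_space p
      then (THE v. AE \<xi> in lborel. rep_L2 (fourier_L2 v) \<xi> = p \<xi> * rep_L2 (fourier_L2 u) \<xi>)
      else 0)"

definition H_norm :: "(real^2 \<Rightarrow> complex) \<Rightarrow> real L2 \<Rightarrow> real" where
  "H_norm l u = norm (diffop l u)"

definition deriv_x2 :: "real L2 \<Rightarrow> real L2" where
  "deriv_x2 = diffop (\<lambda>\<xi>. 2 * complex_of_real pi * \<i> * complex_of_real (\<xi> $ 2))"

definition nonlin :: "nat \<Rightarrow> (nat \<Rightarrow> nat \<Rightarrow> real^2 \<Rightarrow> complex) \<Rightarrow> real L2 \<Rightarrow> real L2" where
  "nonlin N g u = (\<Sum>i=2..N. mk_L2 (\<lambda>x. \<Prod>p=1..i. rep_L2 (diffop (g i p) u) x))"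

definition rot :: "real \<Rightarrow> real^2 \<Rightarrow> real^2" where
  "rot \<theta> x = vector [cos \<theta> * x $ 1 - sin \<theta> * x $ 2, sin \<theta> * x $ 1 + cos \<theta> * x $ 2]"

definition refl_x1 :: "real^2 \<Rightarrow> real^2" where
  "refl_x1 x = vector [- (x $ 1), x $ 2]"

definition pullback :: "(real^2 \<Rightarrow> real^2) \<Rightarrow> real L2 \<Rightarrow> real L2" where
  "pullback T u = mk_L2 (\<lambda>x. rep_L2 u (T x))"

inductive_set generated :: "('a \<Rightarrow> 'a) set \<Rightarrow> ('a \<Rightarrow> 'a) set" for S where
  generated_id: "id \<in> generated S"
| generated_mult: "s \<in> S \<Longrightarrow> t \<in> generated S \<Longrightarrow> s \<circ> t \<in> generated S"
| generated_inv: "s \<in> S \<Longrightarrow> t \<in> generated S \<Longrightarrow> inv s \<circ> t \<in> generated S"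

definition dihedral :: "nat \<Rightarrow> (real^2 \<Rightarrow> real^2) set" where
  "dihedral j = generated {rot (2 * pi / real j), refl_x1}"

definition Z2Z1 :: "(real^2 \<Rightarrow> real^2) set" where
  "Z2Z1 = generated {refl_x1}"

definition L2_sym :: "(real^2 \<Rightarrow> real^2) set \<Rightarrow> real L2 set" where
  "L2_sym K = {u. \<forall>T\<in>K. AE x in lborel. rep_L2 u (T x) = rep_L2 u x}"

definition H_sym :: "(real^2 \<Rightarrow> complex) \<Rightarrow> (real^2 \<Rightarrow> real^2) set \<Rightarrow> real L2 set" where
  "H_sym l K = H_space l \<inter> L2_sym K"

definition commutes_with ::
    "(real^2 \<Rightarrow> complex) \<Rightarrow> (real L2 \<Rightarrow> real L2) \<Rightarrow> (real^2 \<Rightarrow> real^2) \<Rightarrow> bool" where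
  "commutes_with l M T \<longleftrightarrow>
     (\<forall>u\<in>H_space l. pullback T u \<in> H_space l \<and> M (pullback T u) = pullback T (M u))"

definition euclidean_equivariant ::
    "(real^2 \<Rightarrow> complex) \<Rightarrow> (real L2 \<Rightarrow> real L2) \<Rightarrow> bool" where
  "euclidean_equivariant l M \<longleftrightarrow>
     (\<forall>a. commutes_with l M (\<lambda>x. x + a)) \<and> (\<forall>\<theta>. commutes_with l M (rot \<theta>)) \<and>
     commutes_with l M refl_x1"

definition rot_average :: "nat \<Rightarrow> real L2 \<Rightarrow> real L2" where
  "rot_average j u = (1 / real j) *\<^sub>R (\<Sum>k<j. pullback (rot (2 * pi * real k / real j)) u)"

text \<open>\<open>V\<close> and \<open>W\<close> are linear subspaces of the ambient types and \<open>nV\<close>, \<open>nW\<close> are norms on them,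
  in general different from the ambient ones. Nothing is said about maps outside \<open>V\<close>.\<close>

definition bounded_linear_between ::
    "'a::real_vector set \<Rightarrow> ('a \<Rightarrow> real) \<Rightarrow> 'b::real_vector set \<Rightarrow> ('b \<Rightarrow> real) \<Rightarrow> ('a \<Rightarrow> 'b) \<Rightarrow> bool" where
  "bounded_linear_between V nV W nW T \<longleftrightarrow>
     (\<forall>u\<in>V. T u \<in> W) \<and>
     (\<forall>u\<in>V. \<forall>v\<in>V. T (u + v) = T u + T v) \<and>
     (\<forall>a. \<forall>u\<in>V. T (a *\<^sub>R u) = a *\<^sub>R T u) \<and>
     (\<exists>C. \<forall>u\<in>V. nW (T u) \<le> C * nV u)"

text \<open>As for \<^const>\<open>onorm\<close>, the quotient at \<open>0\<close> is \<open>0 / 0 = 0\<close>, and the supremum is meaningful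
  for bounded operators.\<close>

definition onorm_on :: "'a set \<Rightarrow> ('a \<Rightarrow> real) \<Rightarrow> ('b \<Rightarrow> real) \<Rightarrow> ('a \<Rightarrow> 'b) \<Rightarrow> real" where
  "onorm_on V nV nW T = (SUP u\<in>V. nW (T u) / nV u)"

definition has_fderiv_on ::
    "'a::real_vector set \<Rightarrow> ('a \<Rightarrow> real) \<Rightarrow> ('a \<Rightarrow> 'b::real_normed_vector) \<Rightarrow> 'a \<Rightarrow> ('a \<Rightarrow> 'b) \<Rightarrow> bool" where
  "has_fderiv_on V nV \<Phi> x D \<longleftrightarrow>
     bounded_linear_between V nV UNIV norm D \<and>
     (\<forall>\<epsilon>>0. \<exists>\<delta>>0. \<forall>v\<in>V. nV v < \<delta> \<longrightarrow> norm (\<Phi> (x + v) - \<Phi> x - D v) \<le> \<epsilon> * nV v)"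

text \<open>Determined on \<open>V\<close> only.\<close>

definition fderiv_on ::
    "'a::real_vector set \<Rightarrow> ('a \<Rightarrow> real) \<Rightarrow> ('a \<Rightarrow> 'b::real_normed_vector) \<Rightarrow> 'a \<Rightarrow> 'a \<Rightarrow> 'b" where
  "fderiv_on V nV \<Phi> x = (SOME D. has_fderiv_on V nV \<Phi> x D)"

definition bounded_multilinear_on ::
    "'a::real_vector set \<Rightarrow> ('a \<Rightarrow> real) \<Rightarrow> nat \<Rightarrow> ('a list \<Rightarrow> 'b::real_normed_vector) \<Rightarrow> bool" where
  "bounded_multilinear_on V nV k M \<longleftrightarrow>
     (\<forall>vs. length vs = k \<longrightarrow> set vs \<subseteq> V \<longrightarrow>
        (\<forall>i<k. \<forall>u\<in>V. \<forall>v\<in>V. \<forall>a.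
           M (vs[i := u + v]) = M (vs[i := u]) + M (vs[i := v]) \<and>
           M (vs[i := a *\<^sub>R u]) = a *\<^sub>R M (vs[i := u]))) \<and>
     (\<exists>C. \<forall>vs. length vs = k \<longrightarrow> set vs \<subseteq> V \<longrightarrow> norm (M vs) \<le> C * prod_list (map nV vs))"

text \<open>Smoothness in the Frechet sense: \<open>D x [v\<^sub>1, \<dots>, v\<^sub>k]\<close> is the derivative of order \<open>k\<close> at \<open>x\<close>, and
  the derivative of order \<open>k + 1\<close> is the derivative of the one of order \<open>k\<close> with respect to the
  norm of bounded \<open>k\<close>-linear maps.\<close>

definition smooth_on_normed ::
    "'a::real_vector set \<Rightarrow> ('a \<Rightarrow> real) \<Rightarrow> ('a \<Rightarrow> 'b::real_normed_vector) \<Rightarrow> bool" where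
  "smooth_on_normed V nV \<Phi> \<longleftrightarrow>
     (\<exists>D :: 'a \<Rightarrow> 'a list \<Rightarrow> 'b.
        (\<forall>x\<in>V. D x [] = \<Phi> x) \<and>
        (\<forall>x\<in>V. \<forall>k. bounded_multilinear_on V nV k (D x)) \<and>
        (\<forall>x\<in>V. \<forall>k. \<forall>\<epsilon>>0. \<exists>\<delta>>0. \<forall>v\<in>V. nV v < \<delta> \<longrightarrow>
           (\<forall>vs. length vs = k \<longrightarrow> set vs \<subseteq> V \<longrightarrow>
              norm (D (x + v) vs - D x vs - D x (v # vs)) \<le> \<epsilon> * nV v * prod_list (map nV vs))))"

definition trig_poly_on_square :: "real \<Rightarrow> real L2 \<Rightarrow> bool" where
  "trig_poly_on_square d u \<longleftrightarrow>
     (\<exists>(S :: (int \<times> int) set) (c :: int \<times> int \<Rightarrow> complex). finite S \<and>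
        (AE x in lborel. (\<forall>i. \<bar>x $ i\<bar> < d) \<longrightarrow>
           complex_of_real (rep_L2 u x) =
             (\<Sum>(m, n)\<in>S. c (m, n) *
                exp (2 * complex_of_real pi * \<i> *
                     complex_of_real ((of_int m * x $ 1 + of_int n * x $ 2) / (2 * d))))))"

definition supported_in_square :: "real \<Rightarrow> real L2 \<Rightarrow> bool" where
  "supported_in_square d u \<longleftrightarrow> (AE x in lborel. (\<exists>i. \<bar>x $ i\<bar> > d) \<longrightarrow> rep_L2 u x = 0)"

definition G_tilde ::
    "nat \<Rightarrow> (nat \<Rightarrow> nat \<Rightarrow> real^2 \<Rightarrow> complex) \<Rightarrow> nat \<Rightarrow> real L2 \<Rightarrow> real L2" where
  "G_tilde N g j u\<^sub>0 = nonlin N g (rot_average j u\<^sub>0) - rot_average j (nonlin N g u\<^sub>0)"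

definition f_aug ::
    "(real^2 \<Rightarrow> complex) \<Rightarrow> nat \<Rightarrow> (nat \<Rightarrow> nat \<Rightarrow> real^2 \<Rightarrow> complex) \<Rightarrow> real \<Rightarrow> real L2
       \<Rightarrow> real \<times> real L2 \<Rightarrow> real L2" where
  "f_aug l N g \<rho> w\<^sub>0 = (\<lambda>(\<beta>, w). diffop l w + nonlin N g w + \<beta> *\<^sub>R (deriv_x2 w\<^sub>0 /\<^sub>R \<rho>))"

definition F_aug ::
    "(real^2 \<Rightarrow> complex) \<Rightarrow> nat \<Rightarrow> (nat \<Rightarrow> nat \<Rightarrow> real^2 \<Rightarrow> complex) \<Rightarrow> real \<Rightarrow> real L2
       \<Rightarrow> real \<times> real L2 \<Rightarrow> real \<times> real L2" where
  "F_aug l N g \<rho> w\<^sub>0 = (\<lambda>(\<beta>, w).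
     (1 / \<rho> * (diffop l (w - w\<^sub>0) \<bullet> deriv_x2 w\<^sub>0), f_aug l N g \<rho> w\<^sub>0 (\<beta>, w)))"

definition aug_space :: "(real^2 \<Rightarrow> complex) \<Rightarrow> (real^2 \<Rightarrow> real^2) set \<Rightarrow> (real \<times> real L2) set" where
  "aug_space l K = UNIV \<times> H_sym l K"

definition aug_norm :: "(real^2 \<Rightarrow> complex) \<Rightarrow> real \<times> real L2 \<Rightarrow> real" where
  "aug_norm l = (\<lambda>(\<beta>, w). sqrt (\<bar>\<beta>\<bar>\<^sup>2 + (H_norm l w)\<^sup>2))"

definition aug_onorm ::
    "(real^2 \<Rightarrow> complex) \<Rightarrow> (real \<times> real L2 \<Rightarrow> real \<times> real L2) \<Rightarrow> real" where
  "aug_onorm l = onorm_on (aug_space l Z2Z1) (aug_norm l) (aug_norm l)"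

text \<open>The derivative along the space of functions symmetric under the reflection only, which is
  larger than the space containing the base points that are used.\<close>

definition DF_aug ::
    "(real^2 \<Rightarrow> complex) \<Rightarrow> nat \<Rightarrow> (nat \<Rightarrow> nat \<Rightarrow> real^2 \<Rightarrow> complex) \<Rightarrow> real \<Rightarrow> real L2
       \<Rightarrow> real \<times> real L2 \<Rightarrow> real \<times> real L2 \<Rightarrow> real \<times> real L2" where
  "DF_aug l N g \<rho> w\<^sub>0 = fderiv_on (aug_space l Z2Z1) (aug_norm l) (F_aug l N g \<rho> w\<^sub>0)"

definition Q_aug ::
    "(real^2 \<Rightarrow> complex) \<Rightarrow> nat \<Rightarrow> (nat \<Rightarrow> nat \<Rightarrow> real^2 \<Rightarrow> complex) \<Rightarrow> real \<Rightarrow> real L2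
       \<Rightarrow> real \<times> real L2 \<Rightarrow> real \<times> real L2" where
  "Q_aug l N g \<rho> u\<^sub>0 = (\<lambda>(\<beta>, v).
     ((deriv_x2 u\<^sub>0 /\<^sub>R \<rho>) \<bullet> diffop l v,
      \<beta> *\<^sub>R (deriv_x2 u\<^sub>0 /\<^sub>R \<rho>) + diffop l v
        + fderiv_on (H_space l) (H_norm l) (nonlin N g) u\<^sub>0 v))"

definition H1_ball ::
    "(real^2 \<Rightarrow> complex) \<Rightarrow> nat \<Rightarrow> real \<times> real L2 \<Rightarrow> real \<Rightarrow> (real \<times> real L2) set" where
  "H1_ball l j h\<^sub>0 r = {h \<in> aug_space l (dihedral j). aug_norm l (h - h\<^sub>0) < r}"

definition H1_cball ::
    "(real^2 \<Rightarrow> complex) \<Rightarrow> nat \<Rightarrow> real \<times> real L2 \<Rightarrow> real \<Rightarrow> (real \<times> real L2) set" where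
  "H1_cball l j h\<^sub>0 r = {h \<in> aug_space l (dihedral j). aug_norm l (h - h\<^sub>0) \<le> r}"

end

(*
  Symmetrization reduces the claim to the Newton-Kantorovich theorem on D_j-symmetric functions,
  although the approximate inverse A does not respect that symmetry. In the coordinates (beta, L w)
  the derivative DF(0, w0) becomes a compact perturbation T of the identity: since L is rotation
  invariant, its symbol is radial, hence bounded away from 0, and the quotients g_{i,p}/l are bounded
  and in L^2, so every term of DG(w0) is a product of a localized function with a convolution by an
  L^2 kernel. The bounds Z_1 and Z_s give |A T x| >= (1 - Z_1 - Z_s) |x|, so T is injective with
  closed range and, by compactness, onto. The average P over the rotations commutes with T and
  annihilates d/dx_2 w0; applying P to the solution of T x = (0, f) therefore solves the
  symmetrized equation with no loss of norm. Thus the true inverse of L + DG(w0) on D_j-symmetric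
  functions inherits all the bounds assumed for A, and Newton's map with this inverse is a
  contraction. On D_j-symmetric functions the first component of F vanishes identically.
*)

theory Submission
  imports Defs "HOL-Probability.Characteristic_Functions"
    "HOL-Computational_Algebra.Fundamental_Theorem_Algebra"
begin

section \<open>Completeness of \<open>L\<^sup>2\<close>\<close>

text \<open>The bounds on \<open>A\<close> make A T close to the identity for T = DF(0, w0). That
  gives T a left inverse but says nothing about its range, and \<open>A\<close> may a priori have a
  kernel, so a zero of A F need not be a zero of F. Surjectivity of T has to come from compactness.
  Afterwards \<open>\<kappa>\<close> = 1 - Z_1 - Z_s satisfies \<kappa> |T^{-1} \<eta>| \<le> |A
  \<eta>|, and the bounds assumed for \<open>A\<close> are used as bounds on such a right-hand side.
  Since \<kappa> is also the linear coefficient of the radii polynomial, no constant is lost.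
  Positivity of |l| alone does not bound it below: x^2 + (x y - 1)^2 is positive with infimum 0. A
  radial symbol is a polynomial in one variable without real roots; its factors give a lower bound
  and comparability at bounded distance, and the latter takes g/l from L^1 to boundedness. The
  operators are defined through the transform on L^2, so solving L u = y needs the exact range of
  that transform, the Hermitian functions. This is why Plancherel is proved in full, through a
  transform of real functions that inverts itself.\<close>

lemma sq_integrable_rep_L2: "sq_integrable (rep_L2 u)"
  using Quotient_rep_reflp[OF Quotient_L2, of u] by (simp add: L2_rel_refl)

lemma rep_L2_borel [measurable]: "rep_L2 u \<in> borel_measurable borel"
  using sq_integrable_rep_L2[of u] by (simp add: sq_integrable_def)

lemma mk_L2_rep_L2 [simp]: "mk_L2 (rep_L2 u) = u"
  by (simp add: mk_L2_def sq_integrable_rep_L2 Quotient_abs_rep[OF Quotient_L2])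

lemma AE_rep_mk_L2:
  assumes "sq_integrable f"
  shows "AE x in lborel. rep_L2 (mk_L2 f) x = f x"
proof -
  have "L2_rel (rep_L2 (abs_L2 f)) f"
    using assms Quotient_rep_abs[OF Quotient_L2, of f] by (simp add: L2_rel_refl)
  then show ?thesis using assms by (simp add: mk_L2_def L2_rel_def)
qed

lemma mk_L2_cong:
  assumes "sq_integrable f" "sq_integrable g" "AE x in lborel. f x = g x"
  shows "mk_L2 f = mk_L2 g"
  using assms Quotient_rel_abs[OF Quotient_L2, of f g] by (simp add: mk_L2_def L2_rel_def)

lemma L2_eqI:
  assumes "AE x in lborel. rep_L2 u x = rep_L2 v x"
  shows "u = v"
  using mk_L2_cong[OF sq_integrable_rep_L2 sq_integrable_rep_L2 assms] by simp

lemma mk_L2_eqI: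
  assumes "sq_integrable f" "AE x in lborel. f x = rep_L2 v x"
  shows "mk_L2 f = v"
  using mk_L2_cong[OF assms(1) sq_integrable_rep_L2 assms(2)] by simp

lemma mk_L2_zero: "mk_L2 (\<lambda>x. 0) = 0"
  by (simp add: mk_L2_def sq_integrable_zero zero_L2.abs_eq)

lemma mk_L2_add: "sq_integrable f \<Longrightarrow> sq_integrable g \<Longrightarrow> mk_L2 (\<lambda>x. f x + g x) = mk_L2 f + mk_L2 g"
  by (simp add: mk_L2_def sq_integrable_add plus_L2.abs_eq L2_rel_refl)

lemma mk_L2_diff: "sq_integrable f \<Longrightarrow> sq_integrable g \<Longrightarrow> mk_L2 (\<lambda>x. f x - g x) = mk_L2 f - mk_L2 g"
  by (simp add: mk_L2_def sq_integrable_diff minus_L2.abs_eq L2_rel_refl)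

lemma mk_L2_scaleR: "sq_integrable f \<Longrightarrow> mk_L2 (\<lambda>x. c *\<^sub>R f x) = c *\<^sub>R mk_L2 f"
  by (simp add: mk_L2_def sq_integrable_scaleR scaleR_L2.abs_eq L2_rel_refl)

lemma AE_rep_add: "AE x in lborel. rep_L2 (u + v) x = rep_L2 u x + rep_L2 v x"
  using AE_rep_mk_L2[OF sq_integrable_add[OF sq_integrable_rep_L2[of u] sq_integrable_rep_L2[of v]]]
  by (simp add: mk_L2_add sq_integrable_rep_L2)

lemma AE_rep_diff: "AE x in lborel. rep_L2 (u - v) x = rep_L2 u x - rep_L2 v x"
  using AE_rep_mk_L2[OF sq_integrable_diff[OF sq_integrable_rep_L2[of u] sq_integrable_rep_L2[of v]]]
  by (simp add: mk_L2_diff sq_integrable_rep_L2)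

lemma AE_rep_scaleR: "AE x in lborel. rep_L2 (c *\<^sub>R u) x = c *\<^sub>R rep_L2 u x"
  using AE_rep_mk_L2[OF sq_integrable_scaleR[OF sq_integrable_rep_L2[of u]]]
  by (simp add: mk_L2_scaleR sq_integrable_rep_L2)

lemma AE_rep_zero: "AE x in lborel. rep_L2 0 x = 0"
  using AE_rep_mk_L2[OF sq_integrable_zero] by (simp add: mk_L2_zero)

lemma inner_L2_mk:
  "sq_integrable f \<Longrightarrow> sq_integrable g \<Longrightarrow> inner (mk_L2 f) (mk_L2 g) = (LINT x|lborel. f x \<bullet> g x)"
  by (simp add: mk_L2_def inner_L2.abs_eq L2_rel_refl)

lemma inner_L2_rep: "inner u v = (LINT x|lborel. rep_L2 u x \<bullet> rep_L2 v x)"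
  using inner_L2_mk[OF sq_integrable_rep_L2[of u] sq_integrable_rep_L2[of v]] by simp

lemma norm_mk_L2: "sq_integrable f \<Longrightarrow> (norm (mk_L2 f))\<^sup>2 = (LINT x|lborel. (norm (f x))\<^sup>2)"
  by (simp add: power2_norm_eq_inner inner_L2_mk)

lemma norm_L2_rep: "(norm u)\<^sup>2 = (LINT x|lborel. (norm (rep_L2 u x))\<^sup>2)"
  using norm_mk_L2[OF sq_integrable_rep_L2[of u]] by simp

text \<open>Fatou's lemma for the squared norms. The limit is only almost everywhere, so
  measurability of \<open>h\<close> does not come for free.\<close>

lemma sq_integrable_AE_limit:
  assumes f: "\<And>m. sq_integrable (f m)" and C: "\<And>m. (LINT x|lborel. (norm (f m x))\<^sup>2) \<le> C"
    and lim: "AE x in lborel. (\<lambda>m. f m x) \<longlonglongrightarrow> h x" and h: "h \<in> borel_measurable lborel"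
  shows "sq_integrable h \<and> (LINT x|lborel. (norm (h x))\<^sup>2) \<le> C"
proof -
  have [measurable]: "\<And>m. f m \<in> borel_measurable borel" "h \<in> borel_measurable borel"
    using f h by (auto simp: sq_integrable_def)
  have C0: "0 \<le> C" using C[of 0] by (rule order_trans[rotated]) simp
  have e: "(\<integral>\<^sup>+x. ennreal ((norm (f m x))\<^sup>2) \<partial>lborel) \<le> ennreal C" for m
  proof -
    have "(\<integral>\<^sup>+x. ennreal ((norm (f m x))\<^sup>2) \<partial>lborel) = ennreal (LINT x|lborel. (norm (f m x))\<^sup>2)"
      using f[of m] by (intro nn_integral_eq_integral) (auto simp: sq_integrable_def)
    then show ?thesis using C[of m] by (simp add: ennreal_leI)
  qed
  have "(\<integral>\<^sup>+x. ennreal ((norm (h x))\<^sup>2) \<partial>lborel) = (\<integral>\<^sup>+x. liminf (\<lambda>m. ennreal ((norm (f m x))\<^sup>2)) \<partial>lborel)"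
  proof (rule nn_integral_cong_AE, use lim in eventually_elim)
    fix x assume "(\<lambda>m. f m x) \<longlonglongrightarrow> h x"
    then have "(\<lambda>m. ennreal ((norm (f m x))\<^sup>2)) \<longlonglongrightarrow> ennreal ((norm (h x))\<^sup>2)"
      by (intro tendsto_intros)
    then show "ennreal ((norm (h x))\<^sup>2) = liminf (\<lambda>m. ennreal ((norm (f m x))\<^sup>2))"
      by (metis lim_imp_Liminf sequentially_bot)
  qed
  also have "\<dots> \<le> liminf (\<lambda>m. \<integral>\<^sup>+x. ennreal ((norm (f m x))\<^sup>2) \<partial>lborel)"
    by (rule nn_integral_liminf) measurable
  also have "\<dots> \<le> ennreal C"
    using e by (intro Liminf_le) auto
  finally have le: "(\<integral>\<^sup>+x. ennreal ((norm (h x))\<^sup>2) \<partial>lborel) \<le> ennreal C" .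
  then have int: "integrable lborel (\<lambda>x. (norm (h x))\<^sup>2)"
    by (intro integrableI_nonneg) (auto simp: ennreal_less_top intro: le_less_trans)
  then have "ennreal (LINT x|lborel. (norm (h x))\<^sup>2) \<le> ennreal C"
    using le by (subst nn_integral_eq_integral[symmetric]) auto
  then show ?thesis using int C0 by (auto simp: sq_integrable_def)
qed

text \<open>Riesz-Fischer: a fast subsequence converges almost everywhere, Fatou turns this into
  norm convergence, and a Cauchy sequence follows its subsequence.\<close>

lemma complete_L2: 
  fixes X :: "nat \<Rightarrow> 'b::euclidean_space L2"
  assumes X: "Cauchy X"
  shows "convergent X"
proof -
  have "\<exists>r. strict_mono r \<and> (\<forall>k. dist (X (r (Suc k))) (X (r k)) < (1/2)^k)"
  proof -
    have *: "\<exists>N. \<forall>m\<ge>N. \<forall>n\<ge>N. dist (X m) (X n) < (1/2)^k" for k :: nat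
      using X by (meson metric_CauchyD zero_less_power half_gt_zero zero_less_one)
    then obtain N where N: "\<And>k m n. m \<ge> N k \<Longrightarrow> n \<ge> N k \<Longrightarrow> dist (X m) (X n) < (1/2::real)^k"
      by metis
    define r where "r = rec_nat (N 0) (\<lambda>k p. max (Suc p) (N (Suc k)))"
    have r: "r 0 = N 0" "\<And>k. r (Suc k) = max (Suc (r k)) (N (Suc k))" by (auto simp: r_def)
    have rN: "r k \<ge> N k" for k by (cases k) (auto simp: r)
    have sm: "strict_mono r" by (rule strict_mono_Suc_iff[THEN iffD2]) (auto simp: r)
    have "dist (X (r (Suc k))) (X (r k)) < (1/2)^k" for k
      using N[of k "r (Suc k)" "r k"] rN[of k] by (simp add: r)
    then show ?thesis using sm by auto
  qed
  then obtain r where r: "strict_mono r" "\<And>k. dist (X (r (Suc k))) (X (r k)) < (1/2)^k" by auto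
  define f where "f k = rep_L2 (X (r k))" for k
  have [measurable]: "f k \<in> borel_measurable borel" for k by (simp add: f_def)
  have sqf: "sq_integrable (f k)" for k by (simp add: f_def sq_integrable_rep_L2)
  have norm_diff: "(LINT x|lborel. (norm (f m x - f k x))\<^sup>2) = (dist (X (r m)) (X (r k)))\<^sup>2" for m k
    using norm_mk_L2[OF sq_integrable_diff[OF sqf[of m] sqf[of k]]] mk_L2_diff[OF sqf[of m] sqf[of k]]
    by (simp add: dist_norm f_def)
  have int_diff: "integrable lborel (\<lambda>x. (norm (f m x - f k x))\<^sup>2)" for m k
    using sq_integrable_diff[OF sqf[of m] sqf[of k]] by (simp add: sq_integrable_def)
  \<comment> \<open>The squared increments integrate to at most 4^-k, so the weight 2^k still leaves
    a finite sum. Almost everywhere finiteness of the weighted sum then bounds the increments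
    themselves by a multiple of 2^(-k/2), which is summable.\<close>
  have "(\<integral>\<^sup>+x. (\<Sum>k. ennreal (2^k * (norm (f (Suc k) x - f k x))\<^sup>2)) \<partial>lborel)
      = (\<Sum>k. \<integral>\<^sup>+x. ennreal (2^k * (norm (f (Suc k) x - f k x))\<^sup>2) \<partial>lborel)"
    by (rule nn_integral_suminf) measurable
  also have "\<dots> \<le> (\<Sum>k. ennreal ((1/2)^k))"
  proof (rule suminf_le)
    fix k
    have "(\<integral>\<^sup>+x. ennreal (2^k * (norm (f (Suc k) x - f k x))\<^sup>2) \<partial>lborel)
       = ennreal (2^k * (dist (X (r (Suc k))) (X (r k)))\<^sup>2)"
      by (subst nn_integral_eq_integral) (auto simp: int_diff norm_diff)
    also have "\<dots> \<le> ennreal ((1/2)^k)"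
    proof (rule ennreal_leI)
      have "(dist (X (r (Suc k))) (X (r k)))\<^sup>2 \<le> ((1/2)^k)\<^sup>2"
        using r(2)[of k] by (intro power_mono) auto
      then have "2^k * (dist (X (r (Suc k))) (X (r k)))\<^sup>2 \<le> 2^k * ((1/2)^k)\<^sup>2" by simp
      also have "2^k * ((1/2)^k)\<^sup>2 = (1/2::real)^k"
        by (simp add: power2_eq_square power_divide)
      finally show "2^k * (dist (X (r (Suc k))) (X (r k)))\<^sup>2 \<le> (1/2)^k" .
    qed
    finally show "(\<integral>\<^sup>+x. ennreal (2^k * (norm (f (Suc k) x - f k x))\<^sup>2) \<partial>lborel) \<le> ennreal ((1/2)^k)" .
  qed auto
  also have "\<dots> = ennreal (\<Sum>k. (1/2)^k)"
    by (rule suminf_ennreal2) (auto intro: summable_geometric)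
  also have "\<dots> < \<infinity>" by simp
  finally have fin: "(\<integral>\<^sup>+x. (\<Sum>k. ennreal (2^k * (norm (f (Suc k) x - f k x))\<^sup>2)) \<partial>lborel) < \<infinity>" .
  have "AE x in lborel. (\<Sum>k. ennreal (2^k * (norm (f (Suc k) x - f k x))\<^sup>2)) \<noteq> \<infinity>"
    using fin by (intro nn_integral_PInf_AE) auto
  then have conv: "AE x in lborel. convergent (\<lambda>k. f k x)"
  proof eventually_elim
    fix x assume a: "(\<Sum>k. ennreal (2^k * (norm (f (Suc k) x - f k x))\<^sup>2)) \<noteq> \<infinity>"
    then have sm: "summable (\<lambda>k. 2^k * (norm (f (Suc k) x - f k x))\<^sup>2)"
      by (intro summable_suminf_not_top) (auto simp: top_ennreal_def)
    then have "bounded (range (\<lambda>k. 2^k * (norm (f (Suc k) x - f k x))\<^sup>2))"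
      using summable_imp_bounded by blast
    then obtain B where B: "\<And>k. 2^k * (norm (f (Suc k) x - f k x))\<^sup>2 \<le> B"
      unfolding bounded_iff by fastforce
    have B0: "0 \<le> B" using B[of 0] by (rule order_trans[rotated]) simp
    have le: "norm (f (Suc k) x - f k x) \<le> sqrt B * (1 / sqrt 2)^k" for k
    proof -
      have "(norm (f (Suc k) x - f k x))\<^sup>2 \<le> B / 2^k"
        using B[of k] by (simp add: field_simps)
      then have "norm (f (Suc k) x - f k x) \<le> sqrt (B / 2^k)"
        by (rule real_le_rsqrt)
      also have "sqrt (B / 2^k) = sqrt B * (1 / sqrt 2)^k"
        by (simp add: real_sqrt_divide real_sqrt_power power_one_over)
      finally show ?thesis .
    qed
    have "summable (\<lambda>k. sqrt B * (1 / sqrt 2)^k)"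
      by (intro summable_mult summable_geometric) simp
    then have "summable (\<lambda>k. f (Suc k) x - f k x)"
      by (rule summable_comparison_test'[where N=0]) (rule le)
    then have "convergent (\<lambda>n. \<Sum>k<n. f (Suc k) x - f k x)"
      by (simp add: summable_iff_convergent)
    then have "convergent (\<lambda>n. (\<Sum>k<n. f (Suc k) x - f k x) + f 0 x)"
      by (intro convergent_add convergent_const)
    then show "convergent (\<lambda>k. f k x)" by (simp add: sum_lessThan_telescope[of "\<lambda>k. f k x"])
  qed
  define h where "h x = lim (\<lambda>k. f k x)" for x
  have hm [measurable]: "h \<in> borel_measurable borel" unfolding h_def
    by (rule borel_measurable_lim_metric) measurable
  have lim: "AE x in lborel. (\<lambda>k. f k x) \<longlonglongrightarrow> h x"
    using conv by eventually_elim (simp add: h_def convergent_LIMSEQ_iff)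
  \<comment> \<open>Fatou with \<open>k\<close> fixed and the later index running: a Cauchy estimate
    for the subsequence becomes an estimate for the distance from \<open>f k\<close> to the
    limit.\<close>
  have key: "sq_integrable (\<lambda>x. h x - f k x) \<and> (LINT x|lborel. (norm (h x - f k x))\<^sup>2) \<le> e\<^sup>2"
    if e: "\<And>m. dist (X (r (m + k))) (X (r k)) \<le> e" for e k
  proof (rule sq_integrable_AE_limit)
    show "sq_integrable (\<lambda>x. f (m + k) x - f k x)" for m by (intro sq_integrable_diff sqf)
    show "(LINT x|lborel. (norm (f (m + k) x - f k x))\<^sup>2) \<le> e\<^sup>2" for m
      unfolding norm_diff using e[of m] by (intro power_mono) auto
    show "AE x in lborel. (\<lambda>m. f (m + k) x - f k x) \<longlonglongrightarrow> h x - f k x"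
      using lim by eventually_elim (intro tendsto_intros LIMSEQ_ignore_initial_segment)
  qed measurable
  have ex: "\<exists>K. \<forall>k\<ge>K. \<forall>m. dist (X (r (m + k))) (X (r k)) \<le> e" if "e > 0" for e
  proof -
    obtain N where N: "\<And>m n. m \<ge> N \<Longrightarrow> n \<ge> N \<Longrightarrow> dist (X m) (X n) < e"
      using metric_CauchyD[OF X \<open>e > 0\<close>] by auto
    have "\<forall>k\<ge>N. \<forall>m. dist (X (r (m + k))) (X (r k)) \<le> e"
      using N seq_suble[OF r(1)] by (meson le_trans less_imp_le le_add2)
    then show ?thesis by blast
  qed
  obtain K where "\<forall>k\<ge>K. \<forall>m. dist (X (r (m + k))) (X (r k)) \<le> 1" using ex[of 1] by auto
  then have "sq_integrable (\<lambda>x. h x - f K x)" using key[of K 1] by auto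
  from sq_integrable_add[OF this sqf[of K]] have sqh: "sq_integrable h" by simp
  have "(\<lambda>k. X (r k)) \<longlonglongrightarrow> mk_L2 h"
  proof (rule metric_LIMSEQ_I)
    fix e :: real assume "e > 0"
    then obtain K where K: "\<forall>k\<ge>K. \<forall>m. dist (X (r (m + k))) (X (r k)) \<le> e/2" using ex[of "e/2"] by auto
    have "dist (X (r k)) (mk_L2 h) < e" if "k \<ge> K" for k
    proof -
      have "(norm (mk_L2 h - X (r k)))\<^sup>2 = (LINT x|lborel. (norm (h x - f k x))\<^sup>2)"
        using norm_mk_L2[OF sq_integrable_diff[OF sqh sqf[of k]]] mk_L2_diff[OF sqh sqf[of k]]
        by (simp add: f_def)
      also have "\<dots> \<le> (e/2)\<^sup>2" using key[of k "e/2"] K that by auto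
      finally have "norm (mk_L2 h - X (r k)) \<le> e/2" using \<open>e > 0\<close> by (auto dest: power2_le_imp_le)
      then show ?thesis using \<open>e > 0\<close> by (simp add: dist_norm norm_minus_commute)
    qed
    then show "\<exists>K. \<forall>k\<ge>K. dist (X (r k)) (mk_L2 h) < e" by blast
  qed
  then have "X \<longlonglongrightarrow> mk_L2 h"
    by (intro Cauchy_converges_subseq[OF X r(1)]) (simp add: o_def)
  then show ?thesis by (auto simp: convergent_def)
qed

instance L2 :: (euclidean_space) complete_space
  by standard (rule complete_L2)

section \<open>Orthogonal changes of variables\<close>

lemma orthogonal_transformation_borel [measurable_dest]:
  fixes T :: "real^2 \<Rightarrow> real^2"
  assumes "orthogonal_transformation T"
  shows "T \<in> borel_measurable borel"
  using assms
  by (intro borel_measurable_continuous_onI linear_continuous_on)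
     (simp add: orthogonal_transformation_linear linear_conv_bounded_linear[symmetric])

text \<open>Boxes determine \<open>lborel\<close>, and the preimage of a box is its image under the
  inverse map, which is again orthogonal and so preserves measure.\<close>

lemma lborel_distr_orthogonal:
  fixes T :: "real^2 \<Rightarrow> real^2"
  assumes T: "orthogonal_transformation T"
  shows "distr lborel borel T = lborel"
proof (rule lborel_eqI[symmetric])
  fix l u :: "real^2"
  assume le: "\<And>b. b \<in> Basis \<Longrightarrow> l \<bullet> b \<le> u \<bullet> b"
  note [measurable] = orthogonal_transformation_borel[OF T]
  have inv: "orthogonal_transformation (inv T)" "bij T"
    using T by (auto simp: orthogonal_transformation_inv orthogonal_transformation_bij)
  have eq: "T -` box l u = inv T ` box l u"
    using inv(2) by (simp add: bij_vimage_eq_inv_image)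
  have lm: "inv T ` box l u \<in> lmeasurable"
    by (rule measurable_orthogonal_image[OF inv(1)]) simp
  have "emeasure (distr lborel borel T) (box l u) = emeasure lborel (T -` box l u)"
    by (simp add: emeasure_distr)
  also have "\<dots> = emeasure lebesgue (inv T ` box l u)"
  proof -
    have "T -` box l u \<in> sets borel"
      using measurable_sets[OF orthogonal_transformation_borel[OF T], of "box l u"] by simp
    then show ?thesis unfolding eq by (simp add: emeasure_completion)
  qed
  also have "\<dots> = ennreal (measure lebesgue (inv T ` box l u))"
    using lm by (simp add: emeasure_eq_measure2)
  also have "\<dots> = ennreal (measure lebesgue (box l u))"
    by (subst measure_orthogonal_image[OF inv(1)]) simp_all
  also have "\<dots> = (\<Prod>b\<in>Basis. (u - l) \<bullet> b)"
    using le by simp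
  finally show "emeasure (distr lborel borel T) (box l u) = ennreal (\<Prod>b\<in>Basis. (u - l) \<bullet> b)" .
qed simp

context
  fixes T :: "real^2 \<Rightarrow> real^2"
  assumes T: "orthogonal_transformation T"
begin

lemma AE_orthogonal:
  assumes "AE x in lborel. P x"
  shows "AE x in lborel. P (T x)"
proof -
  note [measurable] = orthogonal_transformation_borel[OF T]
  obtain N where N: "N \<in> null_sets lborel" "\<And>x. x \<notin> N \<Longrightarrow> P x"
    using assms unfolding eventually_ae_filter by auto
  have "AE x in distr lborel borel T. x \<notin> N"
    unfolding lborel_distr_orthogonal[OF T] using N(1) by (rule AE_not_in)
  then have "AE x in lborel. T x \<notin> N"
    using N(1) by (subst (asm) AE_distr_iff) auto
  then show ?thesis by (rule eventually_mono) (rule N(2))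
qed

lemma integrable_orthogonal:
  fixes f :: "real^2 \<Rightarrow> 'b::{banach, second_countable_topology}"
  assumes "integrable lborel f"
  shows "integrable lborel (\<lambda>x. f (T x))"
proof -
  note [measurable] = orthogonal_transformation_borel[OF T]
  have [measurable]: "f \<in> borel_measurable borel" using assms by auto
  have "integrable (distr lborel borel T) f"
    using assms by (simp add: lborel_distr_orthogonal[OF T])
  then show ?thesis by (subst (asm) integrable_distr_eq) auto
qed

lemma integral_orthogonal:
  fixes f :: "real^2 \<Rightarrow> 'b::{banach, second_countable_topology}"
  assumes "f \<in> borel_measurable borel"
  shows "(LINT x|lborel. f (T x)) = (LINT x|lborel. f x)"
proof -
  note [measurable] = orthogonal_transformation_borel[OF T]
  have "(LINT x|distr lborel borel T. f x) = (LINT x|lborel. f (T x))"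
    using assms by (intro integral_distr) auto
  then show ?thesis by (simp add: lborel_distr_orthogonal[OF T])
qed

lemma sq_integrable_orthogonal:
  assumes "sq_integrable f"
  shows "sq_integrable (\<lambda>x. f (T x))"
proof -
  note [measurable] = orthogonal_transformation_borel[OF T]
  have [measurable]: "f \<in> borel_measurable borel" using assms by (simp add: sq_integrable_def)
  show ?thesis
    using assms integrable_orthogonal[of "\<lambda>x. (norm (f x))\<^sup>2"] by (auto simp: sq_integrable_def)
qed

lemma AE_rep_pullback: "AE x in lborel. rep_L2 (pullback T u) x = rep_L2 u (T x)"
  unfolding pullback_def by (intro AE_rep_mk_L2 sq_integrable_orthogonal sq_integrable_rep_L2)

lemma pullback_eqI:
  assumes "AE x in lborel. rep_L2 v x = rep_L2 u (T x)"
  shows "pullback T u = v"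
  using AE_rep_pullback[of u] assms by (intro L2_eqI) auto

lemma pullback_add: "pullback T (u + v) = pullback T u + pullback T v"
  by (intro pullback_eqI, use AE_rep_add[of "pullback T u" "pullback T v"] AE_rep_pullback[of u]
      AE_rep_pullback[of v] AE_orthogonal[OF AE_rep_add[of u v]] in eventually_elim) simp

lemma pullback_scaleR: "pullback T (c *\<^sub>R u) = c *\<^sub>R pullback T u"
  by (intro pullback_eqI, use AE_rep_scaleR[of c "pullback T u"] AE_rep_pullback[of u]
      AE_orthogonal[OF AE_rep_scaleR[of c u]] in eventually_elim) simp

lemma inner_pullback: "inner (pullback T u) (pullback T v) = inner u v"
proof -
  note [measurable] = orthogonal_transformation_borel[OF T]
  have "inner (pullback T u) (pullback T v) = (LINT x|lborel. rep_L2 u (T x) \<bullet> rep_L2 v (T x))"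
    unfolding inner_L2_rep
  proof (rule integral_cong_AE)
    show "AE x in lborel. rep_L2 (pullback T u) x \<bullet> rep_L2 (pullback T v) x
        = rep_L2 u (T x) \<bullet> rep_L2 v (T x)"
      using AE_rep_pullback[of u] AE_rep_pullback[of v] by eventually_elim simp
  qed measurable
  also have "\<dots> = inner u v"
    unfolding inner_L2_rep by (rule integral_orthogonal) measurable
  finally show ?thesis .
qed

lemma norm_pullback: "norm (pullback T u) = norm u"
  by (simp add: norm_eq_sqrt_inner inner_pullback)

lemma bounded_linear_pullback: "bounded_linear (pullback T)"
  by (rule bounded_linear_intro[where K=1]) (auto simp: pullback_add pullback_scaleR norm_pullback)

end

lemma pullback_pullback:
  assumes T: "orthogonal_transformation T" and S: "orthogonal_transformation S"
  shows "pullback T (pullback S u) = pullback (S \<circ> T) u"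
proof (rule pullback_eqI[OF T])
  have ST: "orthogonal_transformation (S \<circ> T)"
    using S T by (rule orthogonal_transformation_compose)
  show "AE x in lborel. rep_L2 (pullback (S \<circ> T) u) x = rep_L2 (pullback S u) (T x)"
    using AE_rep_pullback[OF ST, of u] AE_orthogonal[OF T AE_rep_pullback[OF S, of u]]
    by eventually_elim simp
qed

section \<open>The Hartley transform\<close>

text \<open>The characteristic function of the standard normal law after the substitution x = sqrt(2
  pi) s. In the normalization exp(- pi s^2) the Gaussian is its own transform.\<close>

lemma gaussian_char:
  "integrable lborel (\<lambda>s::real. complex_of_real (exp (- pi * s\<^sup>2)) * iexp (2 * pi * z * s))"
  "(CLINT s|lborel. complex_of_real (exp (- pi * s\<^sup>2)) * iexp (2 * pi * z * s)) = complex_of_real (exp (- pi * z\<^sup>2))"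
proof -
  define t where "t = sqrt (2 * pi) * z"
  have i: "integrable lborel (\<lambda>x. std_normal_density x *\<^sub>R iexp (t * x))"
    by (intro Bochner_Integration.integrable_bound[OF integrable_normal_density[of 1 0]])
      (auto simp: norm_mult)
  have "complex_of_real (exp (- (t^2) / 2)) = (CLINT x|lborel. std_normal_density x *\<^sub>R iexp (t * x))"
    using char_std_normal_distribution[THEN fun_cong, of t] unfolding char_def
    by (subst (asm) integral_density) (auto simp: normal_density_nonneg)
  then have "has_bochner_integral lborel (\<lambda>x. std_normal_density x *\<^sub>R iexp (t * x)) (complex_of_real (exp (- (t^2) / 2)))"
    using i by (simp add: has_bochner_integral_iff)
  then have "has_bochner_integral lborel (\<lambda>x. std_normal_density (0 + sqrt (2 * pi) * x) *\<^sub>R iexp (t * (0 + sqrt (2 * pi) * x)))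
     (complex_of_real (exp (- (t^2) / 2)) /\<^sub>R \<bar>sqrt (2 * pi)\<bar>)"
    by (subst (asm) lborel_has_bochner_integral_real_affine_iff[where c="sqrt (2 * pi)" and t=0]) simp_all
  then have "has_bochner_integral lborel (\<lambda>x. \<bar>sqrt (2 * pi)\<bar> *\<^sub>R (std_normal_density (0 + sqrt (2 * pi) * x) *\<^sub>R iexp (t * (0 + sqrt (2 * pi) * x))))
     (\<bar>sqrt (2 * pi)\<bar> *\<^sub>R (complex_of_real (exp (- (t^2) / 2)) /\<^sub>R \<bar>sqrt (2 * pi)\<bar>))"
    by (rule has_bochner_integral_scaleR_right[rotated])
  also have "(\<lambda>x. \<bar>sqrt (2 * pi)\<bar> *\<^sub>R (std_normal_density (0 + sqrt (2 * pi) * x) *\<^sub>R iexp (t * (0 + sqrt (2 * pi) * x))))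
     = (\<lambda>s::real. complex_of_real (exp (- pi * s\<^sup>2)) * iexp (2 * pi * z * s))"
  proof
    fix s :: real
    have a: "t * (0 + sqrt (2 * pi) * s) = 2 * pi * z * s"
      using real_sqrt_mult_self[of "2 * pi"] by (simp add: t_def del: real_sqrt_mult_self)
    have b: "\<bar>sqrt (2 * pi)\<bar> * std_normal_density (0 + sqrt (2 * pi) * s) = exp (- pi * s\<^sup>2)"
      by (simp add: std_normal_density_def power_mult_distrib)
    show "\<bar>sqrt (2 * pi)\<bar> *\<^sub>R (std_normal_density (0 + sqrt (2 * pi) * s) *\<^sub>R iexp (t * (0 + sqrt (2 * pi) * s)))
      = complex_of_real (exp (- pi * s\<^sup>2)) * iexp (2 * pi * z * s)"
      unfolding a scaleR_scaleR b by (simp only: scaleR_conv_of_real)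
  qed
  also have "\<bar>sqrt (2 * pi)\<bar> *\<^sub>R (complex_of_real (exp (- (t^2) / 2)) /\<^sub>R \<bar>sqrt (2 * pi)\<bar>)
     = complex_of_real (exp (- pi * z\<^sup>2))"
    by (simp add: t_def power_mult_distrib)
  finally show "integrable lborel (\<lambda>s::real. complex_of_real (exp (- pi * s\<^sup>2)) * iexp (2 * pi * z * s))"
  "(CLINT s|lborel. complex_of_real (exp (- pi * s\<^sup>2)) * iexp (2 * pi * z * s)) = complex_of_real (exp (- pi * z\<^sup>2))"
    by (auto simp: has_bochner_integral_iff)
qed

text \<open>\<open>lborel\<close> is the image of a product of one-dimensional Lebesgue measures, so
  an integrand that splits over the coordinates integrates factor by factor.\<close>

lemma integral_lborel_prod:
  fixes f :: "'a::euclidean_space \<Rightarrow> real \<Rightarrow> complex"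
  assumes f: "\<And>b. b \<in> Basis \<Longrightarrow> integrable lborel (f b)"
  shows "integrable lborel (\<lambda>x::'a. \<Prod>b\<in>Basis. f b (x \<bullet> b))"
    and "(LINT x|lborel. (\<Prod>b\<in>Basis. f b (x \<bullet> b))) = (\<Prod>b\<in>Basis. (LINT s|lborel. f b s))"
proof -
  interpret product_sigma_finite "\<lambda>_::'a. lborel :: real measure" ..
  have [measurable]: "\<And>b. b \<in> Basis \<Longrightarrow> f b \<in> borel_measurable borel" using f by auto
  have [measurable]: "(\<lambda>f. \<Sum>b\<in>Basis. f b *\<^sub>R b) \<in> measurable (\<Pi>\<^sub>M b\<in>(Basis::'a set). lborel) (borel :: 'a measure)"
    by measurable
  have [measurable]: "(\<lambda>x::'a. \<Prod>b\<in>Basis. f b (x \<bullet> b)) \<in> borel_measurable borel"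
    by measurable
  have eq: "(\<Prod>b\<in>Basis. f b ((\<Sum>c\<in>Basis. x c *\<^sub>R c) \<bullet> b)) = (\<Prod>b\<in>Basis. f b (x b))" for x :: "'a \<Rightarrow> real"
    by (intro prod.cong) (auto simp: inner_sum_left inner_Basis if_distrib cong: if_cong)
  show "integrable lborel (\<lambda>x::'a. \<Prod>b\<in>Basis. f b (x \<bullet> b))"
    by (subst lborel_eq, subst integrable_distr_eq) (auto simp: eq intro!: product_integrable_prod f)
  show "(LINT x|lborel. (\<Prod>b\<in>Basis. f b (x \<bullet> b))) = (\<Prod>b\<in>Basis. (LINT s|lborel. f b s))"
    by (subst lborel_eq, subst integral_distr) (auto simp: eq intro!: product_integral_prod f)
qed

lemma gaussian_fourier:
  fixes z :: "'a::euclidean_space"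
  shows "integrable lborel (\<lambda>x::'a. complex_of_real (exp (- pi * (norm x)\<^sup>2)) * iexp (2 * pi * (z \<bullet> x)))"
    and "(LINT x|lborel. complex_of_real (exp (- pi * (norm x)\<^sup>2)) * iexp (2 * pi * (z \<bullet> x))) = complex_of_real (exp (- pi * (norm z)\<^sup>2))"
proof -
  let ?f = "\<lambda>b (s::real). complex_of_real (exp (- pi * s\<^sup>2)) * iexp (2 * pi * (z \<bullet> b) * s)"
  have n: "(norm x)\<^sup>2 = (\<Sum>b\<in>Basis. (x \<bullet> b)\<^sup>2)" for x :: 'a
    unfolding power2_norm_eq_inner by (subst euclidean_inner) (simp add: power2_eq_square)
  have e: "complex_of_real (exp (- pi * (norm x)\<^sup>2)) * iexp (2 * pi * (z \<bullet> x)) = (\<Prod>b\<in>Basis. ?f b (x \<bullet> b))" for x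
    unfolding prod.distrib of_real_prod[symmetric] exp_sum[OF finite_Basis, symmetric]
      sum_distrib_left[symmetric] n sum_negf
    by (simp add: euclidean_inner[of z x] sum_distrib_left mult.assoc)
  show "integrable lborel (\<lambda>x::'a. complex_of_real (exp (- pi * (norm x)\<^sup>2)) * iexp (2 * pi * (z \<bullet> x)))"
    unfolding e by (intro integral_lborel_prod(1) gaussian_char)
  show "(LINT x|lborel. complex_of_real (exp (- pi * (norm x)\<^sup>2)) * iexp (2 * pi * (z \<bullet> x))) = complex_of_real (exp (- pi * (norm z)\<^sup>2))"
  proof -
    have "(LINT x|lborel. complex_of_real (exp (- pi * (norm x)\<^sup>2)) * iexp (2 * pi * (z \<bullet> x)))
        = (\<Prod>b\<in>Basis. (CLINT s|lborel. ?f b s))"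
      unfolding e by (rule integral_lborel_prod(2)) (rule gaussian_char(1))
    also have "\<dots> = (\<Prod>b\<in>Basis. complex_of_real (exp (- pi * (z \<bullet> b)\<^sup>2)))"
      by (simp only: gaussian_char(2))
    also have "\<dots> = complex_of_real (exp (- pi * (norm z)\<^sup>2))"
      unfolding of_real_prod[symmetric] exp_sum[OF finite_Basis, symmetric] n sum_distrib_left ..
    finally show ?thesis .
  qed
qed

text \<open>The Hartley transform is the real form of the Fourier transform of real functions: it is
  symmetric and isometric, hence an involution, which gives the surjectivity in Plancherel's theorem
  for free.\<close>

definition cas :: "real^2 \<Rightarrow> real^2 \<Rightarrow> real" where
  "cas x \<xi> = cos (2 * pi * (x \<bullet> \<xi>)) + sin (2 * pi * (x \<bullet> \<xi>))"

definition hartley :: "(real^2 \<Rightarrow> real) \<Rightarrow> real^2 \<Rightarrow> real" where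
  "hartley f \<xi> = (LINT x|lborel. f x * cas x \<xi>)"

lemma cas_commute: "cas x \<xi> = cas \<xi> x"
  by (simp add: cas_def inner_commute)

lemma abs_cas_le: "\<bar>cas x \<xi>\<bar> \<le> 2"
  unfolding cas_def by (rule order_trans[OF abs_triangle_ineq])
    (use abs_cos_le_one[of "2 * pi * (x \<bullet> \<xi>)"] abs_sin_le_one[of "2 * pi * (x \<bullet> \<xi>)"] in linarith)

lemma cas_measurable [measurable]: "case_prod cas \<in> borel_measurable (borel \<Otimes>\<^sub>M borel)"
  unfolding cas_def[abs_def] by measurable

lemma integrable_mult_cas:
  assumes f: "integrable lborel f"
  shows "integrable lborel (\<lambda>x. f x * cas x \<xi>)"
proof (rule Bochner_Integration.integrable_bound[of _ "\<lambda>x. 2 * f x"])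
  show "AE x in lborel. norm (f x * cas x \<xi>) \<le> norm (2 * f x)"
    using mult_left_mono[OF abs_cas_le abs_ge_zero] by (auto simp: abs_mult mult.commute)
qed (use f in \<open>auto intro: borel_measurable_integrable\<close>)

lemma abs_hartley_le:
  assumes f: "integrable lborel f"
  shows "\<bar>hartley f \<xi>\<bar> \<le> 2 * (LINT x|lborel. \<bar>f x\<bar>)"
proof -
  have "\<bar>hartley f \<xi>\<bar> \<le> (LINT x|lborel. \<bar>f x * cas x \<xi>\<bar>)"
    unfolding hartley_def by (rule integral_abs_bound)
  also have "\<dots> \<le> (LINT x|lborel. 2 * \<bar>f x\<bar>)"
    using integrable_mult_cas[OF f] f mult_left_mono[OF abs_cas_le abs_ge_zero]
    by (intro integral_mono integrable_abs) (auto simp: abs_mult mult.commute)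
  finally show ?thesis by simp
qed

lemma hartley_measurable [measurable]:
  assumes [measurable]: "f \<in> borel_measurable borel"
  shows "hartley f \<in> borel_measurable borel"
  unfolding hartley_def[abs_def]
  by (rule sigma_finite_measure.borel_measurable_lebesgue_integral[OF sigma_finite_lborel]) measurable

lemma hartley_diff: "integrable lborel f \<Longrightarrow> integrable lborel g \<Longrightarrow>
    hartley (\<lambda>x. f x - g x) \<xi> = hartley f \<xi> - hartley g \<xi>"
  unfolding hartley_def by (simp add: left_diff_distrib integrable_mult_cas)

lemma hartley_cong_AE:
  assumes "AE x in lborel. f x = g x" "f \<in> borel_measurable borel" "g \<in> borel_measurable borel"
  shows "hartley f = hartley g"
  unfolding hartley_def[abs_def]
  by (intro ext integral_cong_AE) (use assms in \<open>auto elim: eventually_mono\<close>)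

text \<open>Fubini for the bounded symmetric kernel \<open>cas\<close>. It serves twice: to move the
  transform off a Gaussian-weighted square, and to make the extension to L^2 self-adjoint.\<close>

lemma integral_hartley_mult:
  assumes f: "integrable lborel f" and g: "integrable lborel g"
  shows "(LINT \<xi>|lborel. hartley f \<xi> * g \<xi>) = (LINT x|lborel. f x * hartley g x)"
proof -
  note [measurable] = borel_measurable_integrable[OF f, simplified] borel_measurable_integrable[OF g, simplified]
  have int: "integrable (lborel \<Otimes>\<^sub>M lborel) (case_prod (\<lambda>x \<xi>. f x * cas x \<xi> * g \<xi>))"
  proof (rule lborel_pair.Fubini_integrable)
    show "integrable lborel (\<lambda>x. LINT y|lborel. norm (case (x, y) of (x, \<xi>) \<Rightarrow> f x * cas x \<xi> * g \<xi>))"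
    proof (rule Bochner_Integration.integrable_bound)
      show "integrable lborel (\<lambda>x. f x * (LINT y|lborel. 2 * \<bar>g y\<bar>))" using f by simp
      show "AE x in lborel. norm (LINT y|lborel. norm (case (x, y) of (x, \<xi>) \<Rightarrow> f x * cas x \<xi> * g \<xi>))
         \<le> norm (f x * (LINT y|lborel. 2 * \<bar>g y\<bar>))"
      proof (rule AE_I2)
        fix x
        have "(LINT y|lborel. \<bar>f x * cas x y * g y\<bar>) \<le> (LINT y|lborel. \<bar>f x\<bar> * (2 * \<bar>g y\<bar>))"
        proof (rule integral_mono)
          show "integrable lborel (\<lambda>y. \<bar>f x * cas x y * g y\<bar>)"
            using integrable_mult_cas[OF g, of x]
            by (simp add: cas_commute[of x] mult_ac)
          show "integrable lborel (\<lambda>y. \<bar>f x\<bar> * (2 * \<bar>g y\<bar>))" using g by simp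
          show "\<bar>f x * cas x y * g y\<bar> \<le> \<bar>f x\<bar> * (2 * \<bar>g y\<bar>)" for y
            using abs_cas_le[of x y] by (simp add: abs_mult mult.assoc mult_left_mono mult_right_mono)
        qed
        then show "norm (LINT y|lborel. norm (case (x, y) of (x, \<xi>) \<Rightarrow> f x * cas x \<xi> * g \<xi>))
          \<le> norm (f x * (LINT y|lborel. 2 * \<bar>g y\<bar>))"
          by (simp add: abs_mult)
      qed
    qed measurable
    show "AE x in lborel. integrable lborel (\<lambda>y. case (x, y) of (x, \<xi>) \<Rightarrow> f x * cas x \<xi> * g \<xi>)"
      using integrable_mult_cas[OF g] by (auto simp: cas_commute mult_ac intro!: AE_I2)
  qed measurable
  have "(LINT \<xi>|lborel. hartley f \<xi> * g \<xi>) = (LINT \<xi>|lborel. (LINT x|lborel. f x * cas x \<xi> * g \<xi>))"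
    by (simp add: hartley_def)
  also have "\<dots> = (LINT x|lborel. (LINT \<xi>|lborel. f x * cas x \<xi> * g \<xi>))"
    by (rule lborel_pair.Fubini_integral[OF int])
  also have "\<dots> = (LINT x|lborel. f x * hartley g x)"
    by (simp add: hartley_def cas_commute mult_ac)
  finally show ?thesis .
qed

lemma integral_affine_lborel:
  fixes h :: "'a::euclidean_space \<Rightarrow> 'b::{banach, second_countable_topology}"
  assumes c: "c \<noteq> 0" and h [measurable]: "h \<in> borel_measurable borel"
  shows "(LINT x|lborel. h x) = \<bar>c\<bar> ^ DIM('a) *\<^sub>R (LINT x|lborel. h (t + c *\<^sub>R x))"
    and "integrable lborel h \<longleftrightarrow> integrable lborel (\<lambda>x. h (t + c *\<^sub>R x))"
proof -
  have eq: "lborel = density (distr lborel borel (\<lambda>x::'a. t + c *\<^sub>R x)) (\<lambda>_. ennreal (\<bar>c\<bar>^DIM('a)))"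
    using lborel_affine[OF c, of t] by simp
  have "(LINT x|lborel. h x) = (LINT x|distr lborel borel (\<lambda>x::'a. t + c *\<^sub>R x). \<bar>c\<bar>^DIM('a) *\<^sub>R h x)"
    by (subst eq, subst integral_density) auto
  also have "\<dots> = (LINT x|lborel. \<bar>c\<bar>^DIM('a) *\<^sub>R h (t + c *\<^sub>R x))"
    by (rule integral_distr) auto
  finally show "(LINT x|lborel. h x) = \<bar>c\<bar> ^ DIM('a) *\<^sub>R (LINT x|lborel. h (t + c *\<^sub>R x))" by simp
  have "integrable lborel h \<longleftrightarrow> integrable (distr lborel borel (\<lambda>x::'a. t + c *\<^sub>R x)) (\<lambda>x. \<bar>c\<bar>^DIM('a) *\<^sub>R h x)"
    by (subst eq, subst integrable_density) auto
  also have "\<dots> \<longleftrightarrow> integrable lborel (\<lambda>x. \<bar>c\<bar>^DIM('a) *\<^sub>R h (t + c *\<^sub>R x))"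
    by (rule integrable_distr_eq) auto
  also have "\<dots> \<longleftrightarrow> integrable lborel (\<lambda>x. h (t + c *\<^sub>R x))"
  proof
    assume "integrable lborel (\<lambda>x. \<bar>c\<bar>^DIM('a) *\<^sub>R h (t + c *\<^sub>R x))"
    then have "integrable lborel (\<lambda>x. inverse (\<bar>c\<bar>^DIM('a)) *\<^sub>R (\<bar>c\<bar>^DIM('a) *\<^sub>R h (t + c *\<^sub>R x)))"
      by (rule integrable_scaleR_right)
    then show "integrable lborel (\<lambda>x. h (t + c *\<^sub>R x))" using c by simp
  qed simp
  finally show "integrable lborel h \<longleftrightarrow> integrable lborel (\<lambda>x. h (t + c *\<^sub>R x))" .
qed

section \<open>Plancherel inequalities by Gaussian regularization\<close>

definition gauss :: "real^2 \<Rightarrow> real" where "gauss x = exp (- pi * (norm x)\<^sup>2)"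

lemma gauss_borel [measurable]: "gauss \<in> borel_measurable borel"
  unfolding gauss_def[abs_def] by measurable

lemma gauss_pos: "gauss x > 0" and gauss_le_1: "gauss x \<le> 1"
  by (auto simp: gauss_def)

lemma gauss_trig:
  shows "integrable lborel (\<lambda>x. gauss x * cos (2 * pi * (z \<bullet> x)))"
    and "(LINT x|lborel. gauss x * cos (2 * pi * (z \<bullet> x))) = gauss z"
    and "integrable lborel (\<lambda>x. gauss x * sin (2 * pi * (z \<bullet> x)))"
    and "(LINT x|lborel. gauss x * sin (2 * pi * (z \<bullet> x))) = 0"
proof -
  note i = gaussian_fourier[of z]
  have r: "Re (complex_of_real (exp (- pi * (norm x)\<^sup>2)) * iexp (2 * pi * (z \<bullet> x))) = gauss x * cos (2 * pi * (z \<bullet> x))"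
    and m: "Im (complex_of_real (exp (- pi * (norm x)\<^sup>2)) * iexp (2 * pi * (z \<bullet> x))) = gauss x * sin (2 * pi * (z \<bullet> x))" for x
    by (simp_all add: Re_exp Im_exp gauss_def)
  show "integrable lborel (\<lambda>x. gauss x * cos (2 * pi * (z \<bullet> x)))"
    "integrable lborel (\<lambda>x. gauss x * sin (2 * pi * (z \<bullet> x)))"
    using integrable_Re[OF i(1)] integrable_Im[OF i(1)] unfolding r m by auto
  show "(LINT x|lborel. gauss x * cos (2 * pi * (z \<bullet> x))) = gauss z"
    using arg_cong[OF i(2), of Re] unfolding integral_Re[OF i(1), symmetric] r by (simp add: gauss_def)
  show "(LINT x|lborel. gauss x * sin (2 * pi * (z \<bullet> x))) = 0"
    using arg_cong[OF i(2), of Im] unfolding integral_Im[OF i(1), symmetric] m by simp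
qed

lemma gauss_integral: "integrable lborel gauss" "(LINT x|lborel. gauss x) = 1"
  using gauss_trig(1,2)[of 0] by (simp_all add: gauss_def[abs_def])

text \<open>The product of two \<open>cas\<close> kernels is cos of the difference plus sin of the
  sum of the angles. The sine part integrates to 0 against the even Gaussian, and the cosine part
  leaves an approximate identity centred at x.\<close>

lemma hartley_gauss_cas:
  fixes n :: real
  assumes n: "n > 0"
  shows "integrable lborel (\<lambda>\<xi>. gauss (\<xi> /\<^sub>R n) * cas x \<xi>)"
    and "hartley (\<lambda>\<xi>. gauss (\<xi> /\<^sub>R n) * cas x \<xi>) y = n\<^sup>2 * gauss (n *\<^sub>R (x - y))"
proof -
  have gi: "integrable lborel (\<lambda>\<xi>. gauss (\<xi> /\<^sub>R n))"
    using integral_affine_lborel(2)[of "inverse n" gauss 0] n gauss_integral by simp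
  show "integrable lborel (\<lambda>\<xi>. gauss (\<xi> /\<^sub>R n) * cas x \<xi>)"
    using integrable_mult_cas[OF gi, of x] by (simp add: cas_commute)
  have prod: "cas x \<xi> * cas \<xi> y = cos (2 * pi * ((x - y) \<bullet> \<xi>)) + sin (2 * pi * ((x + y) \<bullet> \<xi>))" for \<xi>
    unfolding cas_def inner_diff_left inner_add_left right_diff_distrib distrib_left cos_diff sin_add
    by (simp add: inner_commute algebra_simps)
  have "hartley (\<lambda>\<xi>. gauss (\<xi> /\<^sub>R n) * cas x \<xi>) y
     = (LINT \<xi>|lborel. gauss (\<xi> /\<^sub>R n) * (cos (2 * pi * ((x - y) \<bullet> \<xi>)) + sin (2 * pi * ((x + y) \<bullet> \<xi>))))"
    unfolding hartley_def by (simp add: prod mult.assoc)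
  also have "\<dots> = n\<^sup>2 * (LINT \<xi>|lborel. gauss \<xi> * (cos (2 * pi * ((x - y) \<bullet> (n *\<^sub>R \<xi>))) + sin (2 * pi * ((x + y) \<bullet> (n *\<^sub>R \<xi>)))))"
    using n by (subst integral_affine_lborel(1)[where c=n and t=0]) auto
  also have "(LINT \<xi>|lborel. gauss \<xi> * (cos (2 * pi * ((x - y) \<bullet> (n *\<^sub>R \<xi>))) + sin (2 * pi * ((x + y) \<bullet> (n *\<^sub>R \<xi>))))) = gauss (n *\<^sub>R (x - y))"
    using gauss_trig[of "n *\<^sub>R (x - y)"] gauss_trig[of "n *\<^sub>R (x + y)"]
    by (simp add: distrib_left)
  finally show "hartley (\<lambda>\<xi>. gauss (\<xi> /\<^sub>R n) * cas x \<xi>) y = n\<^sup>2 * gauss (n *\<^sub>R (x - y))" .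
qed

text \<open>Before the isometry is known, \<open>hartley f\<close> is merely bounded; the Gaussian
  weight makes it integrable, so the transform can be moved to the other factor. What remains is the
  correlation of f with averages of its own translates at scale 1/n.\<close>

lemma integral_gauss_hartley_sq:
  assumes f: "integrable lborel f" and n: "n > 0"
  shows "integrable lborel (\<lambda>\<xi>. gauss (\<xi> /\<^sub>R n) * (hartley f \<xi>)\<^sup>2)"
    and "(LINT \<xi>|lborel. gauss (\<xi> /\<^sub>R n) * (hartley f \<xi>)\<^sup>2)
      = (LINT x|lborel. f x * (LINT z|lborel. f (x + z /\<^sub>R n) * gauss z))"
proof -
  note [measurable] = borel_measurable_integrable[OF f, simplified]
  have gi: "integrable lborel (\<lambda>\<xi>. gauss (\<xi> /\<^sub>R n))"
    using integral_affine_lborel(2)[of "inverse n" gauss 0] n gauss_integral by simp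
  define B where "B = 2 * (LINT x|lborel. \<bar>f x\<bar>)"
  have B: "\<bar>hartley f \<xi>\<bar> \<le> B" for \<xi> unfolding B_def by (rule abs_hartley_le[OF f])
  have B0: "B \<ge> 0" using B[of 0] by simp
  have i1: "integrable lborel (\<lambda>\<xi>. gauss (\<xi> /\<^sub>R n) * hartley f \<xi>)"
  proof (rule Bochner_Integration.integrable_bound)
    show "integrable lborel (\<lambda>\<xi>. gauss (\<xi> /\<^sub>R n) * B)" using gi by simp
    show "AE x in lborel. norm (gauss (x /\<^sub>R n) * hartley f x) \<le> norm (gauss (x /\<^sub>R n) * B)"
      using B B0 by (auto simp: abs_mult intro!: mult_left_mono)
  qed measurable
  show "integrable lborel (\<lambda>\<xi>. gauss (\<xi> /\<^sub>R n) * (hartley f \<xi>)\<^sup>2)"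
  proof (rule Bochner_Integration.integrable_bound)
    show "integrable lborel (\<lambda>\<xi>. gauss (\<xi> /\<^sub>R n) * hartley f \<xi> * B)" using i1 by simp
    show "AE x in lborel. norm (gauss (x /\<^sub>R n) * (hartley f x)\<^sup>2) \<le> norm (gauss (x /\<^sub>R n) * hartley f x * B)"
    proof (rule AE_I2)
      fix x
      have "\<bar>hartley f x\<bar> * \<bar>hartley f x\<bar> \<le> \<bar>hartley f x\<bar> * B" using B by (intro mult_left_mono) auto
      then show "norm (gauss (x /\<^sub>R n) * (hartley f x)\<^sup>2) \<le> norm (gauss (x /\<^sub>R n) * hartley f x * B)"
        using B0 gauss_pos[of "x /\<^sub>R n"] by (simp add: abs_mult power2_eq_square mult.assoc)
    qed
  qed measurable
  have "(LINT \<xi>|lborel. gauss (\<xi> /\<^sub>R n) * (hartley f \<xi>)\<^sup>2)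
     = (LINT \<xi>|lborel. hartley f \<xi> * (gauss (\<xi> /\<^sub>R n) * hartley f \<xi>))"
    by (simp add: power2_eq_square mult_ac)
  also have "\<dots> = (LINT x|lborel. f x * hartley (\<lambda>\<xi>. gauss (\<xi> /\<^sub>R n) * hartley f \<xi>) x)"
    by (rule integral_hartley_mult[OF f i1])
  also have "\<dots> = (LINT x|lborel. f x * (LINT z|lborel. f (x + z /\<^sub>R n) * gauss z))"
  proof (intro Bochner_Integration.integral_cong refl arg_cong2[where f=times])
    fix x
    have "hartley (\<lambda>\<xi>. gauss (\<xi> /\<^sub>R n) * hartley f \<xi>) x
      = (LINT \<xi>|lborel. hartley f \<xi> * (gauss (\<xi> /\<^sub>R n) * cas x \<xi>))"
      unfolding hartley_def[of "\<lambda>\<xi>. gauss (\<xi> /\<^sub>R n) * hartley f \<xi>"] by (simp add: cas_commute mult_ac)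
    also have "\<dots> = (LINT y|lborel. f y * (n\<^sup>2 * gauss (n *\<^sub>R (x - y))))"
      by (subst integral_hartley_mult[OF f hartley_gauss_cas(1)[OF n]]) (simp add: hartley_gauss_cas(2)[OF n])
    also have "\<dots> = \<bar>inverse n\<bar>\<^sup>2 *\<^sub>R (LINT z|lborel. f (x + inverse n *\<^sub>R z) * (n\<^sup>2 * gauss (n *\<^sub>R (x - (x + inverse n *\<^sub>R z)))))"
      using n by (subst integral_affine_lborel(1)[where c="inverse n" and t=x]) auto
    also have "\<dots> = (LINT z|lborel. f (x + z /\<^sub>R n) * gauss z)"
      using n by (simp add: gauss_def field_simps flip: integral_mult_right_zero)
    finally show "hartley (\<lambda>\<xi>. gauss (\<xi> /\<^sub>R n) * hartley f \<xi>) x = (LINT z|lborel. f (x + z /\<^sub>R n) * gauss z)" .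
  qed
  finally show "(LINT \<xi>|lborel. gauss (\<xi> /\<^sub>R n) * (hartley f \<xi>)\<^sup>2)
      = (LINT x|lborel. f x * (LINT z|lborel. f (x + z /\<^sub>R n) * gauss z))" .
qed


lemma sq_integrable_shift:
  fixes f :: "real^2 \<Rightarrow> real"
  assumes f: "sq_integrable f"
  shows "sq_integrable (\<lambda>x. f (x + a))" and "(LINT x|lborel. (f (x + a))\<^sup>2) = (LINT x|lborel. (f x)\<^sup>2)"
proof -
  have [measurable]: "f \<in> borel_measurable borel" using f by (simp add: sq_integrable_def)
  show "sq_integrable (\<lambda>x. f (x + a))"
    using f integral_affine_lborel(2)[of 1 "\<lambda>x. (f x)\<^sup>2" a] by (simp add: sq_integrable_def add.commute)
  show "(LINT x|lborel. (f (x + a))\<^sup>2) = (LINT x|lborel. (f x)\<^sup>2)"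
    using integral_affine_lborel(1)[of 1 "\<lambda>x. (f x)\<^sup>2" a] by (simp add: add.commute)
qed

lemma autocorrelation_bound:
  fixes f :: "real^2 \<Rightarrow> real"
  assumes f: "sq_integrable f"
  shows "integrable lborel (\<lambda>x. f x * f (x + a))"
    and "(LINT x|lborel. \<bar>f x * f (x + a)\<bar>) \<le> (LINT x|lborel. (f x)\<^sup>2)"
proof -
  have i: "integrable lborel (\<lambda>x. (f x)\<^sup>2)" "integrable lborel (\<lambda>x. (f (x + a))\<^sup>2)"
    using f sq_integrable_shift(1)[OF f, of a] by (auto simp: sq_integrable_def)
  show int: "integrable lborel (\<lambda>x. f x * f (x + a))"
    using sq_integrable_inner[OF f sq_integrable_shift(1)[OF f, of a]] by simp
  have "(LINT x|lborel. \<bar>f x * f (x + a)\<bar>) \<le> (LINT x|lborel. ((f x)\<^sup>2 + (f (x + a))\<^sup>2) / 2)"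
  proof (rule integral_mono)
    show "\<bar>f x * f (x + a)\<bar> \<le> ((f x)\<^sup>2 + (f (x + a))\<^sup>2) / 2" for x
      using sum_squares_bound[of "\<bar>f x\<bar>" "\<bar>f (x + a)\<bar>"] by (simp add: abs_mult)
  qed (use int i in auto)
  also have "\<dots> = (LINT x|lborel. (f x)\<^sup>2)"
    using i by (simp add: sq_integrable_shift(2)[OF f])
  finally show "(LINT x|lborel. \<bar>f x * f (x + a)\<bar>) \<le> (LINT x|lborel. (f x)\<^sup>2)" .
qed

text \<open>Every correlation of f with a translate is at most the squared norm of f, and the
  Gaussian has total mass 1. Fubini lets the translate be fixed first.\<close>

lemma integral_gauss_hartley_sq_le:
  assumes f: "integrable lborel f" and f2: "sq_integrable f" and n: "n > 0"
  shows "(LINT \<xi>|lborel. gauss (\<xi> /\<^sub>R n) * (hartley f \<xi>)\<^sup>2) \<le> (LINT x|lborel. (f x)\<^sup>2)"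
proof -
  note [measurable] = borel_measurable_integrable[OF f, simplified]
  let ?h = "\<lambda>z x. f x * (f (x + z /\<^sub>R n) * gauss z)"
  let ?C = "LINT x|lborel. (f x)\<^sup>2"
  have b: "(LINT x|lborel. \<bar>?h z x\<bar>) \<le> ?C * gauss z" for z
  proof -
    have "(LINT x|lborel. \<bar>?h z x\<bar>) = (LINT x|lborel. \<bar>f x * f (x + z /\<^sub>R n)\<bar>) * gauss z"
      using gauss_pos[of z] by (subst integral_mult_left_zero[symmetric]) (simp add: abs_mult mult.assoc)
    also have "\<dots> \<le> ?C * gauss z"
      using autocorrelation_bound(2)[OF f2] gauss_pos[of z] by (intro mult_right_mono) auto
    finally show ?thesis .
  qed
  have iz: "integrable lborel (?h z)" for z
    using autocorrelation_bound(1)[OF f2, of "z /\<^sub>R n"] by (simp add: mult.assoc[symmetric])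
  have int: "integrable (lborel \<Otimes>\<^sub>M lborel) (case_prod ?h)"
  proof (rule lborel_pair.Fubini_integrable)
    show "integrable lborel (\<lambda>z. LINT x|lborel. norm (case (z, x) of (z, x) \<Rightarrow> ?h z x))"
    proof (rule Bochner_Integration.integrable_bound)
      show "integrable lborel (\<lambda>z. ?C * gauss z)" using gauss_integral by simp
      show "AE z in lborel. norm (LINT x|lborel. norm (case (z, x) of (z, x) \<Rightarrow> ?h z x)) \<le> norm (?C * gauss z)"
        using b gauss_pos by (auto simp: abs_mult less_imp_le)
    qed measurable
  qed (use iz in auto)
  have "(LINT \<xi>|lborel. gauss (\<xi> /\<^sub>R n) * (hartley f \<xi>)\<^sup>2) = (LINT x|lborel. (LINT z|lborel. ?h z x))"
    by (simp add: integral_gauss_hartley_sq(2)[OF f n])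
  also have "\<dots> = (LINT z|lborel. (LINT x|lborel. ?h z x))"
    by (rule lborel_pair.Fubini_integral[OF int])
  also have "\<dots> \<le> (LINT z|lborel. ?C * gauss z)"
  proof (rule integral_mono')
    show "(LINT x|lborel. ?h z x) \<le> ?C * gauss z" for z
      using b[of z] integral_abs_bound[of lborel "?h z"] by linarith
  qed (use gauss_integral gauss_pos in \<open>auto simp: less_imp_le\<close>)
  also have "\<dots> = ?C" using gauss_integral by simp
  finally show ?thesis .
qed

lemma gauss_scaled_tendsto: "(\<lambda>m. gauss (\<xi> /\<^sub>R real (Suc m))) \<longlonglongrightarrow> 1"
proof -
  have "(\<lambda>m. gauss (\<xi> /\<^sub>R real (Suc m))) \<longlonglongrightarrow> exp (- pi * (norm (0 *\<^sub>R \<xi>))\<^sup>2)"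
    unfolding gauss_def by (intro tendsto_intros LIMSEQ_inverse_real_of_nat)
  then show ?thesis by simp
qed

lemma hartley_contraction:
  assumes f: "integrable lborel f" and f2: "sq_integrable f"
  shows "sq_integrable (hartley f)" and "(LINT \<xi>|lborel. (hartley f \<xi>)\<^sup>2) \<le> (LINT x|lborel. (f x)\<^sup>2)"
proof -
  note [measurable] = borel_measurable_integrable[OF f, simplified]
  have n: "(norm (sqrt (gauss \<eta>) * hartley f \<xi>))\<^sup>2 = gauss \<eta> * (hartley f \<xi>)\<^sup>2" for \<xi> \<eta>
    using gauss_pos[of \<eta>] by (simp add: power_mult_distrib)
  have "sq_integrable (hartley f) \<and> (LINT x|lborel. (norm (hartley f x))\<^sup>2) \<le> (LINT x|lborel. (f x)\<^sup>2)"
  proof (rule sq_integrable_AE_limit)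
    \<comment> \<open>The square root of the weight turns the weighted integral into a squared norm,
      the form that the Fatou argument takes.\<close>
    let ?f = "\<lambda>m \<xi>. sqrt (gauss (\<xi> /\<^sub>R real (Suc m))) * hartley f \<xi>"
    show "sq_integrable (?f m)" for m
      unfolding sq_integrable_def n
      using integral_gauss_hartley_sq(1)[OF f, of "real (Suc m)"] by auto
    show "(LINT x|lborel. (norm (?f m x))\<^sup>2) \<le> (LINT x|lborel. (f x)\<^sup>2)" for m
      unfolding n by (rule integral_gauss_hartley_sq_le[OF f f2]) simp
    show "AE x in lborel. (\<lambda>m. ?f m x) \<longlonglongrightarrow> hartley f x"
    proof (rule AE_I2)
      fix x
      have "(\<lambda>m. ?f m x) \<longlonglongrightarrow> sqrt 1 * hartley f x"
        by (intro tendsto_intros gauss_scaled_tendsto)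
      then show "(\<lambda>m. ?f m x) \<longlonglongrightarrow> hartley f x" by simp
    qed
  qed measurable
  then show "sq_integrable (hartley f)" "(LINT \<xi>|lborel. (hartley f \<xi>)\<^sup>2) \<le> (LINT x|lborel. (f x)\<^sup>2)" by auto
qed

text \<open>The converse inequality needs the averages of f(x + z/n) to tend to f(x), which
  continuity provides; boundedness and integrability of f supply the dominating functions for the
  inner and the outer limit.\<close>

lemma hartley_isometry_continuous:
  assumes f: "integrable lborel f" and f2: "sq_integrable f"
    and c: "continuous_on UNIV f" and M: "\<And>x. \<bar>f x\<bar> \<le> M"
  shows "(LINT x|lborel. (f x)\<^sup>2) \<le> (LINT \<xi>|lborel. (hartley f \<xi>)\<^sup>2)"
proof (rule LIMSEQ_le)
  note [measurable] = borel_measurable_integrable[OF f, simplified]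
  let ?n = "\<lambda>m. real (Suc m)"
  have int: "integrable lborel (\<lambda>\<xi>. (hartley f \<xi>)\<^sup>2)"
    using hartley_contraction(1)[OF f f2] by (simp add: sq_integrable_def)
  show "(\<lambda>_. LINT \<xi>|lborel. (hartley f \<xi>)\<^sup>2) \<longlonglongrightarrow> (LINT \<xi>|lborel. (hartley f \<xi>)\<^sup>2)" by simp
  show "\<exists>N. \<forall>m\<ge>N. (LINT x|lborel. f x * (LINT z|lborel. f (x + z /\<^sub>R ?n m) * gauss z)) \<le> (LINT \<xi>|lborel. (hartley f \<xi>)\<^sup>2)"
  proof (intro exI allI impI)
    fix m
    have "(LINT \<xi>|lborel. gauss (\<xi> /\<^sub>R ?n m) * (hartley f \<xi>)\<^sup>2) \<le> (LINT \<xi>|lborel. (hartley f \<xi>)\<^sup>2)"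
      using gauss_le_1 gauss_pos int
      by (intro integral_mono integral_gauss_hartley_sq(1)[OF f]) (auto simp: mult_left_le_one_le less_imp_le)
    then show "(LINT x|lborel. f x * (LINT z|lborel. f (x + z /\<^sub>R ?n m) * gauss z)) \<le> (LINT \<xi>|lborel. (hartley f \<xi>)\<^sup>2)"
      by (subst integral_gauss_hartley_sq(2)[OF f, symmetric]) simp_all
  qed
  show "(\<lambda>m. LINT x|lborel. f x * (LINT z|lborel. f (x + z /\<^sub>R ?n m) * gauss z)) \<longlonglongrightarrow> (LINT x|lborel. (f x)\<^sup>2)"
  proof (rule integral_dominated_convergence)
    show "integrable lborel (\<lambda>x. \<bar>f x\<bar> * M)" using f by auto
    show "AE x in lborel. (\<lambda>m. f x * (LINT z|lborel. f (x + z /\<^sub>R ?n m) * gauss z)) \<longlonglongrightarrow> (f x)\<^sup>2"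
    proof (rule AE_I2)
      fix x
      have "(\<lambda>m. LINT z|lborel. f (x + z /\<^sub>R ?n m) * gauss z) \<longlonglongrightarrow> (LINT z|lborel. f x * gauss z)"
      proof (rule integral_dominated_convergence)
        show "integrable lborel (\<lambda>z. M * gauss z)" using gauss_integral by auto
        show "AE z in lborel. (\<lambda>m. f (x + z /\<^sub>R ?n m) * gauss z) \<longlonglongrightarrow> f x * gauss z"
        proof (rule AE_I2)
          fix z
          have "(\<lambda>m. x + z /\<^sub>R ?n m) \<longlonglongrightarrow> x + 0 *\<^sub>R z"
            by (intro tendsto_intros LIMSEQ_inverse_real_of_nat)
          then have "(\<lambda>m. f (x + z /\<^sub>R ?n m)) \<longlonglongrightarrow> f x"
            using c by (intro isCont_tendsto_compose[of x f]) (auto simp: continuous_on_eq_continuous_at)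
          then show "(\<lambda>m. f (x + z /\<^sub>R ?n m) * gauss z) \<longlonglongrightarrow> f x * gauss z"
            by (intro tendsto_intros)
        qed
        show "AE z in lborel. norm (f (x + z /\<^sub>R ?n m) * gauss z) \<le> M * gauss z" for m
          using M gauss_pos by (auto simp: abs_mult less_imp_le intro!: AE_I2 mult_right_mono)
      qed measurable
      then have "(\<lambda>m. f x * (LINT z|lborel. f (x + z /\<^sub>R ?n m) * gauss z)) \<longlonglongrightarrow> f x * (LINT z|lborel. f x * gauss z)"
        by (intro tendsto_intros)
      then show "(\<lambda>m. f x * (LINT z|lborel. f (x + z /\<^sub>R ?n m) * gauss z)) \<longlonglongrightarrow> (f x)\<^sup>2"
        using gauss_integral by (simp add: power2_eq_square)
    qed
    show "AE x in lborel. norm (f x * (LINT z|lborel. f (x + z /\<^sub>R ?n m) * gauss z)) \<le> \<bar>f x\<bar> * M" for m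
    proof (rule AE_I2)
      fix x
      have "\<bar>LINT z|lborel. f (x + z /\<^sub>R ?n m) * gauss z\<bar> \<le> (LINT z|lborel. \<bar>f (x + z /\<^sub>R ?n m) * gauss z\<bar>)"
        by (rule integral_abs_bound)
      also have "\<dots> \<le> (LINT z|lborel. M * gauss z)"
        using M gauss_pos gauss_integral order_trans[OF abs_ge_zero M]
        by (intro integral_mono') (auto simp: abs_mult less_imp_le intro!: mult_right_mono mult_nonneg_nonneg)
      also have "\<dots> = M" using gauss_integral by simp
      finally show "norm (f x * (LINT z|lborel. f (x + z /\<^sub>R ?n m) * gauss z)) \<le> \<bar>f x\<bar> * M"
        by (simp add: abs_mult mult_left_mono)
    qed
  qed measurable
qed

section \<open>Isometry on L^1 and L^2 functions by approximation\<close>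

definition L12 :: "(real^2 \<Rightarrow> real) \<Rightarrow> bool" where
  "L12 f \<longleftrightarrow> integrable lborel f \<and> sq_integrable f"

lemma L12_diff: "L12 f \<Longrightarrow> L12 g \<Longrightarrow> L12 (\<lambda>x. f x - g x)"
  by (auto simp: L12_def sq_integrable_diff)

lemma integrable_indicator_cball:
  "integrable lborel (\<lambda>x::real^2. indicator (cball 0 R) x *\<^sub>R (c::real))"
  by (intro integrable_scaleR_left integrable_real_indicator)
    (use emeasure_bounded_finite[OF bounded_cball, of "0::real^2" R] in auto)

lemma eventually_real_ge: "eventually (\<lambda>k. c \<le> real k) sequentially"
  by (rule filterlim_at_top[THEN iffD1, rule_format, OF filterlim_real_sequentially])

lemma L12_bounded_support:
  assumes [measurable]: "f \<in> borel_measurable borel" and M: "\<And>x. \<bar>f x\<bar> \<le> M" and R: "\<And>x. norm x > R \<Longrightarrow> f x = 0"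
  shows "L12 f"
proof -
  have M0: "0 \<le> M" using order_trans[OF abs_ge_zero M] .
  note i = integrable_indicator_cball
  have "integrable lborel f"
  proof (rule Bochner_Integration.integrable_bound[OF i[of R M]])
    show "AE x in lborel. norm (f x) \<le> norm (indicator (cball 0 R) x *\<^sub>R M)"
      using M M0 R by (auto simp: indicator_def not_le)
  qed measurable
  moreover have "integrable lborel (\<lambda>x. (f x)\<^sup>2)"
  proof (rule Bochner_Integration.integrable_bound[OF i[of R "M\<^sup>2"]])
    show "AE x in lborel. norm ((f x)\<^sup>2) \<le> norm (indicator (cball 0 R) x *\<^sub>R M\<^sup>2)"
      using M M0 R by (auto simp: indicator_def not_le abs_le_square_iff[symmetric])
  qed measurable
  ultimately show ?thesis by (auto simp: L12_def sq_integrable_def)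
qed

lemma norm_mk_hartley_le:
  assumes "L12 f"
  shows "norm (mk_L2 (hartley f)) \<le> norm (mk_L2 f)"
proof -
  have "(norm (mk_L2 (hartley f)))\<^sup>2 \<le> (norm (mk_L2 f))\<^sup>2"
    using assms hartley_contraction[of f] by (simp add: L12_def norm_mk_L2)
  then show ?thesis by (rule power2_le_imp_le) simp
qed

lemma mk_hartley_diff:
  assumes "L12 f" "L12 g"
  shows "mk_L2 (hartley (\<lambda>x. f x - g x)) = mk_L2 (hartley f) - mk_L2 (hartley g)"
proof -
  have "hartley (\<lambda>x. f x - g x) = (\<lambda>\<xi>. hartley f \<xi> - hartley g \<xi>)"
    using assms by (auto simp: L12_def hartley_diff)
  then show ?thesis
    using assms by (simp add: L12_def hartley_contraction(1) mk_L2_diff)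
qed

text \<open>The transform is already a contraction, so replacing f by \<open>g k\<close> and its
  transform back costs the distance of f and \<open>g k\<close> each time: twice in all. That
  distance tends to 0 by dominated convergence.\<close>

lemma norm_mk_hartley_approx:
  assumes f: "L12 f" and g: "\<And>k. L12 (g k)"
    and iso: "\<And>k. norm (mk_L2 (hartley (g k))) = norm (mk_L2 (g k))"
    and lim: "AE x in lborel. (\<lambda>k. g k x) \<longlonglongrightarrow> f x"
    and dom: "integrable lborel F" "\<And>k x. (f x - g k x)\<^sup>2 \<le> F x"
  shows "norm (mk_L2 (hartley f)) = norm (mk_L2 f)"
proof (rule antisym[OF norm_mk_hartley_le[OF f]])
  have [measurable]: "f \<in> borel_measurable borel" "\<And>k. g k \<in> borel_measurable borel"
    using f g by (auto simp: L12_def sq_integrable_def)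
  have "(\<lambda>k. LINT x|lborel. (f x - g k x)\<^sup>2) \<longlonglongrightarrow> integral\<^sup>L lborel (\<lambda>x::real^2. 0::real)"
  proof (rule integral_dominated_convergence[OF _ _ dom(1)])
    show "AE x in lborel. (\<lambda>k. (f x - g k x)\<^sup>2) \<longlonglongrightarrow> 0"
      using lim
    proof eventually_elim
      fix x assume "(\<lambda>k. g k x) \<longlonglongrightarrow> f x"
      then have "(\<lambda>k. (f x - g k x)\<^sup>2) \<longlonglongrightarrow> (f x - f x)\<^sup>2" by (intro tendsto_intros)
      then show "(\<lambda>k. (f x - g k x)\<^sup>2) \<longlonglongrightarrow> 0" by simp
    qed
  qed (use dom in auto)
  moreover have "(LINT x|lborel. (f x - g k x)\<^sup>2) = (norm (mk_L2 (\<lambda>x. f x - g k x)))\<^sup>2" for k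
    using L12_diff[OF f g[of k]] by (simp add: L12_def norm_mk_L2)
  ultimately have "(\<lambda>k. sqrt ((norm (mk_L2 (\<lambda>x. f x - g k x)))\<^sup>2)) \<longlonglongrightarrow> sqrt 0"
    by (intro tendsto_real_sqrt) simp
  then have z: "(\<lambda>k. norm (mk_L2 (\<lambda>x. f x - g k x))) \<longlonglongrightarrow> 0" by simp
  have "norm (mk_L2 f) - 2 * norm (mk_L2 (\<lambda>x. f x - g k x)) \<le> norm (mk_L2 (hartley f))" for k
  proof -
    have "mk_L2 (\<lambda>x. f x - g k x) = mk_L2 f - mk_L2 (g k)"
      using f g[of k] by (simp add: L12_def mk_L2_diff)
    then have "norm (mk_L2 f) \<le> norm (mk_L2 (g k)) + norm (mk_L2 (\<lambda>x. f x - g k x))"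
      using norm_triangle_ineq[of "mk_L2 (g k)" "mk_L2 f - mk_L2 (g k)"] by simp
    moreover have "norm (mk_L2 (hartley (g k))) \<le> norm (mk_L2 (hartley f)) + norm (mk_L2 (\<lambda>x. f x - g k x))"
      using norm_triangle_ineq2[of "mk_L2 (hartley (g k))" "mk_L2 (hartley f)"]
        norm_mk_hartley_le[OF L12_diff[OF f g[of k]]] mk_hartley_diff[OF f g[of k]]
      by (simp add: norm_minus_commute)
    ultimately show ?thesis using iso[of k] by simp
  qed
  then show "norm (mk_L2 f) \<le> norm (mk_L2 (hartley f))"
    using LIMSEQ_le_const2[OF tendsto_diff[OF tendsto_const tendsto_mult[OF tendsto_const z]]] by fastforce
qed

text \<open>A measurable function is an almost everywhere limit of continuous ones. Clamping their
  values and cutting them off keeps the common bound and support that dominated convergence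
  requires.\<close>

lemma norm_mk_hartley_bounded_support:
  assumes fm [measurable]: "f \<in> borel_measurable borel" and M: "\<And>x. \<bar>f x\<bar> \<le> M" and R: "\<And>x. norm x > R \<Longrightarrow> f x = 0"
  shows "norm (mk_L2 (hartley f)) = norm (mk_L2 f)"
proof -
  have M0: "0 \<le> M" using order_trans[OF abs_ge_zero M] .
  have "f measurable_on UNIV"
    by (rule lebesgue_measurable_imp_measurable_on) (auto intro: measurable_completion)
  then obtain N h where N: "negligible N" and hc: "\<And>n. continuous_on UNIV (h n)"
    and hl: "\<And>x. x \<notin> N \<Longrightarrow> (\<lambda>n. h n x) \<longlonglongrightarrow> f x"
    unfolding measurable_on_def by auto
  \<comment> \<open>A continuous cutoff equal to 1 on the support of f; the price is that the
    support of the approximants grows by 1.\<close>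
  define chi where "chi x = max 0 (min 1 (R + 1 - norm x))" for x :: "real^2"
  define g where "g k x = chi x * max (- M) (min M (h k x))" for k x
  have chi: "0 \<le> chi x" "chi x \<le> 1" "norm x > R + 1 \<Longrightarrow> chi x = 0" "norm x \<le> R \<Longrightarrow> chi x = 1" for x
    by (auto simp: chi_def)
  have gc: "continuous_on UNIV (g k)" for k
    unfolding g_def[abs_def] chi_def[abs_def] by (intro continuous_intros hc)
  then have [measurable]: "g k \<in> borel_measurable borel" for k
    by (rule borel_measurable_continuous_onI)
  have gM: "\<bar>g k x\<bar> \<le> M" for k x
  proof -
    have "\<bar>g k x\<bar> \<le> 1 * M"
      unfolding g_def abs_mult using chi M0 by (intro mult_mono) auto
    then show ?thesis by simp
  qed
  have gR: "norm x > R + 1 \<Longrightarrow> g k x = 0" for k x by (simp add: g_def chi)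
  have gL: "L12 (g k)" for k by (rule L12_bounded_support[OF _ gM gR]) auto
  have fL: "L12 f" by (rule L12_bounded_support[OF fm M R])
  show ?thesis
  proof (rule norm_mk_hartley_approx[OF fL gL])
    show "norm (mk_L2 (hartley (g k))) = norm (mk_L2 (g k))" for k
    proof (rule antisym[OF norm_mk_hartley_le[OF gL]])
      have "(norm (mk_L2 (g k)))\<^sup>2 \<le> (norm (mk_L2 (hartley (g k))))\<^sup>2"
        using gL[of k] hartley_isometry_continuous[OF _ _ gc gM, of k] hartley_contraction(1)[of "g k"]
        by (simp add: L12_def norm_mk_L2)
      then show "norm (mk_L2 (g k)) \<le> norm (mk_L2 (hartley (g k)))" by (rule power2_le_imp_le) simp
    qed
    have "AE x in lebesgue. x \<notin> N" using N by (simp add: negligible_iff_null_sets AE_not_in)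
    then have "AE x in lebesgue. (\<lambda>k. g k x) \<longlonglongrightarrow> f x"
    proof eventually_elim
      fix x assume "x \<notin> N"
      from hl[OF this] have "(\<lambda>k. g k x) \<longlonglongrightarrow> chi x * max (- M) (min M (f x))"
        unfolding g_def by (intro tendsto_intros tendsto_max tendsto_min)
      also have "max (- M) (min M (f x)) = f x" using M[of x] by auto
      also have "chi x * f x = f x" using chi(4)[of x] R[of x] by (cases "norm x \<le> R") auto
      finally show "(\<lambda>k. g k x) \<longlonglongrightarrow> f x" .
    qed
    then show "AE x in lborel. (\<lambda>k. g k x) \<longlonglongrightarrow> f x" by (simp add: AE_completion_iff)
    show "integrable lborel (\<lambda>x::real^2. indicator (cball 0 (R + 1)) x *\<^sub>R (2 * M)\<^sup>2)"
      by (rule integrable_indicator_cball)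
    show "(f x - g k x)\<^sup>2 \<le> indicator (cball 0 (R + 1)) x *\<^sub>R (2 * M)\<^sup>2" for k x
    proof (cases "norm x > R + 1")
      case False
      have "\<bar>f x - g k x\<bar> \<le> 2 * M" using M[of x] gM[of k x] by linarith
      then have "(f x - g k x)\<^sup>2 \<le> (2 * M)\<^sup>2" 
        using power_mono[OF _ abs_ge_zero, of "f x - g k x" "2 * M" 2] by simp
      then show ?thesis using False by simp
    qed (use R gR in auto)
  qed
qed

lemma norm_mk_hartley:
  assumes f: "L12 f"
  shows "norm (mk_L2 (hartley f)) = norm (mk_L2 f)"
proof -
  have [measurable]: "f \<in> borel_measurable borel" using f by (auto simp: L12_def sq_integrable_def)
  define g where "g k x = (if norm x \<le> real k \<and> \<bar>f x\<bar> \<le> real k then f x else 0)" for k x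
  have [measurable]: "g k \<in> borel_measurable borel" for k unfolding g_def[abs_def] by measurable
  have g1: "\<bar>g k x\<bar> \<le> real k" "norm x > real k \<Longrightarrow> g k x = 0" for k x by (auto simp: g_def)
  show ?thesis
  proof (rule norm_mk_hartley_approx[OF f])
    show "L12 (g k)" "norm (mk_L2 (hartley (g k))) = norm (mk_L2 (g k))" for k
      by (rule L12_bounded_support[OF _ g1] norm_mk_hartley_bounded_support[OF _ g1]; simp)+
    show "AE x in lborel. (\<lambda>k. g k x) \<longlonglongrightarrow> f x"
    proof (rule AE_I2)
      fix x :: "real^2"
      have "eventually (\<lambda>k. max (norm x) \<bar>f x\<bar> \<le> real k) sequentially"
        by (rule eventually_real_ge)
      then have "eventually (\<lambda>k. g k x = f x) sequentially"
        by eventually_elim (auto simp: g_def)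
      then show "(\<lambda>k. g k x) \<longlonglongrightarrow> f x" by (rule tendsto_eventually)
    qed
    show "integrable lborel (\<lambda>x. (f x)\<^sup>2)" using f by (simp add: L12_def sq_integrable_def)
    show "(f x - g k x)\<^sup>2 \<le> (f x)\<^sup>2" for k x by (auto simp: g_def)
  qed
qed

section \<open>Extension of the Hartley transform to L^2\<close>

definition trunc :: "nat \<Rightarrow> (real^2 \<Rightarrow> real) \<Rightarrow> real^2 \<Rightarrow> real" where
  "trunc n f x = (if norm x \<le> real n then f x else 0)"

lemma sq_integrable_trunc:
  assumes f: "sq_integrable f"
  shows "sq_integrable (trunc n f)"
proof -
  have [measurable]: "f \<in> borel_measurable borel" using f by (simp add: sq_integrable_def)
  have m [measurable]: "trunc n f \<in> borel_measurable borel" unfolding trunc_def[abs_def] by measurable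
  have "integrable lborel (\<lambda>x. (f x)\<^sup>2)" using f by (simp add: sq_integrable_def)
  then have "integrable lborel (\<lambda>x. (trunc n f x)\<^sup>2)"
    by (rule Bochner_Integration.integrable_bound) (auto simp: trunc_def)
  then show ?thesis by (simp add: sq_integrable_def)
qed

lemma L12_trunc:
  assumes f: "sq_integrable f"
  shows "L12 (trunc n f)"
proof -
  have s: "sq_integrable (trunc n f)" by (rule sq_integrable_trunc[OF f])
  have [measurable]: "trunc n f \<in> borel_measurable borel" using s by (simp add: sq_integrable_def)
  have "integrable lborel (\<lambda>x. indicator (cball 0 (real n)) x + (trunc n f x)\<^sup>2)"
    using s integrable_indicator_cball[of "real n" 1]
    by (intro Bochner_Integration.integrable_add) (auto simp: sq_integrable_def)
  then have "integrable lborel (trunc n f)"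
  proof (rule Bochner_Integration.integrable_bound)
    have "\<bar>a\<bar> \<le> 1 + a\<^sup>2" for a :: real
      using sum_squares_bound[of "\<bar>a\<bar>" 1] zero_le_power2[of a] by simp
    then show "AE x in lborel. norm (trunc n f x) \<le> norm (indicator (cball 0 (real n)) x + (trunc n f x)\<^sup>2)"
      by (auto simp: trunc_def indicator_def)
  qed simp
  then show ?thesis using s by (simp add: L12_def)
qed

lemma mk_trunc_tendsto:
  assumes f: "sq_integrable f"
  shows "(\<lambda>n. mk_L2 (trunc n f)) \<longlonglongrightarrow> mk_L2 f"
proof -
  have [measurable]: "f \<in> borel_measurable borel" using f by (simp add: sq_integrable_def)
  have [measurable]: "trunc n f \<in> borel_measurable borel" for n unfolding trunc_def[abs_def] by measurable
  have "(\<lambda>n. LINT x|lborel. (trunc n f x - f x)\<^sup>2) \<longlonglongrightarrow> integral\<^sup>L lborel (\<lambda>x::real^2. 0::real)"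
  proof (rule integral_dominated_convergence)
    show "integrable lborel (\<lambda>x. (f x)\<^sup>2)" using f by (simp add: sq_integrable_def)
    show "AE x in lborel. (\<lambda>n. (trunc n f x - f x)\<^sup>2) \<longlonglongrightarrow> 0"
    proof (rule AE_I2)
      fix x :: "real^2"
      have "eventually (\<lambda>k. norm x \<le> real k) sequentially"
        by (rule eventually_real_ge)
      then have "eventually (\<lambda>k. (trunc k f x - f x)\<^sup>2 = 0) sequentially"
        by eventually_elim (auto simp: trunc_def)
      then show "(\<lambda>k. (trunc k f x - f x)\<^sup>2) \<longlonglongrightarrow> 0" by (rule tendsto_eventually)
    qed
  qed (auto simp: trunc_def)
  moreover have "(LINT x|lborel. (trunc n f x - f x)\<^sup>2) = (norm (mk_L2 (trunc n f) - mk_L2 f))\<^sup>2" for n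
    using norm_mk_L2[OF sq_integrable_diff[OF sq_integrable_trunc[OF f, of n] f]]
    by (simp add: mk_L2_diff sq_integrable_trunc f)
  ultimately have "(\<lambda>k. sqrt ((norm (mk_L2 (trunc k f) - mk_L2 f))\<^sup>2)) \<longlonglongrightarrow> sqrt 0"
    by (intro tendsto_real_sqrt) simp
  then show ?thesis by (simp add: tendsto_norm_zero_iff LIM_zero_iff)
qed

text \<open>The truncations are those in the definition of \<open>fourier_L2\<close>, so the two
  limits can be compared term by term.\<close>

definition hartley_L2 :: "real L2 \<Rightarrow> real L2" where
  "hartley_L2 u = lim (\<lambda>n. mk_L2 (hartley (trunc n (rep_L2 u))))"

lemma hartley_L2_tendsto: "(\<lambda>n. mk_L2 (hartley (trunc n (rep_L2 u)))) \<longlonglongrightarrow> hartley_L2 u"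
proof -
  let ?t = "\<lambda>n. trunc n (rep_L2 u)"
  have L: "L12 (?t n)" for n by (rule L12_trunc[OF sq_integrable_rep_L2])
  have d: "dist (mk_L2 (hartley (?t m))) (mk_L2 (hartley (?t n))) = dist (mk_L2 (?t m)) (mk_L2 (?t n))" for m n
    using norm_mk_hartley[OF L12_diff[OF L[of m] L[of n]]] L[of m] L[of n]
    by (simp add: dist_norm mk_hartley_diff mk_L2_diff L12_def)
  have "Cauchy (\<lambda>n. mk_L2 (?t n))"
    using mk_trunc_tendsto[OF sq_integrable_rep_L2[of u]] by (rule LIMSEQ_imp_Cauchy)
  then have "Cauchy (\<lambda>n. mk_L2 (hartley (?t n)))" by (simp add: Cauchy_def d)
  then have "convergent (\<lambda>n. mk_L2 (hartley (?t n)))" by (rule complete_L2)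
  then show ?thesis by (simp add: hartley_L2_def convergent_LIMSEQ_iff)
qed

lemma hartley_L2_mk:
  assumes f: "L12 f"
  shows "hartley_L2 (mk_L2 f) = mk_L2 (hartley f)"
proof (rule LIMSEQ_unique[OF hartley_L2_tendsto])
  let ?g = "rep_L2 (mk_L2 f)"
  have fs: "sq_integrable f" using f by (simp add: L12_def)
  have [measurable]: "f \<in> borel_measurable borel" using fs by (simp add: sq_integrable_def)
  have ae: "AE x in lborel. ?g x = f x" by (rule AE_rep_mk_L2[OF fs])
  have "hartley (trunc n ?g) = hartley (trunc n f)" for n
    by (rule hartley_cong_AE) (use ae in \<open>auto simp: trunc_def[abs_def] elim: eventually_mono\<close>)
  moreover have "(\<lambda>n. mk_L2 (hartley (trunc n f))) \<longlonglongrightarrow> mk_L2 (hartley f)"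
  proof (rule LIM_zero_cancel, rule tendsto_norm_zero_cancel)
    have "norm (mk_L2 (hartley (trunc n f)) - mk_L2 (hartley f)) = norm (mk_L2 (trunc n f) - mk_L2 f)" for n
      using norm_mk_hartley[OF L12_diff[OF L12_trunc[OF fs, of n] f]] f L12_trunc[OF fs, of n]
      by (simp add: mk_hartley_diff mk_L2_diff L12_def)
    then show "(\<lambda>n. norm (mk_L2 (hartley (trunc n f)) - mk_L2 (hartley f))) \<longlonglongrightarrow> 0"
      using mk_trunc_tendsto[OF fs] by (simp add: tendsto_norm_zero_iff LIM_zero_iff)
  qed
  ultimately show "(\<lambda>n. mk_L2 (hartley (trunc n ?g))) \<longlonglongrightarrow> mk_L2 (hartley f)" by simp
qed

lemma trunc_dense: "(\<lambda>n. mk_L2 (trunc n (rep_L2 u))) \<longlonglongrightarrow> u"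
  using mk_trunc_tendsto[OF sq_integrable_rep_L2[of u]] by simp

lemma norm_hartley_L2: "norm (hartley_L2 u) = norm u"
proof (rule LIMSEQ_unique)
  show "(\<lambda>n. norm (mk_L2 (trunc n (rep_L2 u)))) \<longlonglongrightarrow> norm u" by (intro tendsto_norm trunc_dense)
  show "(\<lambda>n. norm (mk_L2 (trunc n (rep_L2 u)))) \<longlonglongrightarrow> norm (hartley_L2 u)"
    using tendsto_norm[OF hartley_L2_tendsto[of u]]
    by (simp add: norm_mk_hartley L12_trunc sq_integrable_rep_L2)
qed

lemma hartley_L2_diff: "hartley_L2 (u - v) = hartley_L2 u - hartley_L2 v"
proof (rule LIMSEQ_unique[OF hartley_L2_tendsto])
  have "hartley (trunc n (rep_L2 (u - v))) = hartley (\<lambda>x. trunc n (rep_L2 u) x - trunc n (rep_L2 v) x)" for n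
    by (rule hartley_cong_AE)
      (use AE_rep_diff[of u v] in \<open>auto simp: trunc_def[abs_def] elim!: eventually_mono\<close>)
  then have "mk_L2 (hartley (trunc n (rep_L2 (u - v))))
      = mk_L2 (hartley (trunc n (rep_L2 u))) - mk_L2 (hartley (trunc n (rep_L2 v)))" for n
    by (simp add: mk_hartley_diff L12_trunc sq_integrable_rep_L2)
  then show "(\<lambda>n. mk_L2 (hartley (trunc n (rep_L2 (u - v))))) \<longlonglongrightarrow> hartley_L2 u - hartley_L2 v"
    by (simp add: tendsto_diff hartley_L2_tendsto)
qed

lemma hartley_L2_scaleR: "hartley_L2 (c *\<^sub>R u) = c *\<^sub>R hartley_L2 u"
proof (rule LIMSEQ_unique[OF hartley_L2_tendsto])
  have "hartley (trunc n (rep_L2 (c *\<^sub>R u))) = hartley (\<lambda>x. c * trunc n (rep_L2 u) x)" for n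
    by (rule hartley_cong_AE)
      (use AE_rep_scaleR[of c u] in \<open>auto simp: trunc_def[abs_def] elim!: eventually_mono\<close>)
  moreover have "hartley (\<lambda>x. c * f x) = (\<lambda>\<xi>. c *\<^sub>R hartley f \<xi>)" for f
    by (auto simp: hartley_def fun_eq_iff mult.assoc)
  ultimately have "mk_L2 (hartley (trunc n (rep_L2 (c *\<^sub>R u)))) = c *\<^sub>R mk_L2 (hartley (trunc n (rep_L2 u)))" for n
    using L12_trunc[OF sq_integrable_rep_L2[of u], of n]
    by (simp add: mk_L2_scaleR hartley_contraction(1) L12_def del: real_scaleR_def)
  then show "(\<lambda>n. mk_L2 (hartley (trunc n (rep_L2 (c *\<^sub>R u))))) \<longlonglongrightarrow> c *\<^sub>R hartley_L2 u"
    by (simp add: tendsto_scaleR hartley_L2_tendsto)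
qed

lemma hartley_L2_add: "hartley_L2 (u + v) = hartley_L2 u + hartley_L2 v"
  using hartley_L2_diff[of u "(-1) *\<^sub>R v"] hartley_L2_scaleR[of "-1" v] by simp

lemma inner_isometry:
  fixes F :: "'a::real_inner \<Rightarrow> 'b::real_inner"
  assumes "\<And>u v. F (u + v) = F u + F v" and "\<And>u. norm (F u) = norm u"
  shows "inner (F u) (F v) = inner u v"
  by (simp add: dot_norm assms(2) flip: assms(1))

lemma inner_hartley_L2: "inner (hartley_L2 u) v = inner u (hartley_L2 v)"
proof (rule LIMSEQ_unique)
  let ?u = "\<lambda>n. trunc n (rep_L2 u)" and ?v = "\<lambda>n. trunc n (rep_L2 v)"
  have L: "L12 (?u n)" "L12 (?v n)" for n by (auto intro: L12_trunc sq_integrable_rep_L2)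
  show "(\<lambda>n. inner (mk_L2 (hartley (?u n))) (mk_L2 (?v n))) \<longlonglongrightarrow> inner (hartley_L2 u) v"
    by (intro tendsto_inner hartley_L2_tendsto trunc_dense)
  have "inner (mk_L2 (hartley (?u n))) (mk_L2 (?v n)) = inner (mk_L2 (?u n)) (mk_L2 (hartley (?v n)))" for n
    using L[of n] integral_hartley_mult[of "?u n" "?v n"] hartley_contraction(1)[of "?u n"] hartley_contraction(1)[of "?v n"]
    by (simp add: inner_L2_mk L12_def)
  then show "(\<lambda>n. inner (mk_L2 (hartley (?u n))) (mk_L2 (?v n))) \<longlonglongrightarrow> inner u (hartley_L2 v)"
    by (simp add: tendsto_inner hartley_L2_tendsto trunc_dense)
qed

lemma hartley_L2_involution: "hartley_L2 (hartley_L2 u) = u"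
proof -
  have "inner (hartley_L2 (hartley_L2 u) - u) v = 0" for v
    using inner_isometry[of hartley_L2 u v] inner_hartley_L2[of "hartley_L2 u" v]
    by (simp add: hartley_L2_add norm_hartley_L2 inner_diff_left)
  from this[of "hartley_L2 (hartley_L2 u) - u"] show ?thesis by simp
qed

section \<open>The Fourier transform and Fourier multipliers\<close>

lemma sq_integrable_Complex:
  assumes a: "sq_integrable a" and b: "sq_integrable b"
  shows "sq_integrable (\<lambda>x. Complex (a x) (b x))"
    and "(LINT x|lborel. (norm (Complex (a x) (b x)))\<^sup>2) = (LINT x|lborel. (a x)\<^sup>2 + (b x)\<^sup>2)"
proof -
  have [measurable]: "a \<in> borel_measurable borel" "b \<in> borel_measurable borel"
    using a b by (auto simp: sq_integrable_def)
  have eq: "(\<lambda>x. Complex (a x) (b x)) = (\<lambda>x. complex_of_real (a x) + \<i> * complex_of_real (b x))"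
    by (auto simp: complex_eq_iff)
  have n: "(norm (Complex (a x) (b x)))\<^sup>2 = (a x)\<^sup>2 + (b x)\<^sup>2" for x by (simp add: cmod_power2)
  have "(\<lambda>x. Complex (a x) (b x)) \<in> borel_measurable borel" unfolding eq by measurable
  then show "sq_integrable (\<lambda>x. Complex (a x) (b x))"
    using a b unfolding sq_integrable_def n by auto
  show "(LINT x|lborel. (norm (Complex (a x) (b x)))\<^sup>2) = (LINT x|lborel. (a x)\<^sup>2 + (b x)\<^sup>2)"
    unfolding n ..
qed

lemma sq_integrable_Re_Im:
  assumes "sq_integrable \<phi>"
  shows "sq_integrable (\<lambda>x. Re (\<phi> x))" "sq_integrable (\<lambda>x. Im (\<phi> x))"
proof -
  have [measurable]: "\<phi> \<in> borel_measurable borel" using assms by (auto simp: sq_integrable_def)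
  have i: "integrable lborel (\<lambda>x. (norm (\<phi> x))\<^sup>2)" using assms by (auto simp: sq_integrable_def)
  have "integrable lborel (\<lambda>x. (Re (\<phi> x))\<^sup>2)" "integrable lborel (\<lambda>x. (Im (\<phi> x))\<^sup>2)"
    by (rule Bochner_Integration.integrable_bound[OF i]; auto simp: cmod_power2)+
  then show "sq_integrable (\<lambda>x. Re (\<phi> x))" "sq_integrable (\<lambda>x. Im (\<phi> x))"
    by (auto simp: sq_integrable_def)
qed

lemma orthogonal_transformation_uminus: "orthogonal_transformation (\<lambda>x::real^2. - x)"
  by (simp add: orthogonal_transformation_def linear_iff)

lemmas AE_uminus = AE_orthogonal[OF orthogonal_transformation_uminus]

text \<open>The even part of h minus i times its odd part: it carries the Hartley transform of a
  real function to its Fourier transform.\<close>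

definition hartley_complex :: "(real^2 \<Rightarrow> real) \<Rightarrow> real^2 \<Rightarrow> complex" where
  "hartley_complex h \<xi> = Complex ((h \<xi> + h (- \<xi>)) / 2) ((h (- \<xi>) - h \<xi>) / 2)"

lemma sq_integrable_hartley_complex:
  assumes h: "sq_integrable h"
  shows "sq_integrable (hartley_complex h)"
    and "(norm (mk_L2 (hartley_complex h)))\<^sup>2 = (norm (mk_L2 h))\<^sup>2"
proof -
  have h': "sq_integrable (\<lambda>\<xi>. h (- \<xi>))"
    by (rule sq_integrable_orthogonal[OF orthogonal_transformation_uminus h])
  have hm: "h \<in> borel_measurable borel" using h by (simp add: sq_integrable_def)
  have a: "sq_integrable (\<lambda>\<xi>. (h \<xi> + h (- \<xi>)) / 2)" "sq_integrable (\<lambda>\<xi>. (h (- \<xi>) - h \<xi>) / 2)"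
    using sq_integrable_scaleR[OF sq_integrable_add[OF h h'], of "1/2"]
      sq_integrable_scaleR[OF sq_integrable_diff[OF h' h], of "1/2"] by simp_all
  show s: "sq_integrable (hartley_complex h)"
    unfolding hartley_complex_def[abs_def] by (rule sq_integrable_Complex(1)[OF a])
  have i: "integrable lborel (\<lambda>\<xi>. (h \<xi>)\<^sup>2)" "integrable lborel (\<lambda>\<xi>. (h (- \<xi>))\<^sup>2)"
    using h h' by (auto simp: sq_integrable_def)
  have "(norm (mk_L2 (hartley_complex h)))\<^sup>2 = (LINT \<xi>|lborel. ((h \<xi> + h (- \<xi>)) / 2)\<^sup>2 + ((h (- \<xi>) - h \<xi>) / 2)\<^sup>2)"
    unfolding norm_mk_L2[OF s] unfolding hartley_complex_def by (rule sq_integrable_Complex(2)[OF a])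
  also have "\<dots> = (LINT \<xi>|lborel. ((h \<xi>)\<^sup>2 + (h (- \<xi>))\<^sup>2) / 2)"
    by (intro Bochner_Integration.integral_cong refl) (simp add: power2_eq_square field_simps)
  also have "\<dots> = (LINT \<xi>|lborel. (h \<xi>)\<^sup>2)"
    using i integral_orthogonal[OF orthogonal_transformation_uminus, of "\<lambda>\<xi>. (h \<xi>)\<^sup>2"] hm by simp
  finally show "(norm (mk_L2 (hartley_complex h)))\<^sup>2 = (norm (mk_L2 h))\<^sup>2"
    using norm_mk_L2[OF h] by simp
qed

lemma norm_mk_hartley_complex: "sq_integrable h \<Longrightarrow> norm (mk_L2 (hartley_complex h)) = norm (mk_L2 h)"
  using sq_integrable_hartley_complex(2)[of h] by (simp add: power2_eq_iff_nonneg)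

lemma hartley_complex_AE_cong:
  assumes "AE x in lborel. h x = k x"
  shows "AE x in lborel. hartley_complex h x = hartley_complex k x"
  using assms AE_uminus[OF assms] by eventually_elim (simp add: hartley_complex_def)

lemma fourier_integral_hartley:
  assumes f: "integrable lborel f"
  shows "fourier_integral (\<lambda>x. complex_of_real (f x)) = hartley_complex (hartley f)"
proof
  fix \<xi> :: "real^2"
  let ?\<theta> = "\<lambda>x. 2 * pi * (x \<bullet> \<xi>)"
  have [measurable]: "f \<in> borel_measurable borel" using f by auto
  have c: "integrable lborel (\<lambda>x. f x * cos (?\<theta> x))" and s: "integrable lborel (\<lambda>x. f x * sin (?\<theta> x))"
    by (rule Bochner_Integration.integrable_bound[OF f]; auto simp: abs_mult mult_left_le)+
  have H: "hartley f \<xi> = (LINT x|lborel. f x * cos (?\<theta> x)) + (LINT x|lborel. f x * sin (?\<theta> x))"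
    "hartley f (- \<xi>) = (LINT x|lborel. f x * cos (?\<theta> x)) - (LINT x|lborel. f x * sin (?\<theta> x))"
    using c s by (simp_all add: hartley_def cas_def distrib_left right_diff_distrib)
  have e: "complex_of_real (f x) * exp (- 2 * complex_of_real pi * \<i> * complex_of_real (x \<bullet> \<xi>))
      = complex_of_real (f x * cos (?\<theta> x)) - \<i> * complex_of_real (f x * sin (?\<theta> x))" for x
    by (simp add: complex_eq_iff Re_exp Im_exp)
  have "fourier_integral (\<lambda>x. complex_of_real (f x)) \<xi>
      = complex_of_real (LINT x|lborel. f x * cos (?\<theta> x)) - \<i> * complex_of_real (LINT x|lborel. f x * sin (?\<theta> x))"
    unfolding fourier_integral_def e using c s
    by (simp add: integral_complex_of_real del: of_real_mult)
  then show "fourier_integral (\<lambda>x. complex_of_real (f x)) \<xi> = hartley_complex (hartley f) \<xi>"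
    by (simp add: hartley_complex_def H complex_eq_iff)
qed

text \<open>For the truncations the relation holds by integration, and
  \<open>hartley_complex\<close> is isometric, so it passes to the limit. In particular the
  \<open>lim\<close> in the definition of \<open>fourier_L2\<close> is a genuine limit.\<close>

lemma fourier_L2_hartley: "fourier_L2 u = mk_L2 (hartley_complex (rep_L2 (hartley_L2 u)))"
  unfolding fourier_L2_def
proof (rule limI)
  let ?t = "\<lambda>n. trunc n (rep_L2 u)" and ?H = "rep_L2 (hartley_L2 u)"
  have L: "L12 (?t n)" for n by (rule L12_trunc[OF sq_integrable_rep_L2])
  have hs: "sq_integrable (hartley (?t n))" for n
    using L[of n] by (simp add: L12_def hartley_contraction(1))
  have eq: "(\<lambda>x. if norm x \<le> real n then complex_of_real (rep_L2 u x) else 0) = (\<lambda>x. complex_of_real (?t n x))" for n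
    by (auto simp: trunc_def)
  have "norm (mk_L2 (fourier_integral (\<lambda>x. complex_of_real (?t n x))) - mk_L2 (hartley_complex ?H))
      = norm (mk_L2 (hartley (?t n)) - hartley_L2 u)" for n
  proof -
    have "mk_L2 (fourier_integral (\<lambda>x. complex_of_real (?t n x))) - mk_L2 (hartley_complex ?H)
       = mk_L2 (\<lambda>x. hartley_complex (hartley (?t n)) x - hartley_complex ?H x)"
      using L[of n]
      by (simp add: fourier_integral_hartley L12_def hs sq_integrable_rep_L2
          sq_integrable_hartley_complex(1) mk_L2_diff)
    also have "(\<lambda>x. hartley_complex (hartley (?t n)) x - hartley_complex ?H x)
        = hartley_complex (\<lambda>x. hartley (?t n) x - ?H x)"
      by (auto simp: hartley_complex_def fun_eq_iff complex_eq_iff field_simps)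
    finally show ?thesis
      by (simp add: norm_mk_hartley_complex sq_integrable_diff hs sq_integrable_rep_L2 mk_L2_diff)
  qed
  then have "(\<lambda>n. norm (mk_L2 (fourier_integral (\<lambda>x. complex_of_real (?t n x))) - mk_L2 (hartley_complex ?H))) \<longlonglongrightarrow> 0"
    using hartley_L2_tendsto[of u] by (simp add: tendsto_norm_zero_iff LIM_zero_iff)
  then show "(\<lambda>n. mk_L2 (fourier_integral (\<lambda>x. if norm x \<le> real n then complex_of_real (rep_L2 u x) else 0)))
      \<longlonglongrightarrow> mk_L2 (hartley_complex ?H)"
    unfolding eq by (simp add: tendsto_norm_zero_iff LIM_zero_iff)
qed

abbreviation hat :: "real L2 \<Rightarrow> real^2 \<Rightarrow> complex" where "hat u \<equiv> rep_L2 (fourier_L2 u)"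

lemma AE_hat: "AE \<xi> in lborel. hat u \<xi> = hartley_complex (rep_L2 (hartley_L2 u)) \<xi>"
  unfolding fourier_L2_hartley
  by (intro AE_rep_mk_L2 sq_integrable_hartley_complex(1) sq_integrable_rep_L2)

lemma norm_fourier_L2: "norm (fourier_L2 u) = norm u"
  unfolding fourier_L2_hartley by (simp add: norm_mk_hartley_complex sq_integrable_rep_L2 norm_hartley_L2)

lemma AE_hat_add: "AE \<xi> in lborel. hat (u + v) \<xi> = hat u \<xi> + hat v \<xi>"
  using AE_hat[of u] AE_hat[of v] AE_hat[of "u + v"]
    hartley_complex_AE_cong[OF AE_rep_add[of "hartley_L2 u" "hartley_L2 v"]]
  by eventually_elim (simp add: hartley_L2_add, simp add: hartley_complex_def complex_eq_iff field_simps)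

lemma AE_hat_scaleR: "AE \<xi> in lborel. hat (c *\<^sub>R u) \<xi> = complex_of_real c * hat u \<xi>"
  using AE_hat[of u] AE_hat[of "c *\<^sub>R u"] hartley_complex_AE_cong[OF AE_rep_scaleR[of c "hartley_L2 u"]]
  by eventually_elim (simp add: hartley_L2_scaleR, simp add: hartley_complex_def complex_eq_iff field_simps)

lemma fourier_L2_add: "fourier_L2 (u + v) = fourier_L2 u + fourier_L2 v"
  by (rule L2_eqI, use AE_hat_add[of u v] AE_rep_add[of "fourier_L2 u" "fourier_L2 v"] in eventually_elim) simp

lemma fourier_L2_scaleR: "fourier_L2 (c *\<^sub>R u) = c *\<^sub>R fourier_L2 u"
  by (rule L2_eqI, use AE_hat_scaleR[of c u] AE_rep_scaleR[of c "fourier_L2 u"] in eventually_elim)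
    (simp add: scaleR_conv_of_real)

lemma inner_fourier_L2: "inner (fourier_L2 u) (fourier_L2 v) = inner u v"
  by (rule inner_isometry[OF fourier_L2_add norm_fourier_L2])

lemma fourier_L2_eq_iff: "fourier_L2 u = fourier_L2 v \<longleftrightarrow> u = v"
proof
  assume a: "fourier_L2 u = fourier_L2 v"
  have "fourier_L2 (u + (-1) *\<^sub>R v) = 0" unfolding fourier_L2_add fourier_L2_scaleR by (simp add: a)
  then have "norm (u + (-1) *\<^sub>R v) = 0" by (metis norm_fourier_L2 norm_zero)
  then show "u = v" by simp
qed simp

lemma hat_eqD: "AE \<xi> in lborel. hat u \<xi> = hat v \<xi> \<Longrightarrow> u = v"
  using L2_eqI[of "fourier_L2 u" "fourier_L2 v"] by (simp add: fourier_L2_eq_iff)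

lemma AE_hat_hermitian: "AE \<xi> in lborel. hat u (- \<xi>) = cnj (hat u \<xi>)"
  using AE_hat[of u] AE_uminus[OF AE_hat[of u]]
  by eventually_elim (simp add: hartley_complex_def complex_eq_iff)

text \<open>For Hermitian \<phi> the difference Re \<phi> - Im \<phi> is the real function whose
  even and odd parts encode \<phi>, and the Hartley transform undoes itself. Hence the range of the
  transform is the space of all Hermitian L^2 functions.\<close>

lemma fourier_L2_inverse:
  assumes \<phi>: "sq_integrable \<phi>" and herm: "AE \<xi> in lborel. \<phi> (- \<xi>) = cnj (\<phi> \<xi>)"
  shows "AE \<xi> in lborel. hat (hartley_L2 (mk_L2 (\<lambda>\<xi>. Re (\<phi> \<xi>) - Im (\<phi> \<xi>)))) \<xi> = \<phi> \<xi>"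
proof -
  let ?h = "\<lambda>\<xi>. Re (\<phi> \<xi>) - Im (\<phi> \<xi>)"
  have h: "sq_integrable ?h" using \<phi> by (intro sq_integrable_diff sq_integrable_Re_Im)
  have "AE \<xi> in lborel. hartley_complex (rep_L2 (mk_L2 ?h)) \<xi> = hartley_complex ?h \<xi>"
    by (intro hartley_complex_AE_cong AE_rep_mk_L2 h)
  then show ?thesis
    using AE_hat[of "hartley_L2 (mk_L2 ?h)"] herm
    by eventually_elim (simp add: hartley_L2_involution hartley_complex_def complex_eq_iff)
qed

lemma fourier_L2_surj:
  assumes "sq_integrable \<phi>" "AE \<xi> in lborel. \<phi> (- \<xi>) = cnj (\<phi> \<xi>)"
  obtains u where "AE \<xi> in lborel. hat u \<xi> = \<phi> \<xi>"
  using fourier_L2_inverse[OF assms] by blast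

text \<open>When the transform is also integrable, the function is given by an integral with a value
  at every point. The kernel representation of multipliers rests on this.\<close>

lemma fourier_L2_inverse_integrable:
  assumes \<phi>: "sq_integrable \<phi>" "integrable lborel \<phi>" and u: "AE \<xi> in lborel. hat u \<xi> = \<phi> \<xi>"
  shows "AE x in lborel. rep_L2 u x = hartley (\<lambda>\<xi>. Re (\<phi> \<xi>) - Im (\<phi> \<xi>)) x"
proof -
  let ?h = "\<lambda>\<xi>. Re (\<phi> \<xi>) - Im (\<phi> \<xi>)"
  have herm: "AE \<xi> in lborel. \<phi> (- \<xi>) = cnj (\<phi> \<xi>)"
    using u AE_uminus[OF u] AE_hat_hermitian[of u] by eventually_elim simp
  have h: "L12 ?h"
    unfolding L12_def using \<phi> by (auto intro!: sq_integrable_diff sq_integrable_Re_Im)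
  have "u = hartley_L2 (mk_L2 ?h)"
    by (rule hat_eqD, use u fourier_L2_inverse[OF \<phi>(1) herm] in eventually_elim) simp
  then have "u = mk_L2 (hartley ?h)" by (simp add: hartley_L2_mk[OF h])
  then show ?thesis
    using h AE_rep_mk_L2[of "hartley ?h"] by (simp add: L12_def hartley_contraction(1))
qed

section \<open>Covariance of the transform under orthogonal maps\<close>

context
  fixes T :: "real^2 \<Rightarrow> real^2"
  assumes T: "orthogonal_transformation T"
begin

lemma hartley_orthogonal:
  assumes [measurable]: "f \<in> borel_measurable borel"
  shows "hartley (\<lambda>x. f (T x)) \<xi> = hartley f (T \<xi>)"
proof -
  have "cas x \<xi> = cas (T x) (T \<xi>)" for x
    using T by (simp add: cas_def orthogonal_transformation_def)
  then have "hartley (\<lambda>x. f (T x)) \<xi> = (LINT x|lborel. f (T x) * cas (T x) (T \<xi>))"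
    by (simp add: hartley_def)
  also have "\<dots> = hartley f (T \<xi>)"
    unfolding hartley_def by (rule integral_orthogonal[OF T]) measurable
  finally show ?thesis .
qed

text \<open>An orthogonal map preserves the balls of the truncation, so the identity already holds
  before the limit is taken.\<close>

lemma hartley_L2_pullback: "hartley_L2 (pullback T u) = pullback T (hartley_L2 u)"
proof (rule LIMSEQ_unique[OF hartley_L2_tendsto])
  note [measurable] = orthogonal_transformation_borel[OF T]
  let ?t = "\<lambda>n. trunc n (rep_L2 u)"
  have L: "L12 (?t n)" for n by (rule L12_trunc[OF sq_integrable_rep_L2])
  have [measurable]: "?t n \<in> borel_measurable borel" for n
    using L[of n] by (simp add: L12_def sq_integrable_def)
  have hs: "sq_integrable (hartley (?t n))" for n
    using L[of n] by (simp add: L12_def hartley_contraction(1))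
  have "hartley (trunc n (rep_L2 (pullback T u))) = hartley (\<lambda>x. ?t n (T x))" for n
  proof (rule hartley_cong_AE)
    show "AE x in lborel. trunc n (rep_L2 (pullback T u)) x = ?t n (T x)"
      using AE_rep_pullback[OF T, of u]
      by eventually_elim (simp add: trunc_def orthogonal_transformation_norm[OF T])
  qed (auto simp: trunc_def[abs_def])
  moreover have "hartley (\<lambda>x. ?t n (T x)) = (\<lambda>\<xi>. hartley (?t n) (T \<xi>))" for n
    by (rule ext, rule hartley_orthogonal) measurable
  moreover have "mk_L2 (\<lambda>\<xi>. hartley (?t n) (T \<xi>)) = pullback T (mk_L2 (hartley (?t n)))" for n
  proof (rule mk_L2_eqI)
    show "sq_integrable (\<lambda>\<xi>. hartley (?t n) (T \<xi>))" by (rule sq_integrable_orthogonal[OF T hs])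
    show "AE x in lborel. hartley (?t n) (T x) = rep_L2 (pullback T (mk_L2 (hartley (?t n)))) x"
      using AE_rep_pullback[OF T, of "mk_L2 (hartley (?t n))"] AE_orthogonal[OF T AE_rep_mk_L2[OF hs[of n]]] by eventually_elim simp
  qed
  ultimately show "(\<lambda>n. mk_L2 (hartley (trunc n (rep_L2 (pullback T u))))) \<longlonglongrightarrow> pullback T (hartley_L2 u)"
    by (simp add: bounded_linear.tendsto[OF bounded_linear_pullback[OF T]] hartley_L2_tendsto)
qed

lemma AE_hat_pullback: "AE \<xi> in lborel. hat (pullback T u) \<xi> = hat u (T \<xi>)"
proof -
  interpret linear T using T by (rule orthogonal_transformation_linear)
  show ?thesis
    using AE_hat[of "pullback T u"] AE_orthogonal[OF T AE_hat[of u]]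
      hartley_complex_AE_cong[OF AE_rep_pullback[OF T, of "hartley_L2 u"]]
    by eventually_elim (simp add: hartley_L2_pullback, simp add: hartley_complex_def neg)
qed

end

section \<open>Constant-coefficient operators as Fourier multipliers\<close>

definition hermitian :: "(real^2 \<Rightarrow> complex) \<Rightarrow> bool" where
  "hermitian p \<longleftrightarrow> p \<in> borel_measurable borel \<and> (\<forall>\<xi>. p (- \<xi>) = cnj (p \<xi>))"

lemma diffop_symbol_continuous: "diffop_symbol p \<Longrightarrow> continuous_on UNIV p"
  unfolding diffop_symbol_def by (auto simp: case_prod_beta intro!: continuous_intros)

lemma diffop_symbol_hermitian: 
  assumes "diffop_symbol p"
  shows "hermitian p"
proof -
  have "p (- \<xi>) = cnj (p \<xi>)" for \<xi>
    using assms unfolding diffop_symbol_def by (auto simp: case_prod_beta intro!: sum.cong)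
  then show ?thesis
    using borel_measurable_continuous_onI[OF diffop_symbol_continuous[OF assms]] by (simp add: hermitian_def)
qed

text \<open>Justifies the definite description in \<open>diffop\<close>: a Hermitian symbol keeps
  the product Hermitian, so it is the transform of some real function, and injectivity of the
  transform makes that function unique.\<close>

lemma AE_hat_diffop:
  assumes p: "hermitian p" and u: "u \<in> H_space p"
  shows "AE \<xi> in lborel. hat (diffop p u) \<xi> = p \<xi> * hat u \<xi>"
proof -
  have "AE \<xi> in lborel. p (- \<xi>) * hat u (- \<xi>) = cnj (p \<xi> * hat u \<xi>)"
    using AE_hat_hermitian[of u] by eventually_elim (use p in \<open>simp add: hermitian_def\<close>)
  then obtain v where v: "AE \<xi> in lborel. hat v \<xi> = p \<xi> * hat u \<xi>"
    using fourier_L2_surj[of "\<lambda>\<xi>. p \<xi> * hat u \<xi>"] u by (auto simp: H_space_def)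
  have "AE \<xi> in lborel. hat (THE v. AE \<xi> in lborel. hat v \<xi> = p \<xi> * hat u \<xi>) \<xi> = p \<xi> * hat u \<xi>"
  proof (rule theI[where P="\<lambda>v. AE \<xi> in lborel. hat v \<xi> = p \<xi> * hat u \<xi>" and a=v, OF v])
    fix w assume w: "AE \<xi> in lborel. hat w \<xi> = p \<xi> * hat u \<xi>"
    show "w = v" by (rule hat_eqD, use v w in eventually_elim) simp
  qed
  then show ?thesis using u by (simp add: diffop_def)
qed

lemma H_spaceI:
  assumes p: "hermitian p" and v: "AE \<xi> in lborel. hat v \<xi> = p \<xi> * hat u \<xi>"
  shows "u \<in> H_space p"
proof -
  have [measurable]: "p \<in> borel_measurable borel" using p by (simp add: hermitian_def)
  have "integrable lborel (\<lambda>\<xi>. (norm (hat v \<xi>))\<^sup>2)"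
    using sq_integrable_rep_L2[of "fourier_L2 v"] by (simp add: sq_integrable_def)
  also have "integrable lborel (\<lambda>\<xi>. (norm (hat v \<xi>))\<^sup>2) \<longleftrightarrow> integrable lborel (\<lambda>\<xi>. (norm (p \<xi> * hat u \<xi>))\<^sup>2)"
    by (rule integrable_cong_AE) (use v in \<open>auto elim: eventually_mono\<close>)
  finally show ?thesis by (simp add: H_space_def sq_integrable_def)
qed

lemma diffop_eqI:
  assumes p: "hermitian p" and v: "AE \<xi> in lborel. hat v \<xi> = p \<xi> * hat u \<xi>"
  shows "diffop p u = v"
  by (rule hat_eqD, use v AE_hat_diffop[OF p H_spaceI[OF p v]] in eventually_elim) simp

context
  fixes p assumes p: "hermitian p"
begin

lemma H_space_diffop_add:
  assumes u: "u \<in> H_space p" and v: "v \<in> H_space p"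
  shows "u + v \<in> H_space p \<and> diffop p (u + v) = diffop p u + diffop p v"
proof -
  have "AE \<xi> in lborel. hat (diffop p u + diffop p v) \<xi> = p \<xi> * hat (u + v) \<xi>"
    using AE_hat_diffop[OF p u] AE_hat_diffop[OF p v] AE_hat_add[of u v] AE_hat_add[of "diffop p u" "diffop p v"]
    by eventually_elim (simp add: distrib_left)
  then show ?thesis using H_spaceI[OF p] diffop_eqI[OF p] by blast
qed

lemma H_space_diffop_scaleR:
  assumes u: "u \<in> H_space p"
  shows "c *\<^sub>R u \<in> H_space p \<and> diffop p (c *\<^sub>R u) = c *\<^sub>R diffop p u"
proof -
  have "AE \<xi> in lborel. hat (c *\<^sub>R diffop p u) \<xi> = p \<xi> * hat (c *\<^sub>R u) \<xi>"
    using AE_hat_diffop[OF p u] AE_hat_scaleR[of c u] AE_hat_scaleR[of c "diffop p u"]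
    by eventually_elim simp
  then show ?thesis using H_spaceI[OF p] diffop_eqI[OF p] by blast
qed

lemma H_space_zero: "0 \<in> H_space p"
proof (rule H_spaceI[OF p])
  show "AE \<xi> in lborel. hat 0 \<xi> = p \<xi> * hat 0 \<xi>"
    using AE_hat_scaleR[of 0 0] by eventually_elim simp
qed

lemma subspace_H_space: "subspace (H_space p)"
  unfolding subspace_def using H_space_zero H_space_diffop_add H_space_diffop_scaleR by blast

lemma diffop_diff:
  assumes u: "u \<in> H_space p" and v: "v \<in> H_space p"
  shows "diffop p (u - v) = diffop p u - diffop p v"
  using H_space_diffop_add[OF u, of "(-1) *\<^sub>R v"] H_space_diffop_scaleR[OF v, of "-1"] by simp

end

section \<open>Radial symbols\<close>

text \<open>Composition with X + 1 keeps degree and leading coefficient, so the top terms cancel.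
  This drives the induction for the extrapolation coefficients.\<close>

lemma degree_forward_difference:
  fixes q :: "'a::idom poly"
  assumes "degree q \<le> Suc n"
  shows "degree (pcompose q [:1, 1:] - q) \<le> n"
proof -
  let ?r = "pcompose q [:1, 1:]"
  have d: "degree ?r = degree q" by (subst degree_pcompose) simp
  have l: "lead_coeff ?r = lead_coeff q" by (subst lead_coeff_comp) auto
  show ?thesis
  proof (rule degree_le, intro allI impI)
    fix i assume "i > n"
    show "coeff (?r - q) i = 0"
    proof (cases "i > degree q")
      case True
      then show ?thesis using d by (simp add: coeff_eq_0)
    next
      case False
      then have "i = degree q" using \<open>i > n\<close> assms by simp
      then show ?thesis using l d by simp
    qed
  qed
qed

text \<open>The coefficients are independent of \<open>q\<close>; averaging the identity over directions bounds a
  polynomial pointwise by its local \<open>L\<^sup>1\<close> norm.\<close>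

lemma extrapolation_coefficients:
  "\<exists>c :: nat \<Rightarrow> complex. \<forall>q. degree q \<le> n \<longrightarrow> poly q 0 = (\<Sum>k=1..Suc n. c k * poly q (of_nat k))"
proof (induction n)
  case 0
  have "poly q 0 = (\<Sum>k=1..Suc 0. 1 * poly q (of_nat k))" if "degree q \<le> 0" for q :: "complex poly"
    using that by (auto elim!: degree_eq_zeroE)
  then show ?case by (intro exI[of _ "\<lambda>_. 1"]) blast
next
  case (Suc n)
  then obtain c :: "nat \<Rightarrow> complex"
    where c: "\<And>q. degree q \<le> n \<Longrightarrow> poly q 0 = (\<Sum>k=1..Suc n. c k * poly q (of_nat k))" by blast
  \<comment> \<open>Applying the coefficients \<open>c\<close> to q(X + 1) - q and solving for q(0)
    gives q(1) minus a shifted sum plus an unshifted one; the three summands collect their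
    coefficients at k.\<close>
  define c' where "c' k = (if k = 1 then 1 else 0) - (if k \<ge> 2 then c (k - 1) else 0) + (if k \<le> Suc n then c k else 0)" for k
  have "poly q 0 = (\<Sum>k=1..Suc (Suc n). c' k * poly q (of_nat k))" if q: "degree q \<le> Suc n" for q
  proof -
    have "poly q 1 - poly q 0 = (\<Sum>k=1..Suc n. c k * (poly q (of_nat (Suc k)) - poly q (of_nat k)))"
      using c[OF degree_forward_difference[OF q]] by (simp add: poly_pcompose)
    also have "\<dots> = (\<Sum>k=1..Suc n. c k * poly q (of_nat (Suc k))) - (\<Sum>k=1..Suc n. c k * poly q (of_nat k))"
      by (simp only: right_diff_distrib sum_subtractf)
    finally have 1: "poly q 0 = poly q 1 - (\<Sum>k=1..Suc n. c k * poly q (of_nat (Suc k))) + (\<Sum>k=1..Suc n. c k * poly q (of_nat k))"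
      by (simp add: algebra_simps)
    have a: "(\<Sum>k=1..Suc (Suc n). (if k = 1 then 1 else 0) * poly q (of_nat k)) = poly q 1"
      by (subst sum.mono_neutral_right[of _ "{1}"]) auto
    have b: "(\<Sum>k=1..Suc (Suc n). (if k \<ge> 2 then c (k - 1) else 0) * poly q (of_nat k))
        = (\<Sum>k=1..Suc n. c k * poly q (of_nat (Suc k)))"
    proof -
      have "(\<Sum>k=1..Suc (Suc n). (if k \<ge> 2 then c (k - 1) else 0) * poly q (of_nat k))
        = (\<Sum>k=Suc 1..Suc (Suc n). (if k \<ge> 2 then c (k - 1) else 0) * poly q (of_nat k))"
        by (rule sum.mono_neutral_right) auto
      also have "\<dots> = (\<Sum>k=1..Suc n. c k * poly q (of_nat (Suc k)))"
        unfolding sum.shift_bounds_cl_Suc_ivl by (rule sum.cong) auto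
      finally show ?thesis .
    qed
    have d: "(\<Sum>k=1..Suc (Suc n). (if k \<le> Suc n then c k else 0) * poly q (of_nat k))
        = (\<Sum>k=1..Suc n. c k * poly q (of_nat k))"
      by (subst sum.mono_neutral_right[of _ "{1..Suc n}"]) auto
    show ?thesis
      unfolding c'_def distrib_right left_diff_distrib sum.distrib sum_subtractf a b d by (rule 1)
  qed
  then show ?case by blast
qed

text \<open>The degree bound is uniform in base point and direction, so one set of extrapolation
  coefficients serves all lines while the direction is averaged.\<close>

lemma diffop_symbol_line_poly:
  assumes "diffop_symbol p"
  obtains n where "\<And>\<xi> h. \<exists>q. degree q \<le> n \<and> (\<forall>t. p (\<xi> + t *\<^sub>R h) = poly q (complex_of_real t))"
proof -
  obtain S c where S: "finite S" and p: "p = (\<lambda>\<xi>. \<Sum>(a, b)\<in>S. complex_of_real (c (a, b))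
                 * (2 * complex_of_real pi * \<i> * complex_of_real (\<xi> $ 1)) ^ a
                 * (2 * complex_of_real pi * \<i> * complex_of_real (\<xi> $ 2)) ^ b)"
    using assms unfolding diffop_symbol_def by blast
  define n where "n = (\<Sum>(a, b)\<in>S. a + b)"
  have "\<exists>q. degree q \<le> n \<and> (\<forall>t. p (\<xi> + t *\<^sub>R h) = poly q (complex_of_real t))" for \<xi> h
  proof -
    let ?w = "2 * complex_of_real pi * \<i>"
    define lin where "lin i = [:?w * complex_of_real (\<xi> $ i), ?w * complex_of_real (h $ i):]" for i
    define q where "q = (\<Sum>(a, b)\<in>S. smult (complex_of_real (c (a, b))) (lin 1 ^ a * lin 2 ^ b))"
    have "degree q \<le> n"
      unfolding q_def
    proof (rule degree_sum_le[OF S])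
      fix ab assume "ab \<in> S"
      obtain a b where ab: "ab = (a, b)" by force
      have "degree (lin i ^ e) \<le> e" for i e
        using degree_power_le[of "lin i" e] by (rule order_trans) (simp add: lin_def)
      then have "degree (lin 1 ^ a * lin 2 ^ b) \<le> a + b"
        by (meson add_mono degree_mult_le order_trans)
      also have "a + b \<le> n"
        unfolding n_def using member_le_sum[of "(a, b)" S "\<lambda>(a, b). a + b"] S \<open>ab \<in> S\<close> ab by auto
      finally show "degree (case ab of (a, b) \<Rightarrow> smult (complex_of_real (c (a, b))) (lin 1 ^ a * lin 2 ^ b)) \<le> n"
        unfolding ab by (simp add: order_trans[OF degree_smult_le])
    qed
    moreover have "p (\<xi> + t *\<^sub>R h) = poly q (complex_of_real t)" for t
      unfolding p q_def poly_sum case_prod_beta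
      by (intro sum.cong refl) (simp add: lin_def poly_power algebra_simps)
    ultimately show ?thesis by blast
  qed
  then show ?thesis by (rule that)
qed

text \<open>Split off linear factors t - z. Since z is not real, each is at least |Im z| in modulus,
  and moving t by at most R changes it by a factor of at most 1 + R / |Im z|. Both properties
  multiply.\<close>

lemma poly_comparable:
  fixes q :: "complex poly"
  assumes "\<And>t::real. poly q (complex_of_real t) \<noteq> 0" and R: "R \<ge> 0"
  shows "\<exists>\<delta>>0. \<exists>C>0. \<forall>s t::real. \<delta> \<le> cmod (poly q (complex_of_real t)) \<and>
    (\<bar>s - t\<bar> \<le> R \<longrightarrow> cmod (poly q (complex_of_real s)) \<le> C * cmod (poly q (complex_of_real t)))"
  using assms(1)
proof (induction "degree q" arbitrary: q)
  case 0
  then obtain a where q: "q = [:a:]" by (auto elim!: degree_eq_zeroE[of q])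
  with 0(2) have "a \<noteq> 0" by auto
  then show ?case by (intro exI[of _ "cmod a"] conjI exI[of _ 1]) (auto simp: q)
next
  case (Suc n)
  then have "\<not> constant (poly q)" by (simp add: constant_degree)
  from fundamental_theorem_of_algebra[OF this] obtain z where "poly q z = 0" by blast
  then obtain q' where q: "q = [:- z, 1:] * q'" by (auto simp: poly_eq_0_iff_dvd)
  have im: "Im z \<noteq> 0"
  proof
    assume "Im z = 0"
    then have "complex_of_real (Re z) = z" by (simp add: complex_eq_iff)
    then show False using Suc(3)[of "Re z"] \<open>poly q z = 0\<close> by simp
  qed
  have "q' \<noteq> 0" using Suc(3)[of 0] by (auto simp: q)
  then have "degree q = Suc (degree q')" by (simp add: q degree_mult_eq del: mult_pCons_left)
  then have "n = degree q'" using Suc(2) by simp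
  moreover have "poly q' (complex_of_real t) \<noteq> 0" for t using Suc(3)[of t] by (simp add: q)
  ultimately obtain \<delta> C where dC: "\<delta> > 0" "C > 0"
    "\<And>t. \<delta> \<le> cmod (poly q' (complex_of_real t))"
    "\<And>s t. \<bar>s - t\<bar> \<le> R \<Longrightarrow> cmod (poly q' (complex_of_real s)) \<le> C * cmod (poly q' (complex_of_real t))"
    using Suc(1)[of q'] by metis
  have low: "\<bar>Im z\<bar> \<le> cmod (complex_of_real t - z)" for t
    using abs_Im_le_cmod[of "complex_of_real t - z"] by simp
  have up: "cmod (complex_of_real s - z) \<le> (1 + R / \<bar>Im z\<bar>) * cmod (complex_of_real t - z)" if "\<bar>s - t\<bar> \<le> R" for s t
  proof -
    have "cmod (complex_of_real s - z) \<le> cmod (complex_of_real (s - t)) + cmod (complex_of_real t - z)"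
      using norm_triangle_ineq[of "complex_of_real (s - t)" "complex_of_real t - z"] by simp
    also have "\<dots> \<le> R + cmod (complex_of_real t - z)" using that by (simp add: norm_of_real del: of_real_diff)
    also have "R \<le> R / \<bar>Im z\<bar> * cmod (complex_of_real t - z)"
      using mult_left_mono[OF low[of t], of "R / \<bar>Im z\<bar>"] R im by simp
    finally show ?thesis by (simp add: distrib_right)
  qed
  have e: "cmod (poly q (complex_of_real t)) = cmod (complex_of_real t - z) * cmod (poly q' (complex_of_real t))" for t
    by (simp add: q norm_mult[symmetric] algebra_simps)
  show ?case
  proof (intro exI conjI allI impI)
    show "\<bar>Im z\<bar> * \<delta> > 0" using im dC by simp
    show "(1 + R / \<bar>Im z\<bar>) * C > 0" using R dC by (auto intro!: mult_pos_pos add_pos_nonneg)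
    fix s t :: real
    show "\<bar>Im z\<bar> * \<delta> \<le> cmod (poly q (complex_of_real t))"
      unfolding e using low dC by (intro mult_mono) (auto simp: less_imp_le)
    assume st: "\<bar>s - t\<bar> \<le> R"
    have "cmod (poly q (complex_of_real s)) \<le> ((1 + R / \<bar>Im z\<bar>) * cmod (complex_of_real t - z)) * (C * cmod (poly q' (complex_of_real t)))"
      unfolding e using up[OF st] dC(4)[OF st] R by (intro mult_mono) auto
    then show "cmod (poly q (complex_of_real s)) \<le> (1 + R / \<bar>Im z\<bar>) * C * cmod (poly q (complex_of_real t))"
      unfolding e by (simp add: mult_ac)
  qed
qed

lemma norm_real2: "norm (x :: real^2) = sqrt ((x $ 1)\<^sup>2 + (x $ 2)\<^sup>2)"
  by (simp add: norm_eq_sqrt_inner inner_vec_def UNIV_2 power2_eq_square)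

lemma rot_polar: "\<exists>\<theta>. rot \<theta> (vector [norm \<xi>, 0]) = (\<xi> :: real^2)"
proof (cases "\<xi> = 0")
  case True
  then show ?thesis by (auto simp: rot_def vec_eq_iff forall_2)
next
  case False
  then have "norm \<xi> \<noteq> 0" by simp
  moreover have "(norm \<xi>)\<^sup>2 = (\<xi> $ 1)\<^sup>2 + (\<xi> $ 2)\<^sup>2" by (simp add: norm_real2)
  moreover have "(\<xi> $ 1 / norm \<xi>)\<^sup>2 + (\<xi> $ 2 / norm \<xi>)\<^sup>2 = ((\<xi> $ 1)\<^sup>2 + (\<xi> $ 2)\<^sup>2) / (norm \<xi>)\<^sup>2"
    by (simp only: power_divide add_divide_distrib)
  ultimately have "(\<xi> $ 1 / norm \<xi>)\<^sup>2 + (\<xi> $ 2 / norm \<xi>)\<^sup>2 = 1"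
    by (metis divide_self power_not_zero)
  then obtain \<theta> where "\<xi> $ 1 / norm \<xi> = cos \<theta>" "\<xi> $ 2 / norm \<xi> = sin \<theta>"
    by (rule sincos_total_2pi) blast
  then have "\<xi> $ 1 = cos \<theta> * norm \<xi>" "\<xi> $ 2 = sin \<theta> * norm \<xi>" using False by (auto simp: field_simps)
  then show ?thesis by (intro exI[of _ \<theta>]) (simp add: rot_def vec_eq_iff forall_2)
qed

context
  fixes l :: "real^2 \<Rightarrow> complex"
  assumes l: "diffop_symbol l" and nz: "\<And>\<xi>. l \<xi> \<noteq> 0" and rad: "\<And>\<theta> \<xi>. l (rot \<theta> \<xi>) = l \<xi>"
begin

text \<open>Restrict the symbol to a line through the origin. That line also covers negative t, so
  the polynomial has no real roots although the radius itself is never negative.\<close>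

lemma radial_symbol_poly:
  obtains q where "\<And>\<xi>. l \<xi> = poly q (complex_of_real (norm \<xi>))" "\<And>t::real. poly q (complex_of_real t) \<noteq> 0"
proof -
  obtain q where q: "\<And>t. l (0 + t *\<^sub>R vector [1, 0]) = poly q (complex_of_real t)"
    using diffop_symbol_line_poly[OF l] by metis
  have "l \<xi> = poly q (complex_of_real (norm \<xi>))" for \<xi>
  proof -
    obtain \<theta> where "rot \<theta> (vector [norm \<xi>, 0]) = \<xi>" using rot_polar by blast
    moreover have "(vector [norm \<xi>, 0] :: real^2) = 0 + norm \<xi> *\<^sub>R vector [1, 0]"
      by (simp add: vec_eq_iff forall_2)
    ultimately show ?thesis by (metis q rad)
  qed
  moreover have "poly q (complex_of_real t) \<noteq> 0" for t using nz q by metis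
  ultimately show ?thesis by (rule that)
qed

lemma radial_symbol_lower: "\<exists>\<delta>>0. \<forall>\<xi>. \<delta> \<le> cmod (l \<xi>)"
proof -
  obtain q where q: "\<And>\<xi>. l \<xi> = poly q (complex_of_real (norm \<xi>))" "\<And>t::real. poly q (complex_of_real t) \<noteq> 0"
    using radial_symbol_poly by blast
  show ?thesis using poly_comparable[OF q(2), of 0] unfolding q(1) by auto
qed

lemma radial_symbol_comparable:
  assumes "R \<ge> 0"
  shows "\<exists>C>0. \<forall>\<xi> \<eta>. norm \<eta> \<le> R \<longrightarrow> cmod (l (\<xi> + \<eta>)) \<le> C * cmod (l \<xi>)"
proof -
  obtain q where q: "\<And>\<xi>. l \<xi> = poly q (complex_of_real (norm \<xi>))" "\<And>t::real. poly q (complex_of_real t) \<noteq> 0"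
    using radial_symbol_poly by blast
  obtain C where C: "C > 0" "\<And>s t. \<bar>s - t\<bar> \<le> R \<Longrightarrow> cmod (poly q (complex_of_real s)) \<le> C * cmod (poly q (complex_of_real t))"
    using poly_comparable[OF q(2) assms] by auto
  have "\<bar>norm (\<xi> + \<eta>) - norm \<xi>\<bar> \<le> R" if "norm \<eta> \<le> R" for \<xi> \<eta> :: "real^2"
    using norm_triangle_ineq3[of "\<xi> + \<eta>" \<xi>] that by simp
  then show ?thesis using C unfolding q(1) by blast
qed

text \<open>Along each line through \<xi> the value of g extrapolates from its values at \<xi> + k
  h, and |l| is comparable at these points. So |g/l| at \<xi> is bounded by finitely many values of
  |g/l| at \<xi> + k h; integrating over h in the unit ball replaces these by the L^1 norm.\<close>

lemma integrable_symbol_quotient_bounded: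
  assumes g: "diffop_symbol g" and int: "integrable lborel (\<lambda>\<xi>. g \<xi> / l \<xi>)"
  shows "\<exists>B\<ge>0. \<forall>\<xi>. cmod (g \<xi> / l \<xi>) \<le> B"
proof -
  obtain n where n: "\<And>\<xi> h. \<exists>q. degree q \<le> n \<and> (\<forall>t. g (\<xi> + t *\<^sub>R h) = poly q (complex_of_real t))"
    using diffop_symbol_line_poly[OF g] by metis
  obtain c where c: "\<And>q. degree q \<le> n \<Longrightarrow> poly q 0 = (\<Sum>k=1..Suc n. c k * poly q (of_nat k :: complex))"
    using extrapolation_coefficients[of n] by blast
  have gc: "g \<xi> = (\<Sum>k=1..Suc n. c k * g (\<xi> + real k *\<^sub>R h))" for \<xi> h
  proof -
    obtain q where q: "degree q \<le> n" "\<And>t. g (\<xi> + t *\<^sub>R h) = poly q (complex_of_real t)" using n by blast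
    then show ?thesis using c[OF q(1)] q(2)[of 0] by simp
  qed
  obtain C where C: "C > 0" "\<And>\<xi> \<eta>. norm \<eta> \<le> real (Suc n) \<Longrightarrow> cmod (l (\<xi> + \<eta>)) \<le> C * cmod (l \<xi>)"
    using radial_symbol_comparable[of "real (Suc n)"] by auto
  define m where "m \<xi> = cmod (g \<xi> / l \<xi>)" for \<xi>
  have m_int: "integrable lborel m" unfolding m_def[abs_def] using int by simp
  then have [measurable]: "m \<in> borel_measurable borel" by auto
  have m0: "m \<xi> \<ge> 0" for \<xi> by (simp add: m_def)
  have pt: "m \<xi> \<le> (\<Sum>k=1..Suc n. C * cmod (c k) * m (\<xi> + real k *\<^sub>R h))" if h: "norm h \<le> 1" for \<xi> h
  proof -
    have "cmod (g \<xi>) \<le> (\<Sum>k=1..Suc n. cmod (c k) * cmod (g (\<xi> + real k *\<^sub>R h)))"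
      unfolding gc[of \<xi> h] by (rule sum_norm_le) (simp add: norm_mult)
    also have "\<dots> \<le> (\<Sum>k=1..Suc n. C * cmod (c k) * m (\<xi> + real k *\<^sub>R h) * cmod (l \<xi>))"
    proof (rule sum_mono)
      fix k assume k: "k \<in> {1..Suc n}"
      have "norm (real k *\<^sub>R h) \<le> real (Suc n)"
        using mult_mono[of "real k" "real (Suc n)" "norm h" 1] h k by simp
      from C(2)[OF this, of \<xi>] have "m (\<xi> + real k *\<^sub>R h) * cmod (l (\<xi> + real k *\<^sub>R h)) \<le> m (\<xi> + real k *\<^sub>R h) * (C * cmod (l \<xi>))"
        by (intro mult_left_mono m0)
      moreover have "m (\<xi> + real k *\<^sub>R h) * cmod (l (\<xi> + real k *\<^sub>R h)) = cmod (g (\<xi> + real k *\<^sub>R h))"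
        using nz by (simp add: m_def norm_divide)
      ultimately have "cmod (g (\<xi> + real k *\<^sub>R h)) \<le> C * m (\<xi> + real k *\<^sub>R h) * cmod (l \<xi>)" by (simp add: mult_ac)
      then show "cmod (c k) * cmod (g (\<xi> + real k *\<^sub>R h)) \<le> C * cmod (c k) * m (\<xi> + real k *\<^sub>R h) * cmod (l \<xi>)"
        using mult_left_mono[of _ _ "cmod (c k)"] by (fastforce simp: mult_ac)
    qed
    also have "\<dots> = (\<Sum>k=1..Suc n. C * cmod (c k) * m (\<xi> + real k *\<^sub>R h)) * cmod (l \<xi>)"
      by (simp only: sum_distrib_right)
    finally have fin: "cmod (g \<xi>) \<le> (\<Sum>k=1..Suc n. C * cmod (c k) * m (\<xi> + real k *\<^sub>R h)) * cmod (l \<xi>)" .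
    have pos: "0 < cmod (l \<xi>)" using nz by simp
    show ?thesis
      unfolding m_def[of \<xi>] norm_divide by (rule pos_divide_le_eq[OF pos, THEN iffD2, OF fin])
  qed
  define I where "I = (LINT \<xi>|lborel. m \<xi>)"
  \<comment> \<open>The substitution h to \<xi> + k h has Jacobian k^2. Extrapolating from k \<ge> 1
    only is essential: at k = 0 there would be nothing to integrate over.\<close>
  have shift: "integrable lborel (\<lambda>h. m (\<xi> + real k *\<^sub>R h))" "(LINT h|lborel. m (\<xi> + real k *\<^sub>R h)) \<le> I"
    if "k \<in> {1..Suc n}" for k \<xi>
  proof -
    have k: "real k \<noteq> 0" "1 \<le> real k" using that by auto
    show "integrable lborel (\<lambda>h. m (\<xi> + real k *\<^sub>R h))"
      using m_int integral_affine_lborel(2)[OF k(1), of m \<xi>] by simp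
    have "0 \<le> (LINT h|lborel. m (\<xi> + real k *\<^sub>R h))" using m0 by simp
    moreover have "1 \<le> (real k)\<^sup>2" using k by simp
    ultimately have "1 * (LINT h|lborel. m (\<xi> + real k *\<^sub>R h)) \<le> (real k)\<^sup>2 * (LINT h|lborel. m (\<xi> + real k *\<^sub>R h))"
      by (rule mult_right_mono[rotated])
    then show "(LINT h|lborel. m (\<xi> + real k *\<^sub>R h)) \<le> I"
      unfolding I_def using integral_affine_lborel(1)[OF k(1), of m \<xi>] by simp
  qed
  let ?V = "measure lborel (ball (0::real^2) 1)"
  have V: "?V > 0" using content_ball_pos[of 1 "0::real^2"] by simp
  define B where "B = (\<Sum>k=1..Suc n. C * cmod (c k) * I) / ?V"
  have "m \<xi> \<le> B" for \<xi>
  proof -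
    have "?V * m \<xi> = integral\<^sup>L lborel (\<lambda>h::real^2. indicator (ball 0 1) h * m \<xi>)"
      by simp
    also have "\<dots> \<le> (LINT h|lborel. (\<Sum>k=1..Suc n. C * cmod (c k) * m (\<xi> + real k *\<^sub>R h)))"
    proof (rule integral_mono)
      show "integrable lborel (\<lambda>h::real^2. indicator (ball 0 1) h * m \<xi>)"
        by (intro integrable_mult_left integrable_real_indicator)
          (use emeasure_bounded_finite[OF bounded_ball, of "0::real^2" 1] in auto)
      show "integrable lborel (\<lambda>h. (\<Sum>k=1..Suc n. C * cmod (c k) * m (\<xi> + real k *\<^sub>R h)))"
        by (intro Bochner_Integration.integrable_sum integrable_mult_right shift)
      show "indicator (ball 0 1) h * m \<xi> \<le> (\<Sum>k=1..Suc n. C * cmod (c k) * m (\<xi> + real k *\<^sub>R h))" for h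
      proof (cases "norm h < 1")
        case False
        have "0 \<le> (\<Sum>k=1..Suc n. C * cmod (c k) * m (\<xi> + real k *\<^sub>R h))"
          by (intro sum_nonneg mult_nonneg_nonneg m0) (use C in auto)
        then show ?thesis using False by (simp del: sum.cl_ivl_Suc)
      qed (use pt[of h \<xi>] in simp)
    qed
    also have "\<dots> = (\<Sum>k=1..Suc n. C * cmod (c k) * (LINT h|lborel. m (\<xi> + real k *\<^sub>R h)))"
      by (subst Bochner_Integration.integral_sum) (auto intro!: shift integrable_mult_right simp del: sum.cl_ivl_Suc)
    also have "\<dots> \<le> (\<Sum>k=1..Suc n. C * cmod (c k) * I)"
      using C by (intro sum_mono mult_left_mono shift) auto
    finally show ?thesis using V by (simp add: B_def field_simps del: sum.cl_ivl_Suc)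
  qed
  then show ?thesis unfolding m_def using order_trans[OF norm_ge_zero] by blast
qed

lemma sq_integrable_symbol_quotient:
  assumes g: "diffop_symbol g" and int: "integrable lborel (\<lambda>\<xi>. g \<xi> / l \<xi>)"
  shows "sq_integrable (\<lambda>\<xi>. g \<xi> / l \<xi>)"
proof -
  obtain B where B: "B \<ge> 0" "\<And>\<xi>. cmod (g \<xi> / l \<xi>) \<le> B"
    using integrable_symbol_quotient_bounded[OF g int] by blast
  have "integrable lborel (\<lambda>\<xi>. B * cmod (g \<xi> / l \<xi>))" using int by simp
  then have "integrable lborel (\<lambda>\<xi>. (cmod (g \<xi> / l \<xi>))\<^sup>2)"
    by (rule Bochner_Integration.integrable_bound)
      (use int B in \<open>auto simp: power2_eq_square intro!: AE_I2 mult_right_mono\<close>)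
  then show ?thesis using int by (auto simp: sq_integrable_def)
qed

end

section \<open>Compact perturbations of the identity\<close>

text \<open>The parallelogram law makes a minimizing sequence Cauchy. At the minimizer y, a step t v
  with the optimal t would decrease the distance unless x - y is orthogonal to v.\<close>

lemma orthogonal_projection_exists:
  fixes W :: "'a::{real_inner, complete_space} set"
  assumes W: "subspace W" and comp: "closed W"
  obtains y where "y \<in> W" "\<And>w. w \<in> W \<Longrightarrow> inner (x - y) w = 0"
proof -
  define d where "d = (INF w\<in>W. (norm (x - w))\<^sup>2)"
  have bdd: "bdd_below ((\<lambda>w. (norm (x - w))\<^sup>2) ` W)" by (rule bdd_belowI2[where m=0]) simp
  have ne: "W \<noteq> {}" using W by (auto simp: subspace_def)
  have d: "d \<le> (norm (x - w))\<^sup>2" if "w \<in> W" for w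
    unfolding d_def by (rule cINF_lower[OF bdd that])
  have "\<exists>w\<in>W. (norm (x - w))\<^sup>2 < d + inverse (real (Suc n))" for n
  proof (rule ccontr)
    assume "\<not> ?thesis"
    then have "d + inverse (real (Suc n)) \<le> d"
      unfolding d_def using ne by (intro cINF_greatest[of W, folded d_def]) (auto simp: not_less d_def)
    then show False by simp
  qed
  then obtain w where w: "\<And>n. w n \<in> W" "\<And>n. (norm (x - w n))\<^sup>2 < d + inverse (real (Suc n))" by metis
  have para: "(norm (w m - w n))\<^sup>2 \<le> 2 * inverse (real (Suc m)) + 2 * inverse (real (Suc n))" for m n
  proof -
    have "(1/2) *\<^sub>R (w m + w n) \<in> W" using w(1) W by (simp add: subspace_add subspace_scale)
    then have "4 * d \<le> 4 * (norm (x - (1/2) *\<^sub>R (w m + w n)))\<^sup>2" using d by simp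
    also have "\<dots> = 2 * (norm (x - w m))\<^sup>2 + 2 * (norm (x - w n))\<^sup>2 - (norm (w m - w n))\<^sup>2"
      by (simp add: power2_norm_eq_inner inner_diff_left inner_diff_right inner_add_left inner_add_right inner_commute algebra_simps)
    finally show ?thesis using w(2)[of m] w(2)[of n] by simp
  qed
  have "Cauchy w"
  proof (rule metric_CauchyI)
    fix e :: real assume e: "e > 0"
    then obtain N where N: "inverse (real (Suc N)) < e\<^sup>2 / 4" using reals_Archimedean[of "e\<^sup>2/4"] by auto
    have "dist (w m) (w n) < e" if "m \<ge> N" "n \<ge> N" for m n
    proof -
      have "inverse (real (Suc m)) \<le> inverse (real (Suc N))" "inverse (real (Suc n)) \<le> inverse (real (Suc N))"
        using that by (auto intro!: le_imp_inverse_le)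
      then have "(norm (w m - w n))\<^sup>2 < e\<^sup>2" using para[of m n] N by linarith
      then show ?thesis using e by (simp add: dist_norm power2_less_imp_less)
    qed
    then show "\<exists>N. \<forall>m\<ge>N. \<forall>n\<ge>N. dist (w m) (w n) < e" by blast
  qed
  then obtain y where lim: "w \<longlonglongrightarrow> y" by (auto simp: Cauchy_convergent_iff convergent_def)
  note y = closed_sequentially[OF comp w(1) lim] lim
  have "(norm (x - y))\<^sup>2 \<le> d + 0"
  proof (rule LIMSEQ_le)
    show "(\<lambda>n. (norm (x - w n))\<^sup>2) \<longlonglongrightarrow> (norm (x - y))\<^sup>2" by (intro tendsto_intros y)
    show "(\<lambda>n. d + inverse (real (Suc n))) \<longlonglongrightarrow> d + 0" by (intro tendsto_intros LIMSEQ_inverse_real_of_nat)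
    show "\<exists>N. \<forall>n\<ge>N. (norm (x - w n))\<^sup>2 \<le> d + inverse (real (Suc n))" using w(2) by (auto simp: less_imp_le)
  qed
  then have yd: "(norm (x - y))\<^sup>2 \<le> d" by simp
  have "inner (x - y) v = 0" if v: "v \<in> W" for v
  proof (cases "v = 0")
    case False
    define t where "t = inner (x - y) v / (norm v)\<^sup>2"
    have "y + t *\<^sub>R v \<in> W" using v y W by (simp add: subspace_add subspace_scale)
    then have "(norm (x - y))\<^sup>2 \<le> (norm (x - (y + t *\<^sub>R v)))\<^sup>2" by (rule order_trans[OF yd d])
    also have "(norm (x - (y + t *\<^sub>R v)))\<^sup>2 = (norm (x - y))\<^sup>2 - 2 * t * inner (x - y) v + t * t * (norm v)\<^sup>2"
      by (simp add: power2_norm_eq_inner inner_diff_left inner_diff_right inner_add_left inner_add_right inner_commute algebra_simps)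
    also have "t * t * (norm v)\<^sup>2 = t * inner (x - y) v"
      using False by (simp add: t_def power2_eq_square)
    finally have "t * inner (x - y) v \<le> 0" by simp
    then have "(inner (x - y) v)\<^sup>2 / (norm v)\<^sup>2 \<le> 0" by (simp add: t_def power2_eq_square)
    then have "(inner (x - y) v)\<^sup>2 \<le> 0" using False by (simp add: divide_le_0_iff)
    then show ?thesis by simp
  qed simp
  with y(1) show ?thesis by (rule that)
qed

text \<open>If \<open>T = I + K\<close> were not onto, the images \<open>T\<^sup>n S\<close> would decrease strictly; unit vectors \<open>e\<^sub>n\<close>
  in \<open>T\<^sup>n S\<close> orthogonal to \<open>T\<^sup>n\<^sup>+\<^sup>1 S\<close> satisfy \<open>\<langle>T e\<^sub>n, e\<^sub>n\<rangle> = 0\<close>, so \<open>\<parallel>K e\<^sub>n\<parallel> \<ge> 1\<close>.\<close>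

lemma compact_perturbation_surj:
  fixes T :: "'a::{real_inner, complete_space} \<Rightarrow> 'a"
  assumes S: "subspace S" "closed S"
    and T: "\<And>x. x \<in> S \<Longrightarrow> T x \<in> S" "\<And>x y. x \<in> S \<Longrightarrow> y \<in> S \<Longrightarrow> T (x + y) = T x + T y"
      "\<And>a x. x \<in> S \<Longrightarrow> T (a *\<^sub>R x) = a *\<^sub>R T x"
    and bound: "\<And>x. x \<in> S \<Longrightarrow> norm (T x) \<le> C * norm x"
    and below: "c > 0" "\<And>x. x \<in> S \<Longrightarrow> c * norm x \<le> norm (T x)"
    and compact: "\<And>e. (\<And>n. e n \<in> S) \<Longrightarrow> (\<And>m n. inner (e m) (e n) = (if m = n then 1 else 0)) \<Longrightarrow>
        (\<lambda>n::nat. T (e n) - e n) \<longlonglongrightarrow> 0"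
  shows "T ` S = S"
proof (rule ccontr)
  assume ne: "T ` S \<noteq> S"
  have T_diff: "T (x - y) = T x - T y" if "x \<in> S" "y \<in> S" for x y
    using T(2)[of "x" "(-1) *\<^sub>R y"] T(3)[of y "-1"] that S by (simp add: subspace_neg)
  \<comment> \<open>The lower bound on T makes preimages of a convergent sequence Cauchy, so images
    of closed subspaces stay closed; the projections onto them depend on that.\<close>
  have image: "subspace (T ` W) \<and> closed (T ` W) \<and> T ` W \<subseteq> S" if W: "subspace W" "closed W" "W \<subseteq> S" for W
  proof (intro conjI)
    show "T ` W \<subseteq> S" using W T(1) by auto
    show "subspace (T ` W)"
      unfolding subspace_def
    proof (intro conjI ballI allI)
      have "T 0 = 0" using T(3)[of 0 0] S by (simp add: subspace_0)
      then show "0 \<in> T ` W" using W(1) subspace_0 by (metis imageI)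
      fix x y assume "x \<in> T ` W" "y \<in> T ` W"
      then obtain a b where ab: "a \<in> W" "b \<in> W" "x = T a" "y = T b" by auto
      have "a + b \<in> W" using W(1) ab(1,2) by (rule subspace_add)
      moreover have "T (a + b) = x + y" using T(2)[of a b] W(3) ab by blast
      ultimately show "x + y \<in> T ` W" by (metis imageI)
    next
      fix a x assume "x \<in> T ` W"
      then obtain b where b: "b \<in> W" "x = T b" by auto
      have "a *\<^sub>R b \<in> W" using W(1) b(1) by (rule subspace_scale)
      moreover have "T (a *\<^sub>R b) = a *\<^sub>R x" using T(3)[of b a] W(3) b by blast
      ultimately show "a *\<^sub>R x \<in> T ` W" by (metis imageI)
    qed
    show "closed (T ` W)"
      unfolding closed_sequential_limits
    proof (intro allI impI)
      fix f z assume f: "(\<forall>n::nat. f n \<in> T ` W) \<and> f \<longlonglongrightarrow> z"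
      then have "\<forall>n. \<exists>w. w \<in> W \<and> f n = T w" by auto
      then obtain w where w: "\<And>n. w n \<in> W" "\<And>n. f n = T (w n)" by metis
      have wS: "w n \<in> S" for n using w(1) W(3) by auto
      have "Cauchy w"
      proof (rule metric_CauchyI)
        fix e :: real assume "e > 0"
        then have "c * e > 0" using below by simp
        then obtain N where N: "\<And>m n. m \<ge> N \<Longrightarrow> n \<ge> N \<Longrightarrow> dist (f m) (f n) < c * e"
          using f metric_CauchyD[OF LIMSEQ_imp_Cauchy] by blast
        have "dist (w m) (w n) < e" if "m \<ge> N" "n \<ge> N" for m n
        proof -
          have "c * norm (w m - w n) \<le> norm (f m - f n)"
            using below(2)[of "w m - w n"] wS S by (simp add: w(2) T_diff subspace_diff)
          then have "c * norm (w m - w n) < c * e" using N[OF that] by (simp add: dist_norm)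
          then show ?thesis using below(1) by (simp add: dist_norm)
        qed
        then show "\<exists>N. \<forall>m\<ge>N. \<forall>n\<ge>N. dist (w m) (w n) < e" by blast
      qed
      then obtain y where lim: "w \<longlonglongrightarrow> y" by (auto simp: Cauchy_convergent_iff convergent_def)
      note y = closed_sequentially[OF W(2) w(1) lim] lim
      then have yS: "y \<in> S" using W by auto
      have "f \<longlonglongrightarrow> T y"
      proof (rule LIM_zero_cancel, rule Lim_null_comparison)
        show "\<forall>\<^sub>F n in sequentially. norm (f n - T y) \<le> C * norm (w n - y)"
          using bound[of "w _ - y"] wS yS S by (intro always_eventually) (simp add: w(2) T_diff[symmetric] subspace_diff)
        have "(\<lambda>n. C * norm (w n - y)) \<longlonglongrightarrow> C * norm (y - y)" by (intro tendsto_intros y)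
        then show "(\<lambda>n. C * norm (w n - y)) \<longlonglongrightarrow> 0" by simp
      qed
      then show "z \<in> T ` W" using y(1) f LIMSEQ_unique by blast
    qed
  qed
  define R where "R n = ((`) T ^^ n) S" for n
  have R0: "R 0 = S" and RS: "R (Suc n) = T ` R n" for n by (auto simp: R_def)
  have R: "subspace (R n) \<and> closed (R n) \<and> R n \<subseteq> S" for n
  proof (induction n)
    case 0
    then show ?case using S by (simp add: R0)
  next
    case (Suc n)
    then show ?case using image[of "R n"] by (simp add: RS)
  qed
  have dec1: "R (Suc n) \<subseteq> R n" for n
  proof (induction n)
    case 0
    then show ?case using T(1) by (auto simp: R0 RS)
  next
    case (Suc n)
    then have "T ` R (Suc n) \<subseteq> T ` R n" by (rule image_mono)
    then show ?case by (simp only: RS)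
  qed
  have dec: "m \<le> n \<Longrightarrow> R n \<subseteq> R m" for m n by (rule lift_Suc_antimono_le[of R, OF dec1])
  have inj: "x = y" if "x \<in> S" "y \<in> S" "T x = T y" for x y
  proof -
    have "c * norm (x - y) \<le> 0" using below(2)[of "x - y"] that S T_diff by (simp add: subspace_diff)
    then have "norm (x - y) \<le> 0" using below(1) by (simp add: mult_le_0_iff)
    then show ?thesis by simp
  qed
  \<comment> \<open>Injectivity propagates the strict inclusion at the first step to all later
    ones.\<close>
  have strict: "\<exists>x. x \<in> R n \<and> x \<notin> R (Suc n)" for n
  proof (induction n)
    case 0
    then show ?case using ne T(1) by (auto simp: R0 RS)
  next
    case (Suc n)
    then obtain x where x: "x \<in> R n" "x \<notin> R (Suc n)" by auto
    have "T x \<notin> T ` R (Suc n)"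
    proof
      assume "T x \<in> T ` R (Suc n)"
      then obtain y where "y \<in> R (Suc n)" "T x = T y" by auto
      then show False using inj[of x y] x R[of n] R[of "Suc n"] by auto
    qed
    then show ?case using x by (auto simp: RS)
  qed
  have "\<exists>e. e \<in> R n \<and> norm e = 1 \<and> (\<forall>w\<in>R (Suc n). inner e w = 0)" for n
  proof -
    obtain x where x: "x \<in> R n" "x \<notin> R (Suc n)" using strict by blast
    obtain y where y: "y \<in> R (Suc n)" "\<And>w. w \<in> R (Suc n) \<Longrightarrow> inner (x - y) w = 0"
      using orthogonal_projection_exists[of "R (Suc n)" x] R by metis
    have "x - y \<in> R n" using x y dec1[of n] R[of n] by (auto intro: subspace_diff)
    moreover have "x - y \<noteq> 0" using x y by auto
    ultimately show ?thesis using y R[of n]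
      by (intro exI[of _ "(x - y) /\<^sub>R norm (x - y)"]) (auto simp: subspace_scale)
  qed
  then obtain e where e: "\<And>n. e n \<in> R n" "\<And>n. norm (e n) = 1" "\<And>n w. w \<in> R (Suc n) \<Longrightarrow> inner (e n) w = 0" by metis
  have eS: "e n \<in> S" for n using e(1)[of n] R[of n] by auto
  have lt: "inner (e m) (e n) = 0" if "m < n" for m n
    using e(3)[of "e n" m] e(1)[of n] dec[of "Suc m" n] that by auto
  have ortho: "inner (e m) (e n) = (if m = n then 1 else 0)" for m n
    using lt[of m n] lt[of n m] e(2)[of n] by (cases m n rule: linorder_cases) (auto simp: inner_commute dot_square_norm)
  have "(\<lambda>n. T (e n) - e n) \<longlonglongrightarrow> 0" by (rule compact[OF eS ortho])
  then have "(\<lambda>n. norm (T (e n) - e n)) \<longlonglongrightarrow> 0" by (rule tendsto_norm_zero)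
  moreover have "1 \<le> norm (T (e n) - e n)" for n
  proof -
    have "inner (e n) (T (e n)) = 0" using e(3)[of "T (e n)" n] e(1)[of n] by (auto simp: RS)
    then have "inner (e n) (T (e n) - e n) = - 1" using ortho[of n n] by (simp add: inner_diff_right)
    then show ?thesis using Cauchy_Schwarz_ineq2[of "e n" "T (e n) - e n"] e(2)[of n] by simp
  qed
  ultimately have "(1::real) \<le> 0" by (intro LIMSEQ_le_const) auto
  then show False by simp
qed

text \<open>Bessel's inequality: the squared coefficients are summable. Orthonormal sequences
  thereby supply the weak convergence to 0 that compactness turns into norm convergence.\<close>

lemma bessel_tendsto:
  fixes e :: "nat \<Rightarrow> 'a::real_inner"
  assumes ortho: "\<And>m n. inner (e m) (e n) = (if m = n then 1 else 0)"
  shows "(\<lambda>n. inner x (e n)) \<longlonglongrightarrow> 0"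
proof -
  have "(\<Sum>n<N. (inner x (e n))\<^sup>2) \<le> (norm x)\<^sup>2" for N
  proof -
    let ?s = "\<Sum>n<N. inner x (e n) *\<^sub>R e n"
    have s: "inner ?s ?s = (\<Sum>n<N. (inner x (e n))\<^sup>2)"
      by (simp add: inner_sum_left inner_sum_right ortho if_distrib power2_eq_square cong: if_cong)
    have "inner x ?s = (\<Sum>n<N. (inner x (e n))\<^sup>2)"
      by (simp add: inner_sum_right power2_eq_square)
    then have "0 \<le> inner x x - (\<Sum>n<N. (inner x (e n))\<^sup>2)"
      using inner_ge_zero[of "x - ?s"] s by (simp add: inner_diff_left inner_diff_right inner_commute)
    then show ?thesis by (simp add: power2_norm_eq_inner)
  qed
  then have "summable (\<lambda>n. (inner x (e n))\<^sup>2)"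
    by (intro summableI_nonneg_bounded) auto
  then have "(\<lambda>n. (inner x (e n))\<^sup>2) \<longlonglongrightarrow> 0" by (rule summable_LIMSEQ_zero)
  then have "(\<lambda>n. sqrt ((inner x (e n))\<^sup>2)) \<longlonglongrightarrow> sqrt 0" by (rule tendsto_real_sqrt)
  then show ?thesis by (simp add: tendsto_rabs_zero_iff)
qed

section \<open>Symmetric functions\<close>

lemma rot_rot: "rot a (rot b x) = rot (a + b) x"
  by (simp add: rot_def vec_eq_iff forall_2 cos_add sin_add algebra_simps)

lemma rot_zero: "rot 0 = id"
  by (auto simp: rot_def vec_eq_iff forall_2)

lemma rot_2pi_nat: "rot (2 * pi * real k) = id"
  using cos_int_2pin[of "int k"] sin_int_2pin[of "int k"]
  by (auto simp: rot_def vec_eq_iff forall_2 mult_ac)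

lemma rot_2pi: "rot (2 * pi) = id"
  using rot_2pi_nat[of 1] by simp

lemma refl_rot: "refl_x1 (rot a x) = rot (- a) (refl_x1 x)"
  by (simp add: rot_def refl_x1_def vec_eq_iff forall_2)

lemma refl_refl: "refl_x1 (refl_x1 x) = x"
  by (simp add: refl_x1_def vec_eq_iff forall_2)

lemma inner_real2: "inner x y = x $ 1 * y $ 1 + x $ 2 * (y :: real^2) $ 2"
  by (simp add: inner_vec_def UNIV_2)

lemma orthogonal_transformation_rot: "orthogonal_transformation (rot \<theta>)"
  unfolding orthogonal_transformation_def
proof (intro conjI allI)
  show "linear (rot \<theta>)"
    by (simp add: linear_iff rot_def vec_eq_iff forall_2 algebra_simps)
  fix v w :: "real^2"
  have "inner (rot \<theta> v) (rot \<theta> w) = ((sin \<theta>)\<^sup>2 + (cos \<theta>)\<^sup>2) * inner v w"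
    unfolding inner_real2 rot_def vector_2 by algebra
  then show "inner (rot \<theta> v) (rot \<theta> w) = inner v w" by simp
qed

lemma orthogonal_transformation_refl: "orthogonal_transformation refl_x1"
  unfolding orthogonal_transformation_def
  by (auto simp: linear_iff refl_x1_def vec_eq_iff forall_2 inner_real2)

lemma orthogonal_generated:
  fixes S :: "(real^2 \<Rightarrow> real^2) set"
  assumes S: "\<And>s. s \<in> S \<Longrightarrow> orthogonal_transformation s" and T: "T \<in> generated S"
  shows "orthogonal_transformation T"
  using T
proof induction
  case generated_id
  show ?case by (simp add: orthogonal_transformation_id[unfolded id_def[symmetric]])
next
  case (generated_mult s t)
  then show ?case using orthogonal_transformation_compose[OF S] by blast
next
  case (generated_inv s t)
  then show ?case using orthogonal_transformation_compose[OF orthogonal_transformation_inv[OF S]] by blast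
qed

lemma pullback_id: "pullback id u = u" "pullback (\<lambda>x. x) u = u"
  by (simp_all add: pullback_def)

lemma L2_sym_iff_pullback:
  assumes "\<And>T. T \<in> K \<Longrightarrow> orthogonal_transformation T"
  shows "u \<in> L2_sym K \<longleftrightarrow> (\<forall>T\<in>K. pullback T u = u)"
proof -
  have "(AE x in lborel. rep_L2 u (T x) = rep_L2 u x) \<longleftrightarrow> pullback T u = u" if "T \<in> K" for T
  proof
    assume "AE x in lborel. rep_L2 u (T x) = rep_L2 u x"
    then show "pullback T u = u"
      by (intro pullback_eqI assms that) (auto elim: eventually_mono)
  next
    assume "pullback T u = u"
    then show "AE x in lborel. rep_L2 u (T x) = rep_L2 u x"
      using AE_rep_pullback[OF assms[OF that], of u] by (auto elim: eventually_mono)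
  qed
  then show ?thesis by (auto simp: L2_sym_def)
qed

text \<open>A word in the generators acts by successive pullbacks, and the pullback along an inverse
  undoes the pullback along the generator; invariance up to null sets survives because orthogonal
  maps preserve null sets.\<close>

lemma L2_sym_generated:
  assumes S: "\<And>s. s \<in> S \<Longrightarrow> orthogonal_transformation s"
  shows "u \<in> L2_sym (generated S) \<longleftrightarrow> (\<forall>s\<in>S. pullback s u = u)"
proof -
  have gen: "s \<in> generated S" if "s \<in> S" for s
    using generated_mult[OF that generated_id] by simp
  have all: "pullback T u = u" if inv: "\<forall>s\<in>S. pullback s u = u" and T: "T \<in> generated S" for T
    using T
  proof induction
    case generated_id
    show ?case by (rule pullback_id(1))
  next
    case (generated_mult s t)
    have "pullback (s \<circ> t) u = pullback t (pullback s u)"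
      using pullback_pullback[of t s u] orthogonal_generated[OF S generated_mult(2)] S generated_mult(1) by simp
    then show ?case using generated_mult inv by metis
  next
    case (generated_inv s t)
    have s: "orthogonal_transformation s" "orthogonal_transformation (inv s)"
      using generated_inv S by (auto intro: orthogonal_transformation_inv)
    have "pullback (inv s) (pullback s u) = pullback (s \<circ> inv s) u"
      by (rule pullback_pullback[OF s(2,1)])
    moreover have "s \<circ> inv s = id"
      using orthogonal_transformation_surj[OF s(1)] by (auto simp: fun_eq_iff surj_f_inv_f)
    ultimately have "pullback (inv s) u = u" using inv generated_inv by (simp add: pullback_id)
    moreover have "pullback (inv s \<circ> t) u = pullback t (pullback (inv s) u)"
      using pullback_pullback[of t "inv s" u] orthogonal_generated[OF S generated_inv(2)] s by simp
    ultimately show ?case using generated_inv by metis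
  qed
  have eq: "u \<in> L2_sym (generated S) \<longleftrightarrow> (\<forall>T\<in>generated S. pullback T u = u)"
    by (rule L2_sym_iff_pullback, rule orthogonal_generated[OF S])
  show ?thesis
    unfolding eq using gen all by (intro iffI ballI) simp_all
qed

lemma Z2Z1_iff: "u \<in> L2_sym Z2Z1 \<longleftrightarrow> pullback refl_x1 u = u"
  unfolding Z2Z1_def by (subst L2_sym_generated) (auto simp: orthogonal_transformation_refl)

lemma dihedral_iff: "u \<in> L2_sym (dihedral j) \<longleftrightarrow> pullback (rot (2 * pi / real j)) u = u \<and> pullback refl_x1 u = u"
  unfolding dihedral_def
  by (subst L2_sym_generated) (auto simp: orthogonal_transformation_refl orthogonal_transformation_rot)

lemma dihedral_Z2Z1: "u \<in> L2_sym (dihedral j) \<Longrightarrow> u \<in> L2_sym Z2Z1"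
  by (simp add: Z2Z1_iff dihedral_iff)

lemma subspace_pullback_fixed:
  assumes "orthogonal_transformation T"
  shows "subspace {u. pullback T u = u}" "closed {u. pullback T u = u}"
proof -
  interpret bounded_linear "pullback T" by (rule bounded_linear_pullback[OF assms])
  show "subspace {u. pullback T u = u}" by (auto simp: subspace_def zero add scaleR)
  show "closed {u. pullback T u = u}"
    by (intro closed_Collect_eq continuous_intros continuous_on)
qed

lemma L2_sym_Z2Z1_subspace: "subspace (L2_sym Z2Z1)" "closed (L2_sym Z2Z1)"
proof -
  have "L2_sym Z2Z1 = {u. pullback refl_x1 u = u}" by (auto simp: Z2Z1_iff)
  then show "subspace (L2_sym Z2Z1)" "closed (L2_sym Z2Z1)"
    using subspace_pullback_fixed[OF orthogonal_transformation_refl] by auto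
qed

lemma L2_sym_dihedral_subspace: "subspace (L2_sym (dihedral j))" "closed (L2_sym (dihedral j))"
proof -
  have "L2_sym (dihedral j) = {u. pullback (rot (2 * pi / real j)) u = u} \<inter> {u. pullback refl_x1 u = u}"
    by (auto simp: dihedral_iff)
  then show "subspace (L2_sym (dihedral j))" "closed (L2_sym (dihedral j))"
    using subspace_pullback_fixed[OF orthogonal_transformation_refl]
      subspace_pullback_fixed[OF orthogonal_transformation_rot]
    by (auto intro: subspace_inter closed_Int)
qed

section \<open>Averages over the rotations of order j\<close>

abbreviation rotk :: "nat \<Rightarrow> nat \<Rightarrow> real^2 \<Rightarrow> real^2" where
  "rotk j k \<equiv> rot (2 * pi * real k / real j)"

lemma rotk_compose: "rotk j a \<circ> rotk j b = rotk j (a + b)"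
  by (auto simp: rot_rot add_divide_distrib distrib_left)

lemma rotk_period: "j > 0 \<Longrightarrow> rotk j j = id"
  using rot_2pi_nat[of 1] by simp

lemma pullback_rotk_dihedral:
  assumes "u \<in> L2_sym (dihedral j)"
  shows "pullback (rotk j k) u = u"
proof (induction k)
  case 0
  then show ?case by (simp add: rot_zero pullback_id)
next
  case (Suc k)
  have "pullback (rotk j (Suc k)) u = pullback (rotk j 1) (pullback (rotk j k) u)"
    by (subst pullback_pullback) (simp_all only: orthogonal_transformation_rot rotk_compose add_Suc_right add_0_right One_nat_def)
  then show ?case using Suc assms by (simp add: dihedral_iff)
qed

lemma rot_average_dihedral:
  assumes "u \<in> L2_sym (dihedral j)" "j > 0"
  shows "rot_average j u = u"
  using assms by (simp add: rot_average_def pullback_rotk_dihedral scaleR_left.sum[symmetric] sum_constant_scaleR)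

lemma bounded_linear_rot_average: "bounded_linear (rot_average j)"
  unfolding rot_average_def[abs_def]
  by (intro bounded_linear_const_scaleR bounded_linear_sum bounded_linear_pullback orthogonal_transformation_rot)

lemma norm_rot_average_le: "norm (rot_average j u) \<le> norm u"
proof (cases "j = 0")
  case False
  have "norm (\<Sum>k<j. pullback (rotk j k) u) \<le> (\<Sum>k<j. norm u)"
    by (rule sum_norm_le) (simp add: norm_pullback orthogonal_transformation_rot)
  then have "(1 / real j) * norm (\<Sum>k<j. pullback (rotk j k) u) \<le> (1 / real j) * (real j * norm u)"
    by (intro mult_left_mono) auto
  then show ?thesis using False by (simp add: rot_average_def)
qed (simp add: rot_average_def)

text \<open>The generating rotation permutes the summands cyclically. The reflection conjugates each
  rotation to its inverse and fixes u, so it permutes them as well: for such u the average over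
  rotations is already the average over the whole dihedral group.\<close>

lemma rot_average_in_dihedral:
  assumes u: "u \<in> L2_sym Z2Z1" and j: "j > 0"
  shows "rot_average j u \<in> L2_sym (dihedral j)"
proof -
  define f where "f k = pullback (rotk j k) u" for k
  have fj: "f j = f 0" using j by (simp add: f_def rotk_period rot_zero rot_2pi pullback_id)
  have "(\<Sum>k<j. f (Suc k)) + f 0 = (\<Sum>k<j. f k) + f j"
    using sum.lessThan_Suc_shift[of f j] sum.lessThan_Suc[of f j] by (simp add: add.commute)
  then have shift: "(\<Sum>k<j. f (Suc k)) = (\<Sum>k<j. f k)" by (simp add: fj)
  have r: "pullback (rot (2 * pi / real j)) (f k) = f (Suc k)" for k
  proof -
    have "pullback (rotk j 1) (f k) = pullback (rotk j k \<circ> rotk j 1) u"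
      unfolding f_def by (rule pullback_pullback) (rule orthogonal_transformation_rot)+
    then show ?thesis unfolding rotk_compose by (simp add: f_def)
  qed
  \<comment> \<open>The index j - k stays a natural number at the cost of the value j at k = 0,
    where \<open>f j\<close> = \<open>f 0\<close>. The range 1..j that arises matches the cyclically
    shifted sum.\<close>
  have s: "pullback refl_x1 (f k) = f (j - k)" if "k < j" for k
  proof -
    have "rotk j k \<circ> refl_x1 = refl_x1 \<circ> rotk j (j - k)"
    proof
      fix x
      have e: "2 * pi * real (j - k) / real j = 2 * pi * real 1 + - (2 * pi * real k / real j)"
        using that by (simp add: of_nat_diff field_simps)
      have "rotk j (j - k) x = rot (- (2 * pi * real k / real j)) x"
        unfolding e rot_rot[symmetric] rot_2pi_nat by simp
      then show "(rotk j k \<circ> refl_x1) x = (refl_x1 \<circ> rotk j (j - k)) x"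
        by (simp add: refl_rot)
    qed
    then have "pullback refl_x1 (f k) = pullback (refl_x1 \<circ> rotk j (j - k)) u"
      unfolding f_def by (subst pullback_pullback) (auto simp: orthogonal_transformation_rot orthogonal_transformation_refl)
    also have "\<dots> = pullback (rotk j (j - k)) (pullback refl_x1 u)"
      by (rule pullback_pullback[symmetric]) (rule orthogonal_transformation_rot orthogonal_transformation_refl)+
    finally show ?thesis using u by (simp add: f_def Z2Z1_iff)
  qed
  have A: "rot_average j u = (1 / real j) *\<^sub>R (\<Sum>k<j. f k)" by (simp add: rot_average_def f_def)
  have lin: "pullback T (rot_average j u) = (1 / real j) *\<^sub>R (\<Sum>k<j. pullback T (f k))"
    if "orthogonal_transformation T" for T
  proof -
    interpret bounded_linear "pullback T" by (rule bounded_linear_pullback[OF that])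
    show ?thesis unfolding A by (simp add: scaleR sum)
  qed
  have "(\<Sum>k<j. pullback refl_x1 (f k)) = (\<Sum>k<j. f (Suc (j - Suc k)))"
    by (rule sum.cong) (auto simp: s Suc_diff_Suc)
  also have "\<dots> = (\<Sum>k<j. f (Suc k))" by (rule sum.nat_diff_reindex)
  finally have "(\<Sum>k<j. pullback refl_x1 (f k)) = (\<Sum>k<j. f k)" by (simp add: shift)
  then show ?thesis
    unfolding dihedral_iff lin[OF orthogonal_transformation_rot] lin[OF orthogonal_transformation_refl]
    by (simp add: r shift A)
qed

text \<open>The sum s is fixed by the rotation of angle 2 pi / j. Pairing with s gives (1 - cos)
  |s|^2 = 0, and the cosine is below 1 because the angle lies in (0, pi].\<close>

lemma sum_rotk_components:
  assumes "j \<ge> 2"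
  shows "(\<Sum>k<j. rotk j k \<xi>) = 0"
proof -
  define s where "s = (\<Sum>k<j. rotk j k \<xi>)"
  have j: "real j \<noteq> 0" using assms by simp
  define f where "f k = rotk j k \<xi>" for k
  interpret R: linear "rot (2 * pi / real j)" by (rule orthogonal_transformation_linear[OF orthogonal_transformation_rot])
  have "(\<Sum>k<j. f (Suc k)) + f 0 = (\<Sum>k<j. f k) + f j"
    using sum.lessThan_Suc_shift[of f j] sum.lessThan_Suc[of f j] by (simp add: add.commute)
  moreover have "f j = f 0" using j by (simp add: f_def rotk_period rot_zero rot_2pi pullback_id)
  moreover have "f (Suc k) = rot (2 * pi / real j) (f k)" for k
    by (simp add: f_def rot_rot add_divide_distrib distrib_left)
  ultimately have fx: "rot (2 * pi / real j) s = s" by (simp add: s_def f_def R.sum)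
  let ?c = "cos (2 * pi / real j)" and ?s = "sin (2 * pi / real j)"
  have e: "?c * s $ 1 - ?s * s $ 2 = s $ 1" "?s * s $ 1 + ?c * s $ 2 = s $ 2"
    using fx by (auto simp: rot_def vec_eq_iff forall_2)
  have "inner (rot (2 * pi / real j) s) s = ?c * inner s s"
    by (simp add: rot_def inner_real2 algebra_simps)
  then have "(1 - ?c) * inner s s = 0" by (simp add: fx left_diff_distrib)
  moreover have "?c < 1"
  proof -
    have "2 * pi / real j \<le> pi" using assms by (simp add: field_simps)
    moreover have "0 < 2 * pi / real j" using assms by simp
    ultimately show ?thesis using cos_monotone_0_pi[of 0 "2 * pi / real j"] by simp
  qed
  ultimately show ?thesis by (simp add: s_def)
qed

section \<open>The nonlinearity and its derivative\<close>

text \<open>Fatou applied to the tail of X - Y bounds the norm of h - Y by every positive number, so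
  no almost everywhere convergent subsequence has to be extracted.\<close>

lemma L2_tendsto_AE_eq:
  fixes Y :: "'b::euclidean_space L2"
  assumes lim: "X \<longlonglongrightarrow> Y" and pt: "AE x in lborel. (\<lambda>n. rep_L2 (X n) x) \<longlonglongrightarrow> h x"
    and h: "h \<in> borel_measurable borel"
  shows "AE x in lborel. rep_L2 Y x = h x"
proof -
  have "sq_integrable (\<lambda>x. h x - rep_L2 Y x) \<and> (LINT x|lborel. (norm (h x - rep_L2 Y x))\<^sup>2) \<le> e" if e: "e > 0" for e
  proof -
    have "(\<lambda>n. (norm (X n - Y))\<^sup>2) \<longlonglongrightarrow> (norm (Y - Y))\<^sup>2" by (intro tendsto_intros lim)
    then have "\<forall>\<^sub>F n in sequentially. (norm (X n - Y))\<^sup>2 < e" by (rule order_tendstoD(2)) (use e in simp)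
    then obtain M where M: "\<And>n. n \<ge> M \<Longrightarrow> (norm (X n - Y))\<^sup>2 < e" by (auto simp: eventually_sequentially)
    show ?thesis
    proof (rule sq_integrable_AE_limit)
      show "sq_integrable (\<lambda>x. rep_L2 (X (n + M)) x - rep_L2 Y x)" for n
        by (intro sq_integrable_diff sq_integrable_rep_L2)
      show "(LINT x|lborel. (norm (rep_L2 (X (n + M)) x - rep_L2 Y x))\<^sup>2) \<le> e" for n
        using norm_mk_L2[OF sq_integrable_diff[OF sq_integrable_rep_L2 sq_integrable_rep_L2], of "X (n + M)" Y]
          M[of "n + M"] by (simp add: mk_L2_diff sq_integrable_rep_L2)
      show "AE x in lborel. (\<lambda>n. rep_L2 (X (n + M)) x - rep_L2 Y x) \<longlonglongrightarrow> h x - rep_L2 Y x"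
        using pt by eventually_elim (intro tendsto_intros LIMSEQ_ignore_initial_segment)
    qed (use h in measurable)
  qed
  then have s: "sq_integrable (\<lambda>x. h x - rep_L2 Y x)"
    and "(LINT x|lborel. (norm (h x - rep_L2 Y x))\<^sup>2) \<le> 0"
    by (auto intro: zero_less_one field_le_epsilon)
  then have "(norm (mk_L2 (\<lambda>x. h x - rep_L2 Y x)))\<^sup>2 \<le> 0" by (simp add: norm_mk_L2)
  then have "mk_L2 (\<lambda>x. h x - rep_L2 Y x) = 0" by simp
  then have "AE x in lborel. rep_L2 0 x = h x - rep_L2 Y x" using AE_rep_mk_L2[OF s] by simp
  moreover have "AE x in lborel. rep_L2 (0 :: 'b L2) x = 0" by (rule AE_rep_zero)
  ultimately show ?thesis by eventually_elim simp
qed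

lemma integrable_mult_sq_integrable:
  fixes f g :: "real^2 \<Rightarrow> complex"
  assumes f: "sq_integrable f" and g: "sq_integrable g"
  shows "integrable lborel (\<lambda>x. f x * g x)"
proof (rule Bochner_Integration.integrable_bound)
  have [measurable]: "f \<in> borel_measurable borel" "g \<in> borel_measurable borel"
    using f g by (auto simp: sq_integrable_def)
  show "(\<lambda>x. f x * g x) \<in> borel_measurable lborel" by measurable
  show "integrable lborel (\<lambda>x. (norm (f x))\<^sup>2 + (norm (g x))\<^sup>2)"
    using f g by (auto simp: sq_integrable_def)
  show "AE x in lborel. norm (f x * g x) \<le> norm ((norm (f x))\<^sup>2 + (norm (g x))\<^sup>2)"
  proof (rule AE_I2)
    fix x
    have "2 * (norm (f x) * norm (g x)) \<le> (norm (f x))\<^sup>2 + (norm (g x))\<^sup>2"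
      using sum_squares_bound[of "norm (f x)" "norm (g x)"] by simp
    moreover have "0 \<le> norm (f x) * norm (g x)" by simp
    ultimately have "norm (f x) * norm (g x) \<le> (norm (f x))\<^sup>2 + (norm (g x))\<^sup>2" by linarith
    then show "norm (f x * g x) \<le> norm ((norm (f x))\<^sup>2 + (norm (g x))\<^sup>2)"
      by (simp add: norm_mult)
  qed
qed

lemma sq_integrable_mult_bounded:
  fixes f g :: "real^2 \<Rightarrow> 'b::{euclidean_space, real_normed_field}"
  assumes f: "sq_integrable f" and g [measurable]: "g \<in> borel_measurable borel" and B: "\<And>x. norm (g x) \<le> B"
  shows "sq_integrable (\<lambda>x. g x * f x)"
proof -
  have [measurable]: "f \<in> borel_measurable borel" using f by (auto simp: sq_integrable_def)
  have "integrable lborel (\<lambda>x. B\<^sup>2 * (norm (f x))\<^sup>2)" using f by (auto simp: sq_integrable_def)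
  then have "integrable lborel (\<lambda>x. (norm (g x * f x))\<^sup>2)"
    by (rule Bochner_Integration.integrable_bound)
      (use B in \<open>auto simp: norm_mult power_mult_distrib intro!: mult_right_mono power_mono\<close>)
  then show ?thesis by (simp add: sq_integrable_def)
qed

text \<open>A Fourier multiplier in \<open>L\<^sup>2\<close> is an integral operator with a uniformly bounded family
  \<open>K x\<close> of \<open>L\<^sup>2\<close> kernels; the pairing below is a representative defined at every \<open>x\<close>.\<close>

lemma fourier_multiplier_kernel:
  assumes m: "sq_integrable m" "\<And>\<xi>. cmod (m \<xi>) \<le> B"
  shows "\<exists>K C. (\<forall>x. norm (K x) \<le> C) \<and>
    (\<forall>y. (\<lambda>x. inner (K x) (fourier_L2 y)) \<in> borel_measurable borel) \<and>
    (\<forall>y b. (AE \<xi> in lborel. hat b \<xi> = m \<xi> * hat y \<xi>) \<longrightarrow>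
       (AE x in lborel. rep_L2 b x = inner (K x) (fourier_L2 y)))"
proof -
  have [measurable]: "m \<in> borel_measurable borel" using m by (simp add: sq_integrable_def)
  define z where "z x \<xi> = m \<xi> * complex_of_real (cas \<xi> x)" for x \<xi>
  \<comment> \<open>This is (1 - i) times the conjugate of z: under the real inner product on
    complex numbers it represents \<phi> to Re (z \<phi>) - Im (z \<phi>), the integrand of the
    inverse transform. Its squared modulus is 2 |z|^2, and |z| \<le> 2 |m|, whence the constant 8
    below.\<close>
  define k where "k x \<xi> = Complex (Re (z x \<xi>) - Im (z x \<xi>)) (- (Re (z x \<xi>) + Im (z x \<xi>)))" for x \<xi>
  define K where "K x = mk_L2 (k x)" for x
  have zs: "sq_integrable (z x)" for x
  proof -
    have "sq_integrable (\<lambda>\<xi>. complex_of_real (cas \<xi> x) * m \<xi>)"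
      by (rule sq_integrable_mult_bounded[OF m(1), where B=2]) (auto simp: abs_cas_le)
    then show ?thesis by (simp add: z_def[abs_def] mult.commute)
  qed
  have ks: "sq_integrable (k x)" for x
    unfolding k_def[abs_def]
    by (intro sq_integrable_Complex sq_integrable_diff sq_integrable_add sq_integrable_uminus sq_integrable_Re_Im zs)
  have kn: "(norm (k x \<xi>))\<^sup>2 = 2 * (norm (z x \<xi>))\<^sup>2" for x \<xi>
    unfolding cmod_power2 k_def complex.sel by (simp add: power2_eq_square algebra_simps)
  have zn: "norm (z x \<xi>) \<le> norm (2 * m \<xi>)" for x \<xi>
    using mult_left_mono[OF abs_cas_le[of \<xi> x] norm_ge_zero[of "m \<xi>"]] by (simp add: z_def norm_mult mult.commute)
  have KC: "norm (K x) \<le> sqrt (8 * (norm (mk_L2 m))\<^sup>2)" for x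
  proof (rule real_le_rsqrt)
    have i: "integrable lborel (\<lambda>\<xi>. (norm (m \<xi>))\<^sup>2)" using m by (simp add: sq_integrable_def)
    have "(norm (K x))\<^sup>2 = (LINT \<xi>|lborel. (norm (k x \<xi>))\<^sup>2)" unfolding K_def by (rule norm_mk_L2[OF ks])
    also have "\<dots> \<le> (LINT \<xi>|lborel. 8 * (norm (m \<xi>))\<^sup>2)"
    proof (rule integral_mono)
      show "integrable lborel (\<lambda>\<xi>. (norm (k x \<xi>))\<^sup>2)" using ks[of x] by (simp add: sq_integrable_def)
      show "(norm (k x \<xi>))\<^sup>2 \<le> 8 * (norm (m \<xi>))\<^sup>2" for \<xi>
        using power_mono[OF zn[of x \<xi>] norm_ge_zero, of 2] by (simp add: kn norm_mult power_mult_distrib)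
    qed (use i in simp)
    also have "\<dots> = 8 * (norm (mk_L2 m))\<^sup>2" using i by (simp add: norm_mk_L2[OF m(1)])
    finally show "(norm (K x))\<^sup>2 \<le> 8 * (norm (mk_L2 m))\<^sup>2" .
  qed
  have rep: "inner (K x) (fourier_L2 y) = hartley (\<lambda>\<xi>. Re (m \<xi> * hat y \<xi>) - Im (m \<xi> * hat y \<xi>)) x" for x y
  proof -
    have "inner (K x) (fourier_L2 y) = (LINT \<xi>|lborel. inner (k x \<xi>) (hat y \<xi>))"
      unfolding K_def using inner_L2_mk[OF ks sq_integrable_rep_L2[of "fourier_L2 y"]] by simp
    also have "\<dots> = hartley (\<lambda>\<xi>. Re (m \<xi> * hat y \<xi>) - Im (m \<xi> * hat y \<xi>)) x"
      unfolding hartley_def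
      by (intro Bochner_Integration.integral_cong refl)
        (simp add: k_def z_def inner_complex_def algebra_simps)
    finally show ?thesis .
  qed
  have meas: "(\<lambda>x. inner (K x) (fourier_L2 y)) \<in> borel_measurable borel" for y
    unfolding rep by measurable
  have "AE x in lborel. rep_L2 b x = inner (K x) (fourier_L2 y)" if b: "AE \<xi> in lborel. hat b \<xi> = m \<xi> * hat y \<xi>" for y b
    unfolding rep
  proof (rule fourier_L2_inverse_integrable[OF _ _ b])
    show "sq_integrable (\<lambda>\<xi>. m \<xi> * hat y \<xi>)"
      by (rule sq_integrable_mult_bounded[OF sq_integrable_rep_L2 _ m(2)]) measurable
    show "integrable lborel (\<lambda>\<xi>. m \<xi> * hat y \<xi>)"
      by (rule integrable_mult_sq_integrable[OF m(1) sq_integrable_rep_L2])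
  qed
  then show ?thesis using KC meas by blast
qed

lemma AE_rep_sum: "finite I \<Longrightarrow> AE x in lborel. rep_L2 (\<Sum>i\<in>I. f i) x = (\<Sum>i\<in>I. rep_L2 (f i) x)"
proof (induction I rule: finite_induct)
  case (insert i I)
  have "AE x in lborel. rep_L2 (f i + (\<Sum>i\<in>I. f i)) x = rep_L2 (f i) x + (\<Sum>i\<in>I. rep_L2 (f i) x)"
    using insert.IH AE_rep_add[of "f i" "\<Sum>i\<in>I. f i"] by eventually_elim simp
  then show ?case using insert by simp
qed (use AE_rep_zero in simp)

lemma sq_integrable_prod_bounded:
  fixes f :: "'i \<Rightarrow> real^2 \<Rightarrow> real"
  assumes I: "finite I" "I \<noteq> {}" and f: "\<And>i. i \<in> I \<Longrightarrow> sq_integrable (f i)"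
    and B: "\<And>i x. i \<in> I \<Longrightarrow> \<bar>f i x\<bar> \<le> B i"
  shows "sq_integrable (\<lambda>x. \<Prod>i\<in>I. f i x)"
  using I f B
proof (induction I rule: finite_ne_induct)
  case (insert i I)
  have "sq_integrable (\<lambda>x. f i x * (\<Prod>i\<in>I. f i x))"
    by (rule sq_integrable_mult_bounded[where B="B i"]) (use insert in \<open>auto simp: sq_integrable_def\<close>)
  then show ?case using insert by simp
qed simp

text \<open>A Frechet derivative is determined on V by its directional limits. Since
  \<open>fderiv_on\<close> is a choice, this is the only access to its values. Homogeneity is an
  assumption because \<open>nV\<close> is an arbitrary real function.\<close>

lemma has_fderiv_on_tendsto:
  assumes D: "has_fderiv_on V nV \<Phi> x D" and V: "subspace V" and v: "v \<in> V"
    and hom: "\<And>t. nV (t *\<^sub>R v) = \<bar>t\<bar> * nV v"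
  shows "((\<lambda>t. (\<Phi> (x + t *\<^sub>R v) - \<Phi> x) /\<^sub>R t) \<longlongrightarrow> D v) (at 0)"
proof (rule tendstoI)
  fix e :: real assume e: "e > 0"
  define c where "c = \<bar>nV v\<bar> + 1"
  have c: "c > 0" "nV v \<le> c" by (auto simp: c_def)
  define \<epsilon> where "\<epsilon> = e / (2 * c)"
  have \<epsilon>: "\<epsilon> > 0" using e c by (simp add: \<epsilon>_def)
  then obtain \<delta> where \<delta>: "\<delta> > 0" "\<And>w. w \<in> V \<Longrightarrow> nV w < \<delta> \<Longrightarrow> norm (\<Phi> (x + w) - \<Phi> x - D w) \<le> \<epsilon> * nV w"
    using D unfolding has_fderiv_on_def by blast
  have "dist ((\<Phi> (x + t *\<^sub>R v) - \<Phi> x) /\<^sub>R t) (D v) < e" if t: "t \<noteq> 0" "dist t 0 < \<delta> / c" for t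
  proof -
    have tV: "t *\<^sub>R v \<in> V" using V v by (rule subspace_scale)
    have "\<bar>t\<bar> * nV v \<le> \<bar>t\<bar> * c" using c by (intro mult_left_mono) auto
    also have "\<dots> < \<delta>" using t c by (simp add: pos_less_divide_eq)
    finally have "norm (\<Phi> (x + t *\<^sub>R v) - \<Phi> x - D (t *\<^sub>R v)) \<le> \<epsilon> * (\<bar>t\<bar> * nV v)"
      using \<delta>(2)[OF tV] by (simp add: hom)
    moreover have "D (t *\<^sub>R v) = t *\<^sub>R D v"
      using D v by (simp add: has_fderiv_on_def bounded_linear_between_def)
    ultimately have *: "norm (\<Phi> (x + t *\<^sub>R v) - \<Phi> x - t *\<^sub>R D v) \<le> \<bar>t\<bar> * (\<epsilon> * nV v)"
      by (simp add: mult_ac)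
    have "(\<Phi> (x + t *\<^sub>R v) - \<Phi> x) /\<^sub>R t - D v = (\<Phi> (x + t *\<^sub>R v) - \<Phi> x - t *\<^sub>R D v) /\<^sub>R t"
      using t by (simp add: scaleR_diff_right)
    then have "dist ((\<Phi> (x + t *\<^sub>R v) - \<Phi> x) /\<^sub>R t) (D v) = norm (\<Phi> (x + t *\<^sub>R v) - \<Phi> x - t *\<^sub>R D v) / \<bar>t\<bar>"
      by (simp add: dist_norm divide_inverse mult.commute)
    also have "\<dots> \<le> \<epsilon> * nV v" using * t by (simp add: field_simps)
    also have "\<dots> \<le> \<epsilon> * c" using \<epsilon> c by (intro mult_left_mono) auto
    also have "\<dots> < e" using e c by (simp add: \<epsilon>_def)
    finally show ?thesis .
  qed
  moreover have "\<delta> / c > 0" using \<delta> c by simp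
  ultimately show "\<forall>\<^sub>F t in at 0. dist ((\<Phi> (x + t *\<^sub>R v) - \<Phi> x) /\<^sub>R t) (D v) < e"
    unfolding eventually_at by blast
qed

text \<open>The case k = 0 of the smoothness condition: the multilinear map on one-element lists is
  the first derivative, so the choice in \<open>fderiv_on\<close> succeeds.\<close>

lemma smooth_has_fderiv_on:
  assumes "smooth_on_normed V nV \<Phi>" and V: "subspace V" and x: "x \<in> V"
  shows "has_fderiv_on V nV \<Phi> x (fderiv_on V nV \<Phi> x)"
proof -
  obtain D where D: "\<And>x. x \<in> V \<Longrightarrow> D x [] = \<Phi> x" "\<And>x k. x \<in> V \<Longrightarrow> bounded_multilinear_on V nV k (D x)"
    "\<And>x k \<epsilon>. x \<in> V \<Longrightarrow> \<epsilon> > 0 \<Longrightarrow> \<exists>\<delta>>0. \<forall>v\<in>V. nV v < \<delta> \<longrightarrow> (\<forall>vs. length vs = k \<longrightarrow> set vs \<subseteq> V \<longrightarrow>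
              norm (D (x + v) vs - D x vs - D x (v # vs)) \<le> \<epsilon> * nV v * prod_list (map nV vs))"
    using assms(1) unfolding smooth_on_normed_def by metis
  have "has_fderiv_on V nV \<Phi> x (\<lambda>v. D x [v])"
    unfolding has_fderiv_on_def
  proof (intro conjI allI impI)
    have lin: "D x ([w][i := u + v]) = D x ([w][i := u]) + D x ([w][i := v]) \<and> D x ([w][i := a *\<^sub>R u]) = a *\<^sub>R D x ([w][i := u])"
      if "w \<in> V" "u \<in> V" "v \<in> V" "i < 1" for w u v i a
      using D(2)[OF x, of 1] that unfolding bounded_multilinear_on_def by (auto dest!: spec[of _ "[w]"])
    obtain C where "\<And>vs. length vs = 1 \<Longrightarrow> set vs \<subseteq> V \<Longrightarrow> norm (D x vs) \<le> C * prod_list (map nV vs)"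
      using D(2)[OF x, of 1] unfolding bounded_multilinear_on_def by blast
    from this[of "[_]"] have "\<forall>v\<in>V. norm (D x [v]) \<le> C * nV v" by simp
    then show "bounded_linear_between V nV UNIV norm (\<lambda>v. D x [v])"
      unfolding bounded_linear_between_def using lin[of _ _ _ 0] by fastforce
    fix \<epsilon> :: real assume "\<epsilon> > 0"
    from D(3)[OF x this, of 0] obtain \<delta> where \<delta>: "\<delta> > 0"
      "\<And>v. v \<in> V \<Longrightarrow> nV v < \<delta> \<Longrightarrow> norm (D (x + v) [] - D x [] - D x [v]) \<le> \<epsilon> * nV v"
      by auto
    have "norm (\<Phi> (x + v) - \<Phi> x - D x [v]) \<le> \<epsilon> * nV v" if "v \<in> V" "nV v < \<delta>" for v
      using \<delta>(2)[OF that] D(1)[OF x] D(1)[of "x + v"] subspace_add[OF V x that(1)] by simp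
    then show "\<exists>\<delta>>0. \<forall>v\<in>V. nV v < \<delta> \<longrightarrow> norm (\<Phi> (x + v) - \<Phi> x - D x [v]) \<le> \<epsilon> * nV v"
      using \<delta>(1) by blast
  qed
  then show ?thesis unfolding fderiv_on_def by (rule someI[where P="has_fderiv_on V nV \<Phi> x"])
qed

lemma continuous_AE_eq_on_ball:
  fixes f g :: "real^2 \<Rightarrow> complex"
  assumes c: "continuous_on UNIV f" "continuous_on UNIV g"
    and ae: "AE x in lborel. norm x < R \<longrightarrow> f x = g x" and x: "norm x < R"
  shows "f x = g x"
proof (rule ccontr)
  assume ne: "f x \<noteq> g x"
  let ?S = "ball 0 R \<inter> {x. f x \<noteq> g x}"
  have op: "open ?S"
    by (intro open_Int open_ball open_Collect_neq c)
  have "AE x in lborel. x \<notin> ?S" using ae by eventually_elim auto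
  then have "?S \<in> null_sets lborel"
    using op by (subst AE_iff_null_sets) auto
  then have "negligible ?S"
    by (simp add: negligible_iff_null_sets null_sets_completionI)
  moreover have "x \<in> ?S" using x ne by simp
  ultimately show False using open_not_negligible[OF op] by blast
qed

lemma sq_integrable_ball_indicator:
  fixes f :: "real^2 \<Rightarrow> complex"
  assumes "continuous_on UNIV f"
  shows "sq_integrable (\<lambda>\<xi>. if norm \<xi> \<le> R then f \<xi> else 0)"
proof -
  have [measurable]: "f \<in> borel_measurable borel" by (rule borel_measurable_continuous_onI[OF assms])
  have "compact (f ` cball 0 R)"
    by (intro compact_continuous_image continuous_on_subset[OF assms]) auto
  then obtain B where "\<forall>y\<in>f ` cball 0 R. norm y \<le> B"
    using compact_imp_bounded[of "f ` cball 0 R"] unfolding bounded_iff by blast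
  then have B: "norm (f x) \<le> B" if "norm x \<le> R" for x using that by simp
  have "integrable lborel (\<lambda>\<xi>. (norm (if norm \<xi> \<le> R then f \<xi> else 0))\<^sup>2)"
    by (rule Bochner_Integration.integrable_bound[OF integrable_indicator_cball[of R "B\<^sup>2"]])
      (use B in \<open>auto intro!: AE_I2 power_mono\<close>)
  then show ?thesis by (simp add: sq_integrable_def)
qed

text \<open>Test the operator on the function whose transform is the indicator of a centred disc. It
  is rotation invariant, hence so is its image, whose transform is l cut off to the disc. Continuity
  upgrades almost everywhere to everywhere.\<close>

lemma rot_equivariant_symbol:
  assumes l: "diffop_symbol l" and eq: "commutes_with l (diffop l) (rot \<theta>)"
  shows "l (rot \<theta> \<xi>) = l \<xi>"
proof -
  \<comment> \<open>The extra 1 puts \<xi> in the open disc, where almost everywhere equality can be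
    upgraded.\<close>
  define R where "R = norm \<xi> + 1"
  define \<gamma> where "\<gamma> \<xi> = (if norm \<xi> \<le> R then 1 else 0 :: complex)" for \<xi> :: "real^2"
  note O = orthogonal_transformation_rot[of \<theta>]
  note h = diffop_symbol_hermitian[OF l] and c = diffop_symbol_continuous[OF l]
  have "sq_integrable \<gamma>" unfolding \<gamma>_def[abs_def] by (rule sq_integrable_ball_indicator) simp
  moreover have "AE \<xi> in lborel. \<gamma> (- \<xi>) = cnj (\<gamma> \<xi>)" by (simp add: \<gamma>_def)
  ultimately obtain u where u: "AE \<xi> in lborel. hat u \<xi> = \<gamma> \<xi>" by (rule fourier_L2_surj)
  have "sq_integrable (\<lambda>\<xi>. if norm \<xi> \<le> R then l \<xi> else 0)"
    by (rule sq_integrable_ball_indicator[OF c])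
  moreover have "AE \<xi> in lborel. (if norm (- \<xi>) \<le> R then l (- \<xi>) else 0) = cnj (if norm \<xi> \<le> R then l \<xi> else 0)"
    using h by (simp add: hermitian_def)
  ultimately obtain v where v: "AE \<xi> in lborel. hat v \<xi> = (if norm \<xi> \<le> R then l \<xi> else 0)" by (rule fourier_L2_surj)
  have "AE \<xi> in lborel. hat v \<xi> = l \<xi> * hat u \<xi>"
    using u v by eventually_elim (simp add: \<gamma>_def)
  then have uH: "u \<in> H_space l" and Lu: "diffop l u = v"
    using H_spaceI[OF h] diffop_eqI[OF h] by blast+
  have "pullback (rot \<theta>) u = u"
    by (rule hat_eqD, use AE_hat_pullback[OF O, of u] u AE_orthogonal[OF O u] in eventually_elim)
      (simp add: \<gamma>_def orthogonal_transformation_norm[OF O])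
  then have pv: "pullback (rot \<theta>) v = v"
    using eq uH Lu by (auto simp: commutes_with_def)
  have "AE \<xi> in lborel. norm \<xi> < R \<longrightarrow> l (rot \<theta> \<xi>) = l \<xi>"
    using AE_hat_pullback[OF O, of v] v AE_orthogonal[OF O v] unfolding pv
    by eventually_elim (auto simp: orthogonal_transformation_norm[OF O] split: if_splits)
  moreover have "continuous_on UNIV (\<lambda>\<xi>. l (rot \<theta> \<xi>))"
    using linear_continuous_on[of "rot \<theta>" UNIV] orthogonal_transformation_linear[OF O]
    by (intro continuous_on_compose2[OF c]) (auto simp: linear_conv_bounded_linear)
  ultimately show ?thesis
    using continuous_AE_eq_on_ball[OF _ c, of "\<lambda>\<xi>. l (rot \<theta> \<xi>)" R \<xi>] by (simp add: R_def)
qed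

section \<open>The equation and its linearization\<close>

locale pattern_equation =
  fixes l :: "real^2 \<Rightarrow> complex" and N :: nat and g :: "nat \<Rightarrow> nat \<Rightarrow> real^2 \<Rightarrow> complex"
  assumes l_symbol: "diffop_symbol l" and l_nonzero: "\<forall>\<xi>. cmod (l \<xi>) > 0"
    and g_symbol: "\<forall>i\<in>{2..N}. \<forall>p\<in>{1..i}. diffop_symbol (g i p)"
    and g_integrable: "\<forall>i\<in>{2..N}. \<forall>p\<in>{1..i}. integrable lborel (\<lambda>\<xi>. g i p \<xi> / l \<xi>)"
    and G_smooth: "smooth_on_normed (H_space l) (H_norm l) (nonlin N g)"
    and L_equivariant: "euclidean_equivariant l (diffop l)"
    and G_equivariant: "euclidean_equivariant l (nonlin N g)"
begin

abbreviation "H \<equiv> H_space l"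
abbreviation "L \<equiv> diffop l"
abbreviation "G \<equiv> nonlin N g"

lemma l_nz: "l \<xi> \<noteq> 0" using l_nonzero[rule_format, of \<xi>] by auto

lemma l_rot: "l (rot \<theta> \<xi>) = l \<xi>"
  using rot_equivariant_symbol[OF l_symbol] L_equivariant by (simp add: euclidean_equivariant_def)

lemmas l_hermitian = diffop_symbol_hermitian[OF l_symbol]

lemma l_borel [measurable]: "l \<in> borel_measurable borel"
  using l_hermitian by (simp add: hermitian_def)

lemma subspace_H: "subspace H" by (rule subspace_H_space[OF l_hermitian])

lemma L_add: "u \<in> H \<Longrightarrow> v \<in> H \<Longrightarrow> L (u + v) = L u + L v"
  and L_scaleR: "u \<in> H \<Longrightarrow> L (c *\<^sub>R u) = c *\<^sub>R L u"
  and L_diff: "u \<in> H \<Longrightarrow> v \<in> H \<Longrightarrow> L (u - v) = L u - L v"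
  using H_space_diffop_add[OF l_hermitian] H_space_diffop_scaleR[OF l_hermitian] diffop_diff[OF l_hermitian] by auto

lemma L_zero: "L 0 = 0"
  using L_scaleR[of 0 0] subspace_0[OF subspace_H] by simp

definition Linv :: "real L2 \<Rightarrow> real L2" where
  "Linv y = (SOME u. u \<in> H \<and> L u = y)"

text \<open>With |l| bounded below, 1/l is a bounded Hermitian multiplier. As the norm of w is the
  L^2 norm of L w, the element y = L w can serve as the unknown, ranging over all of L^2.\<close>

lemma Linv: "Linv y \<in> H" "L (Linv y) = y"
proof -
  obtain \<delta> where \<delta>: "\<delta> > 0" "\<And>\<xi>. \<delta> \<le> cmod (l \<xi>)"
    using radial_symbol_lower[OF l_symbol l_nz l_rot] by blast
  have "cmod (inverse (l \<xi>)) \<le> inverse \<delta>" for \<xi>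
    using \<delta> by (simp add: norm_inverse le_imp_inverse_le)
  then have "sq_integrable (\<lambda>\<xi>. inverse (l \<xi>) * hat y \<xi>)"
    by (intro sq_integrable_mult_bounded sq_integrable_rep_L2) auto
  moreover have "AE \<xi> in lborel. inverse (l (- \<xi>)) * hat y (- \<xi>) = cnj (inverse (l \<xi>) * hat y \<xi>)"
    using AE_hat_hermitian[of y] by eventually_elim (use l_hermitian in \<open>simp add: hermitian_def\<close>)
  ultimately obtain u where u: "AE \<xi> in lborel. hat u \<xi> = inverse (l \<xi>) * hat y \<xi>" by (rule fourier_L2_surj)
  have "AE \<xi> in lborel. hat y \<xi> = l \<xi> * hat u \<xi>"
    using u by eventually_elim (simp add: l_nz)
  then have "u \<in> H \<and> L u = y" using H_spaceI[OF l_hermitian] diffop_eqI[OF l_hermitian] by blast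
  then have "Linv y \<in> H \<and> L (Linv y) = y" unfolding Linv_def by (rule someI)
  then show "Linv y \<in> H" "L (Linv y) = y" by auto
qed

lemma L_inj:
  assumes u: "u \<in> H" and v: "v \<in> H" and eq: "L u = L v"
  shows "u = v"
proof (rule hat_eqD)
  show "AE \<xi> in lborel. hat u \<xi> = hat v \<xi>"
    using AE_hat_diffop[OF l_hermitian u] AE_hat_diffop[OF l_hermitian v] unfolding eq
    by eventually_elim (use l_nz in auto)
qed

lemma Linv_L: "u \<in> H \<Longrightarrow> Linv (L u) = u"
  by (rule L_inj) (auto simp: Linv)

lemma Linv_add: "Linv (x + y) = Linv x + Linv y"
  by (rule L_inj) (auto simp: Linv L_add intro: subspace_add[OF subspace_H])

lemma Linv_scaleR: "Linv (c *\<^sub>R x) = c *\<^sub>R Linv x"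
  by (rule L_inj) (auto simp: Linv L_scaleR intro: subspace_scale[OF subspace_H])

lemma Linv_diff: "Linv (x - y) = Linv x - Linv y"
  by (rule L_inj) (auto simp: Linv L_diff intro: subspace_diff[OF subspace_H])

lemma L_pullback: "u \<in> H \<Longrightarrow> pullback (rot \<theta>) u \<in> H \<and> L (pullback (rot \<theta>) u) = pullback (rot \<theta>) (L u)"
  "u \<in> H \<Longrightarrow> pullback refl_x1 u \<in> H \<and> L (pullback refl_x1 u) = pullback refl_x1 (L u)"
  using L_equivariant by (auto simp: euclidean_equivariant_def commutes_with_def)

lemma G_pullback: "u \<in> H \<Longrightarrow> G (pullback (rot \<theta>) u) = pullback (rot \<theta>) (G u)"
  "u \<in> H \<Longrightarrow> G (pullback refl_x1 u) = pullback refl_x1 (G u)"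
  using G_equivariant by (auto simp: euclidean_equivariant_def commutes_with_def)

lemma Linv_pullback: "Linv (pullback (rot \<theta>) y) = pullback (rot \<theta>) (Linv y)"
  "Linv (pullback refl_x1 y) = pullback refl_x1 (Linv y)"
  by (rule L_inj; simp add: Linv L_pullback)+

lemma H_norm_scaleR: "v \<in> H \<Longrightarrow> H_norm l (t *\<^sub>R v) = \<bar>t\<bar> * H_norm l v"
  by (simp add: H_norm_def L_scaleR)

abbreviation "DG \<equiv> fderiv_on H (H_norm l) G"

lemma DG_has_fderiv: "w \<in> H \<Longrightarrow> has_fderiv_on H (H_norm l) G w (DG w)"
  by (rule smooth_has_fderiv_on[OF G_smooth subspace_H])

lemma DG_tendsto:
  assumes "w \<in> H" "v \<in> H"
  shows "((\<lambda>t. (G (w + t *\<^sub>R v) - G w) /\<^sub>R t) \<longlongrightarrow> DG w v) (at 0)"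
  by (rule has_fderiv_on_tendsto[OF DG_has_fderiv[OF assms(1)] subspace_H assms(2) H_norm_scaleR[OF assms(2)]])

lemma DG_linear:
  assumes w: "w \<in> H"
  shows "u \<in> H \<Longrightarrow> v \<in> H \<Longrightarrow> DG w (u + v) = DG w u + DG w v"
    and "v \<in> H \<Longrightarrow> DG w (a *\<^sub>R v) = a *\<^sub>R DG w v"
    and "\<exists>C. \<forall>v\<in>H. norm (DG w v) \<le> C * norm (L v)"
  using DG_has_fderiv[OF w] unfolding has_fderiv_on_def bounded_linear_between_def H_norm_def by auto

text \<open>Values of the derivative are limits of difference quotients, through which the
  equivariance of G passes.\<close>

lemma DG_pullback_aux:
  assumes T: "orthogonal_transformation T" and w: "w \<in> H" and v: "v \<in> H"
    and H: "\<And>u. u \<in> H \<Longrightarrow> pullback T u \<in> H" and c: "\<And>u. u \<in> H \<Longrightarrow> G (pullback T u) = pullback T (G u)"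
  shows "DG (pullback T w) (pullback T v) = pullback T (DG w v)"
proof (rule tendsto_unique)
  interpret bounded_linear "pullback T" by (rule bounded_linear_pullback[OF T])
  show "((\<lambda>t. pullback T ((G (w + t *\<^sub>R v) - G w) /\<^sub>R t)) \<longlongrightarrow> pullback T (DG w v)) (at 0)"
    by (intro tendsto DG_tendsto w v)
  have wv: "w + t *\<^sub>R v \<in> H" for t using subspace_H w v by (intro subspace_add subspace_scale)
  have "pullback T ((G (w + t *\<^sub>R v) - G w) /\<^sub>R t) = (G (pullback T w + t *\<^sub>R pullback T v) - G (pullback T w)) /\<^sub>R t" for t
    using c[OF wv[of t]] c[OF w] by (simp add: scaleR diff add)
  then show "((\<lambda>t. pullback T ((G (w + t *\<^sub>R v) - G w) /\<^sub>R t)) \<longlongrightarrow> DG (pullback T w) (pullback T v)) (at 0)"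
    using DG_tendsto[OF H[OF w] H[OF v]] by simp
qed simp

lemma DG_pullback:
  assumes "w \<in> H" "v \<in> H"
  shows "DG (pullback (rot \<theta>) w) (pullback (rot \<theta>) v) = pullback (rot \<theta>) (DG w v)"
    and "DG (pullback refl_x1 w) (pullback refl_x1 v) = pullback refl_x1 (DG w v)"
  using assms L_pullback G_pullback
  by (auto intro!: DG_pullback_aux orthogonal_transformation_rot orthogonal_transformation_refl)

text \<open>\<open>factor i p y\<close> is a pointwise representative of the factor \<open>(i, p)\<close> of the nonlinearity at
  \<open>L\<^sup>-\<^sup>1 y\<close>.\<close>

definition kernel :: "nat \<Rightarrow> nat \<Rightarrow> (real^2 \<Rightarrow> complex L2) \<times> real" where
  "kernel i p = (SOME (K, C). (\<forall>x. norm (K x) \<le> C) \<and>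
    (\<forall>y. (\<lambda>x. inner (K x) (fourier_L2 y)) \<in> borel_measurable borel) \<and>
    (\<forall>y b. (AE \<xi> in lborel. hat b \<xi> = g i p \<xi> / l \<xi> * hat y \<xi>) \<longrightarrow>
       (AE x in lborel. rep_L2 b x = inner (K x) (fourier_L2 y))))"

definition factor :: "nat \<Rightarrow> nat \<Rightarrow> real L2 \<Rightarrow> real^2 \<Rightarrow> real" where
  "factor i p y x = inner (fst (kernel i p) x) (fourier_L2 y)"

context
  fixes i p :: nat
  assumes ip: "i \<in> {2..N}" "p \<in> {1..i}"
begin

lemma symbol_quotient:
  "sq_integrable (\<lambda>\<xi>. g i p \<xi> / l \<xi>)" "\<exists>B. \<forall>\<xi>. cmod (g i p \<xi> / l \<xi>) \<le> B" "hermitian (g i p)"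
proof -
  have s: "diffop_symbol (g i p)" "integrable lborel (\<lambda>\<xi>. g i p \<xi> / l \<xi>)"
    using g_symbol g_integrable ip by auto
  show "sq_integrable (\<lambda>\<xi>. g i p \<xi> / l \<xi>)" by (rule sq_integrable_symbol_quotient[OF l_symbol l_nz l_rot s])
  show "\<exists>B. \<forall>\<xi>. cmod (g i p \<xi> / l \<xi>) \<le> B"
    using integrable_symbol_quotient_bounded[OF l_symbol l_nz l_rot s] by blast
  show "hermitian (g i p)" by (rule diffop_symbol_hermitian[OF s(1)])
qed

lemma kernel_props:
  shows "norm (fst (kernel i p) x) \<le> snd (kernel i p)"
    and "factor i p y \<in> borel_measurable borel"
    and "AE \<xi> in lborel. hat b \<xi> = g i p \<xi> / l \<xi> * hat y \<xi> \<Longrightarrow> AE x in lborel. rep_L2 b x = factor i p y x"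
proof -
  obtain B where B: "\<And>\<xi>. cmod (g i p \<xi> / l \<xi>) \<le> B" using symbol_quotient(2) by blast
  let ?P = "\<lambda>(K, C). (\<forall>x. norm (K x) \<le> C) \<and>
    (\<forall>y. (\<lambda>x. inner (K x) (fourier_L2 y)) \<in> borel_measurable borel) \<and>
    (\<forall>y b. (AE \<xi> in lborel. hat b \<xi> = g i p \<xi> / l \<xi> * hat y \<xi>) \<longrightarrow>
       (AE x in lborel. rep_L2 b x = inner (K x) (fourier_L2 y)))"
  from fourier_multiplier_kernel[OF symbol_quotient(1) B] obtain K C where "?P (K, C)" by auto
  then have "?P (kernel i p)" unfolding kernel_def by (rule someI)
  then show "norm (fst (kernel i p) x) \<le> snd (kernel i p)"
    "factor i p y \<in> borel_measurable borel"
    "AE \<xi> in lborel. hat b \<xi> = g i p \<xi> / l \<xi> * hat y \<xi> \<Longrightarrow> AE x in lborel. rep_L2 b x = factor i p y x"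
    by (auto simp: case_prod_beta factor_def[abs_def])
qed

lemma abs_factor_le: "\<bar>factor i p y x\<bar> \<le> snd (kernel i p) * norm y"
proof -
  have "\<bar>factor i p y x\<bar> \<le> norm (fst (kernel i p) x) * norm (fourier_L2 y)"
    unfolding factor_def by (rule Cauchy_Schwarz_ineq2)
  also have "\<dots> \<le> snd (kernel i p) * norm y"
    using kernel_props(1)[of x] by (simp add: norm_fourier_L2 mult_right_mono)
  finally show ?thesis .
qed

text \<open>Since g/l is bounded, multiplying the transform of L u by it stays in L^2; so u lies in
  the domain of \<open>diffop (g i p)\<close> and the default value 0 does not occur.\<close>

lemma AE_rep_diffop_g:
  assumes u: "u \<in> H"
  shows "AE x in lborel. rep_L2 (diffop (g i p) u) x = factor i p (L u) x"
proof (rule kernel_props(3))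
  obtain B where B: "\<And>\<xi>. cmod (g i p \<xi> / l \<xi>) \<le> B" using symbol_quotient(2) by blast
  have m [measurable]: "g i p \<in> borel_measurable borel" using symbol_quotient(3) by (simp add: hermitian_def)
  have Lu: "AE \<xi> in lborel. g i p \<xi> / l \<xi> * hat (L u) \<xi> = g i p \<xi> * hat u \<xi>"
    using AE_hat_diffop[OF l_hermitian u] by eventually_elim (simp add: l_nz)
  have "sq_integrable (\<lambda>\<xi>. g i p \<xi> / l \<xi> * hat (L u) \<xi>)"
    by (rule sq_integrable_mult_bounded[OF sq_integrable_rep_L2 _ B]) measurable
  moreover have "AE \<xi> in lborel. g i p (- \<xi>) / l (- \<xi>) * hat (L u) (- \<xi>) = cnj (g i p \<xi> / l \<xi> * hat (L u) \<xi>)"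
    using AE_hat_hermitian[of "L u"] by eventually_elim (use symbol_quotient(3) l_hermitian in \<open>simp add: hermitian_def\<close>)
  ultimately obtain b where b: "AE \<xi> in lborel. hat b \<xi> = g i p \<xi> / l \<xi> * hat (L u) \<xi>" by (rule fourier_L2_surj)
  then have "AE \<xi> in lborel. hat b \<xi> = g i p \<xi> * hat u \<xi>" using Lu by eventually_elim simp
  then have "diffop (g i p) u = b" by (rule diffop_eqI[OF symbol_quotient(3)])
  then show "AE \<xi> in lborel. hat (diffop (g i p) u) \<xi> = g i p \<xi> / l \<xi> * hat (L u) \<xi>" using b by simp
qed

lemma sq_integrable_factor: "sq_integrable (factor i p y)"
proof -
  have ae: "AE x in lborel. rep_L2 (diffop (g i p) (Linv y)) x = factor i p y x"
    using AE_rep_diffop_g[OF Linv(1)] by (simp add: Linv)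
  have [measurable]: "factor i p y \<in> borel_measurable borel" by (rule kernel_props(2))
  have "integrable lborel (\<lambda>x. (norm (rep_L2 (diffop (g i p) (Linv y)) x))\<^sup>2)"
    using sq_integrable_rep_L2[of "diffop (g i p) (Linv y)"] by (simp add: sq_integrable_def)
  also have "?this \<longleftrightarrow> integrable lborel (\<lambda>x. (norm (factor i p y x))\<^sup>2)"
    by (rule integrable_cong_AE) (use ae in \<open>auto elim: eventually_mono\<close>)
  finally show ?thesis by (simp add: sq_integrable_def)
qed

end

lemma factor_add: "factor i p (y + z) x = factor i p y x + factor i p z x"
  by (simp add: factor_def fourier_L2_add inner_add_right)

lemma factor_scaleR: "factor i p (c *\<^sub>R y) x = c * factor i p y x"
  by (simp add: factor_def fourier_L2_scaleR)

lemma sq_integrable_factor_prod: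
  assumes i: "i \<in> {2..N}" and P: "P \<subseteq> {1..i}" "P \<noteq> {}"
  shows "sq_integrable (\<lambda>x. \<Prod>p\<in>P. factor i p y x)"
  using P sq_integrable_factor[OF i] abs_factor_le[OF i]
  by (intro sq_integrable_prod_bounded[where B="\<lambda>p. snd (kernel i p) * norm y"]) (auto intro: finite_subset)

text \<open>Each product has one square-integrable factor and bounded others, hence is square
  integrable: \<open>mk_L2\<close> in \<open>nonlin\<close> never takes its default value.\<close>

lemma AE_rep_G:
  assumes u: "u \<in> H"
  shows "AE x in lborel. rep_L2 (G u) x = (\<Sum>i=2..N. \<Prod>p=1..i. factor i p (L u) x)"
proof -
  have one: "AE x in lborel. rep_L2 (mk_L2 (\<lambda>x. \<Prod>p=1..i. rep_L2 (diffop (g i p) u) x)) x = (\<Prod>p=1..i. factor i p (L u) x)"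
    if i: "i \<in> {2..N}" for i
  proof -
    have "AE x in lborel. \<forall>p\<in>{1..i}. rep_L2 (diffop (g i p) u) x = factor i p (L u) x"
      using AE_rep_diffop_g[OF i _ u] by (intro AE_finite_allI) auto
    then have ae: "AE x in lborel. (\<Prod>p=1..i. rep_L2 (diffop (g i p) u) x) = (\<Prod>p=1..i. factor i p (L u) x)"
      by eventually_elim (auto intro: prod.cong)
    have s: "sq_integrable (\<lambda>x. \<Prod>p=1..i. factor i p (L u) x)"
      using i by (intro sq_integrable_factor_prod) auto
    then have [measurable]: "(\<lambda>x. \<Prod>p=1..i. factor i p (L u) x) \<in> borel_measurable borel" by (simp add: sq_integrable_def)
    have "integrable lborel (\<lambda>x. (norm (\<Prod>p=1..i. factor i p (L u) x))\<^sup>2)" using s by (simp add: sq_integrable_def)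
    also have "?this \<longleftrightarrow> integrable lborel (\<lambda>x. (norm (\<Prod>p=1..i. rep_L2 (diffop (g i p) u) x))\<^sup>2)"
    proof (rule integrable_cong_AE)
      show "(\<lambda>x. (norm (\<Prod>p=1..i. factor i p (L u) x))\<^sup>2) \<in> borel_measurable lborel" by measurable
      show "(\<lambda>x. (norm (\<Prod>p=1..i. rep_L2 (diffop (g i p) u) x))\<^sup>2) \<in> borel_measurable lborel" by measurable
    qed (use ae in eventually_elim, simp)
    finally have "sq_integrable (\<lambda>x. \<Prod>p=1..i. rep_L2 (diffop (g i p) u) x)" by (simp add: sq_integrable_def)
    from AE_rep_mk_L2[OF this] ae show ?thesis by eventually_elim simp
  qed
  have "AE x in lborel. \<forall>i\<in>{2..N}. rep_L2 (mk_L2 (\<lambda>x. \<Prod>p=1..i. rep_L2 (diffop (g i p) u) x)) x = (\<Prod>p=1..i. factor i p (L u) x)"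
    using one by (intro AE_finite_allI) auto
  then show ?thesis
    using AE_rep_sum[of "{2..N}" "\<lambda>i. mk_L2 (\<lambda>x. \<Prod>p=1..i. rep_L2 (diffop (g i p) u) x)", OF finite_atLeastAtMost]
    unfolding nonlin_def by eventually_elim simp
qed

text \<open>The Leibniz rule for the nonlinearity, at the function with L w = y and in the direction
  with L v = z.\<close>

definition DG_rep :: "real L2 \<Rightarrow> real L2 \<Rightarrow> real^2 \<Rightarrow> real" where
  "DG_rep y z x = (\<Sum>i=2..N. \<Sum>q=1..i. factor i q z x * (\<Prod>p\<in>{1..i}-{q}. factor i p y x))"

lemma DG_rep_borel: "DG_rep y z \<in> borel_measurable borel"
proof -
  have *: "(\<lambda>x. \<Sum>q=1..i. factor i q z x * (\<Prod>p\<in>{1..i}-{q}. factor i p y x)) \<in> borel_measurable borel" if "i \<in> {2..N}" for i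
    using kernel_props(2)[OF that]
    by (intro borel_measurable_sum borel_measurable_times borel_measurable_prod) auto
  show ?thesis unfolding DG_rep_def[abs_def] by (rule borel_measurable_sum, rule *)
qed

text \<open>The smoothness hypothesis yields an abstract derivative. Its difference quotients
  converge in L^2, while pointwise each is the quotient of a polynomial in t; the two limits must
  agree.\<close>

lemma AE_rep_DG:
  assumes w: "w \<in> H" and v: "v \<in> H"
  shows "AE x in lborel. rep_L2 (DG w v) x = DG_rep (L w) (L v) x"
proof (rule L2_tendsto_AE_eq[OF _ _ DG_rep_borel])
  \<comment> \<open>A sequence of step sizes instead of a continuum, so that only countably many
    exceptional null sets are united.\<close>
  let ?t = "\<lambda>n. inverse (real (Suc n))"
  let ?q = "\<lambda>t. (G (w + t *\<^sub>R v) - G w) /\<^sub>R t"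
  have t: "filterlim ?t (at 0) sequentially"
    unfolding filterlim_at by (intro conjI LIMSEQ_inverse_real_of_nat always_eventually) auto
  show "(\<lambda>n. ?q (?t n)) \<longlonglongrightarrow> DG w v"
    by (rule filterlim_compose[OF DG_tendsto[OF w v] t])
  have wv: "w + t *\<^sub>R v \<in> H" for t using subspace_H w v by (intro subspace_add subspace_scale)
  let ?P = "\<lambda>x t. \<Sum>i=2..N. \<Prod>p=1..i. factor i p (L w) x + t * factor i p (L v) x"
  have rep: "AE x in lborel. rep_L2 (?q t) x = (?P x t - ?P x 0) / t" for t
  proof -
    have e: "factor i p (L (w + t *\<^sub>R v)) x = factor i p (L w) x + t * factor i p (L v) x" for i p x
      using v w subspace_scale[OF subspace_H v] by (simp add: L_add L_scaleR factor_add factor_scaleR)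
    show ?thesis
      using AE_rep_G[OF wv[of t]] AE_rep_G[OF w] AE_rep_diff[of "G (w + t *\<^sub>R v)" "G w"]
        AE_rep_scaleR[of "inverse t" "G (w + t *\<^sub>R v) - G w"]
      by eventually_elim (simp add: e divide_inverse mult.commute)
  qed
  have "AE x in lborel. \<forall>n. rep_L2 (?q (?t n)) x = (?P x (?t n) - ?P x 0) / ?t n"
    unfolding AE_all_countable using rep by blast
  then show "AE x in lborel. (\<lambda>n. rep_L2 (?q (?t n)) x) \<longlonglongrightarrow> DG_rep (L w) (L v) x"
  proof eventually_elim
    fix x assume x: "\<forall>n. rep_L2 (?q (?t n)) x = (?P x (?t n) - ?P x 0) / ?t n"
    have "(?P x has_field_derivative DG_rep (L w) (L v) x) (at 0)"
      unfolding DG_rep_def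
    proof (rule DERIV_sum)
      fix i
      have "((\<lambda>t. \<Prod>p=1..i. factor i p (L w) x + t * factor i p (L v) x) has_field_derivative
        (\<Sum>q=1..i. factor i q (L v) x * (\<Prod>p\<in>{1..i}-{q}. factor i p (L w) x + 0 * factor i p (L v) x))) (at 0)"
        by (rule has_field_derivative_prod[where f="\<lambda>p t. factor i p (L w) x + t * factor i p (L v) x"])
          (auto intro!: derivative_eq_intros)
      then show "((\<lambda>t. \<Prod>p=1..i. factor i p (L w) x + t * factor i p (L v) x) has_field_derivative
        (\<Sum>q=1..i. factor i q (L v) x * (\<Prod>p\<in>{1..i}-{q}. factor i p (L w) x))) (at 0)" by simp
    qed
    then have "((\<lambda>t. (?P x t - ?P x 0) / t) \<longlongrightarrow> DG_rep (L w) (L v) x) (at 0)"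
      by (simp add: has_field_derivative_iff)
    from filterlim_compose[OF this t] show "(\<lambda>n. rep_L2 (?q (?t n)) x) \<longlonglongrightarrow> DG_rep (L w) (L v) x"
      using x by simp
  qed
qed

text \<open>The varied factor is a pairing with a fixed kernel at each point, so weak convergence
  makes it tend to 0 pointwise with a uniform bound. The unvaried factors form an L^2 function, and
  dominated convergence applies.\<close>

lemma DG_compact:
  assumes w: "w \<in> H" and bd: "\<And>n. norm (y n) \<le> 1"
    and weak: "\<And>c. (\<lambda>n::nat. inner c (fourier_L2 (y n))) \<longlonglongrightarrow> 0"
  shows "(\<lambda>n. DG w (Linv (y n))) \<longlonglongrightarrow> 0"
proof -
  define D where "D x = (\<Sum>i=2..N. \<Sum>q=1..i. snd (kernel i q) * \<bar>\<Prod>p\<in>{1..i}-{q}. factor i p (L w) x\<bar>)" for x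
  have pr: "sq_integrable (\<lambda>x. \<Prod>p\<in>{1..i}-{q}. factor i p (L w) x)" if "i \<in> {2..N}" for i q
  proof (rule sq_integrable_factor_prod[OF that])
    \<comment> \<open>Superlinearity enters here: with i \<ge> 2 at least one unvaried factor
      remains to localize the product.\<close>
    have "1 \<in> {1..i}-{q} \<or> 2 \<in> {1..i}-{q}" using that by auto
    then show "{1..i}-{q} \<noteq> {}" by blast
  qed auto
  have pa: "sq_integrable (\<lambda>x. c * \<bar>\<Prod>p\<in>{1..i}-{q}. factor i p (L w) x\<bar>)" if "i \<in> {2..N}" for i q c
  proof -
    have "sq_integrable (\<lambda>x. \<bar>\<Prod>p\<in>{1..i}-{q}. factor i p (L w) x\<bar>)"
      using pr[OF that, of q] by (simp only: sq_integrable_def borel_measurable_abs real_norm_def abs_idempotent simp_thms)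
    from sq_integrable_scaleR[OF this, of c] show ?thesis by simp
  qed
  have sum: "sq_integrable (\<lambda>x. \<Sum>i\<in>I. f i x)" if "finite I" "\<And>i. i \<in> I \<Longrightarrow> sq_integrable (f i)"
    for I :: "nat set" and f :: "nat \<Rightarrow> real^2 \<Rightarrow> real"
    using that by (induction I rule: finite_induct) (auto intro: sq_integrable_add sq_integrable_zero)
  have D: "sq_integrable D" unfolding D_def[abs_def] by (intro sum pa) auto
  have le: "\<bar>DG_rep (L w) (y n) x\<bar> \<le> D x" for n x
    unfolding DG_rep_def D_def
  proof (intro order_trans[OF sum_abs] sum_mono)
    fix i q assume i: "i \<in> {2..N}" "q \<in> {1..i}"
    have "\<bar>factor i q (y n) x\<bar> \<le> snd (kernel i q) * norm (y n)" by (rule abs_factor_le[OF i])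
    also have "\<dots> \<le> snd (kernel i q)"
      using bd[of n] kernel_props(1)[OF i, of x] by (intro mult_left_le) (auto intro: order_trans[OF norm_ge_zero])
    finally show "\<bar>factor i q (y n) x * (\<Prod>p\<in>{1..i}-{q}. factor i p (L w) x)\<bar>
        \<le> snd (kernel i q) * \<bar>\<Prod>p\<in>{1..i}-{q}. factor i p (L w) x\<bar>"
      unfolding abs_mult by (rule mult_right_mono) simp
  qed
  have "(\<lambda>n. LINT x|lborel. (DG_rep (L w) (y n) x)\<^sup>2) \<longlonglongrightarrow> integral\<^sup>L lborel (\<lambda>x::real^2. 0::real)"
  proof (rule integral_dominated_convergence)
    show "integrable lborel (\<lambda>x. (D x)\<^sup>2)" using D by (simp add: sq_integrable_def)
    show "AE x in lborel. norm ((DG_rep (L w) (y n) x)\<^sup>2) \<le> (D x)\<^sup>2" for n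
      using power_mono[OF le abs_ge_zero, of n _ 2] by simp
    show "AE x in lborel. (\<lambda>n. (DG_rep (L w) (y n) x)\<^sup>2) \<longlonglongrightarrow> 0"
    proof (rule AE_I2)
      fix x
      have "(\<lambda>n. (DG_rep (L w) (y n) x)\<^sup>2) \<longlonglongrightarrow> (\<Sum>i=2..N. \<Sum>q=1..i. 0 * (\<Prod>p\<in>{1..i}-{q}. factor i p (L w) x))\<^sup>2"
        unfolding DG_rep_def factor_def[of _ _ "y _"] by (intro tendsto_intros weak)
      then show "(\<lambda>n. (DG_rep (L w) (y n) x)\<^sup>2) \<longlonglongrightarrow> 0" by simp
    qed
  qed (use DG_rep_borel in auto)
  moreover have "(LINT x|lborel. (DG_rep (L w) (y n) x)\<^sup>2) = (norm (DG w (Linv (y n))))\<^sup>2" for n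
  proof -
    have "AE x in lborel. rep_L2 (DG w (Linv (y n))) x = DG_rep (L w) (y n) x"
      using AE_rep_DG[OF w Linv(1), of "y n"] by (simp add: Linv)
    then show ?thesis
      unfolding norm_L2_rep by (intro integral_cong_AE) (use DG_rep_borel in \<open>auto elim: eventually_mono\<close>)
  qed
  ultimately have "(\<lambda>n. sqrt ((norm (DG w (Linv (y n))))\<^sup>2)) \<longlonglongrightarrow> sqrt 0"
    by (intro tendsto_real_sqrt) simp
  then show ?thesis by (simp add: tendsto_norm_zero_iff)
qed

end

section \<open>The augmented problem\<close>

text \<open>\<open>onorm_on\<close> is a supremum of reals, meaningful only when the quotients are
  bounded. Hence every operator-norm hypothesis is accompanied by a crude bound C before it is
  used.\<close>

lemma onorm_on_bound:
  assumes C: "\<And>u. u \<in> V \<Longrightarrow> nW (T u) \<le> C * nV u" and nV: "\<And>u. u \<in> V \<Longrightarrow> nV u \<ge> 0" and u: "u \<in> V"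
  shows "nW (T u) \<le> onorm_on V nV nW T * nV u"
proof (cases "nV u = 0")
  case True
  then show ?thesis using C[OF u] by simp
next
  case False
  then have pos: "nV u > 0" using nV[OF u] by simp
  have "bdd_above ((\<lambda>u. nW (T u) / nV u) ` V)"
  proof (rule bdd_aboveI2)
    fix v assume v: "v \<in> V"
    show "nW (T v) / nV v \<le> \<bar>C\<bar>"
    proof (cases "nV v = 0")
      case False
      then have "nV v > 0" using nV[OF v] by simp
      moreover have "C * nV v \<le> \<bar>C\<bar> * nV v" using nV[OF v] by (intro mult_right_mono) auto
      note order_trans[OF C[OF v] this]
      ultimately show ?thesis by (simp add: pos_divide_le_eq)
    qed simp
  qed
  then have "nW (T u) / nV u \<le> onorm_on V nV nW T"
    unfolding onorm_on_def by (intro cSUP_upper u)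
  then show ?thesis using pos by (simp add: pos_divide_le_eq)
qed

lemma has_vector_derivative_difference_quotient:
  fixes f :: "real \<Rightarrow> 'a::real_normed_vector"
  assumes "((\<lambda>s. (f (t + s) - f t) /\<^sub>R s) \<longlongrightarrow> D) (at 0)"
  shows "(f has_vector_derivative D) (at t)"
  unfolding has_vector_derivative_def has_derivative_at
proof
  show "bounded_linear (\<lambda>h. h *\<^sub>R D)" by (rule bounded_linear_scaleR_left)
  have "((\<lambda>s. norm ((f (t + s) - f t) /\<^sub>R s - D)) \<longlongrightarrow> 0) (at 0)"
    using assms by (intro tendsto_norm_zero LIM_zero)
  moreover have "\<forall>\<^sub>F s in at 0. norm ((f (t + s) - f t) /\<^sub>R s - D) = norm (f (t + s) - f t - s *\<^sub>R D) / norm s"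
    unfolding eventually_at_filter
  proof (intro always_eventually allI impI)
    fix s :: real assume "s \<noteq> 0"
    then have "(f (t + s) - f t) /\<^sub>R s - D = (f (t + s) - f t - s *\<^sub>R D) /\<^sub>R s"
      by (simp add: scaleR_diff_right)
    then show "norm ((f (t + s) - f t) /\<^sub>R s - D) = norm (f (t + s) - f t - s *\<^sub>R D) / norm s"
      by (simp add: divide_inverse mult.commute)
  qed
  ultimately show "((\<lambda>h. norm (f (t + h) - f t - h *\<^sub>R D) / norm h) \<longlongrightarrow> 0) (at 0)"
    by (rule Lim_transform_eventually)
qed

lemma fourier_L2_sum: "fourier_L2 (\<Sum>i\<in>I. f i) = (\<Sum>i\<in>I. fourier_L2 (f i))"
proof -
  have "fourier_L2 0 = 0" using fourier_L2_scaleR[of 0 0] by simp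
  then show ?thesis by (induction I rule: infinite_finite_induct) (simp_all add: fourier_L2_add)
qed

lemma deriv_symbol_hermitian: "hermitian (\<lambda>\<xi>. 2 * complex_of_real pi * \<i> * complex_of_real (\<xi> $ 2))"
  by (simp add: hermitian_def)

lemma pullback_zero: "orthogonal_transformation T \<Longrightarrow> pullback T 0 = 0"
  using linear_0[OF bounded_linear.linear[OF bounded_linear_pullback]] .

text \<open>For an invariant u, pulling back its derivative changes nothing on the Fourier side
  except the linear form, which becomes the second coordinate of T \<xi>.\<close>

lemma hat_pullback_deriv_x2:
  assumes T: "orthogonal_transformation T" and inv: "pullback T u = u"
    and u: "u \<in> H_space (\<lambda>\<xi>. 2 * complex_of_real pi * \<i> * complex_of_real (\<xi> $ 2))"
  shows "AE \<xi> in lborel. hat (pullback T (deriv_x2 u)) \<xi> = 2 * complex_of_real pi * \<i> * complex_of_real (T \<xi> $ 2) * hat u \<xi>"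
  using AE_hat_pullback[OF T, of "deriv_x2 u"] AE_hat_pullback[OF T, of u]
    AE_orthogonal[OF T AE_hat_diffop[OF deriv_symbol_hermitian u]]
  unfolding inv deriv_x2_def by eventually_elim simp

lemma deriv_x2_Z2Z1:
  assumes "u \<in> L2_sym Z2Z1"
  shows "deriv_x2 u \<in> L2_sym Z2Z1"
proof (cases "u \<in> H_space (\<lambda>\<xi>. 2 * complex_of_real pi * \<i> * complex_of_real (\<xi> $ 2))")
  case True
  have "pullback refl_x1 (deriv_x2 u) = deriv_x2 u"
    by (rule hat_eqD, use hat_pullback_deriv_x2[OF orthogonal_transformation_refl _ True]
      AE_hat_diffop[OF deriv_symbol_hermitian True] assms in \<open>auto simp: Z2Z1_iff deriv_x2_def refl_x1_def\<close>)
  then show ?thesis by (simp add: Z2Z1_iff)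
next
  \<comment> \<open>Outside its domain \<open>deriv_x2\<close> has the default value 0, which has
    every symmetry.\<close>
  case False
  then have "deriv_x2 u = 0" by (simp add: deriv_x2_def diffop_def)
  then show ?thesis using subspace_0[OF L2_sym_Z2Z1_subspace(1)] by simp
qed

text \<open>The rotated derivatives of a symmetric function are its derivatives in j directions
  pointing to the vertices of a regular j-gon, and these directions sum to 0.\<close>

lemma rot_average_deriv_x2:
  assumes u: "u \<in> L2_sym (dihedral j)" and j: "j \<ge> 2"
  shows "rot_average j (deriv_x2 u) = 0"
proof (cases "u \<in> H_space (\<lambda>\<xi>. 2 * complex_of_real pi * \<i> * complex_of_real (\<xi> $ 2))")
  case True
  have "(\<Sum>k<j. pullback (rotk j k) (deriv_x2 u)) = 0"
  proof (rule hat_eqD)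
    have "AE \<xi> in lborel. \<forall>k\<in>{..<j}. hat (pullback (rotk j k) (deriv_x2 u)) \<xi>
        = 2 * complex_of_real pi * \<i> * complex_of_real (rotk j k \<xi> $ 2) * hat u \<xi>"
      using hat_pullback_deriv_x2[OF orthogonal_transformation_rot pullback_rotk_dihedral[OF u] True]
      by (intro AE_finite_allI) auto
    moreover have "AE \<xi> in lborel. hat (\<Sum>k<j. pullback (rotk j k) (deriv_x2 u)) \<xi>
        = (\<Sum>k<j. hat (pullback (rotk j k) (deriv_x2 u)) \<xi>)"
      unfolding fourier_L2_sum by (rule AE_rep_sum) simp
    moreover have "AE \<xi> in lborel. hat 0 \<xi> = 0" using AE_hat_scaleR[of 0 0] by eventually_elim simp
    ultimately show "AE \<xi> in lborel. hat (\<Sum>k<j. pullback (rotk j k) (deriv_x2 u)) \<xi> = hat 0 \<xi>"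
    proof eventually_elim
      fix \<xi>
      assume "\<forall>k\<in>{..<j}. hat (pullback (rotk j k) (deriv_x2 u)) \<xi>
        = 2 * complex_of_real pi * \<i> * complex_of_real (rotk j k \<xi> $ 2) * hat u \<xi>"
        and a: "hat (\<Sum>k<j. pullback (rotk j k) (deriv_x2 u)) \<xi> = (\<Sum>k<j. hat (pullback (rotk j k) (deriv_x2 u)) \<xi>)"
          "hat 0 \<xi> = 0"
      then have "(\<Sum>k<j. hat (pullback (rotk j k) (deriv_x2 u)) \<xi>)
        = (\<Sum>k<j. 2 * complex_of_real pi * \<i> * complex_of_real (rotk j k \<xi> $ 2) * hat u \<xi>)"
        by (intro sum.cong) auto
      also have "\<dots> = 2 * complex_of_real pi * \<i> * complex_of_real ((\<Sum>k<j. rotk j k \<xi>) $ 2) * hat u \<xi>"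
        by (simp add: sum_distrib_left sum_distrib_right)
      also have "\<dots> = 0" by (simp add: sum_rotk_components[OF j])
      finally show "hat (\<Sum>k<j. pullback (rotk j k) (deriv_x2 u)) \<xi> = hat 0 \<xi>" using a by simp
    qed
  qed
  then show ?thesis by (simp add: rot_average_def)
next
  case False
  then have "deriv_x2 u = 0" by (simp add: deriv_x2_def diffop_def)
  then show ?thesis by (simp add: rot_average_def pullback_zero orthogonal_transformation_rot)
qed

lemma inner_rot_average:
  assumes z: "z \<in> L2_sym (dihedral j)" and j: "j > 0"
  shows "inner z (rot_average j u) = inner z u"
proof -
  have "inner z (pullback (rotk j k) u) = inner z u" for k
    using inner_pullback[OF orthogonal_transformation_rot, of "2 * pi * real k / real j" z u]
    by (simp add: pullback_rotk_dihedral[OF z])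
  then show ?thesis using j by (simp add: rot_average_def inner_sum_right)
qed

text \<open>A dihedrally symmetric z sees only the rotation average of what it is paired with, and
  here that average vanishes. This decouples the border of the augmented system from the symmetric
  functions.\<close>

lemma inner_deriv_x2_dihedral:
  assumes "u \<in> L2_sym (dihedral j)" "z \<in> L2_sym (dihedral j)" "j \<ge> 2"
  shows "inner z (deriv_x2 u) = 0"
  using inner_rot_average[OF assms(2), of "deriv_x2 u"] rot_average_deriv_x2[OF assms(1,3)] assms(3) by simp

context pattern_equation
begin

lemma L_rot_average: "u \<in> H \<Longrightarrow> rot_average j u \<in> H \<and> L (rot_average j u) = rot_average j (L u)"
proof -
  assume u: "u \<in> H"
  have "(\<Sum>k\<in>I. pullback (rotk j k) u) \<in> H \<and> L (\<Sum>k\<in>I. pullback (rotk j k) u) = (\<Sum>k\<in>I. pullback (rotk j k) (L u))"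
    if "finite I" for I
    using that
    by (induction I) (use u L_pullback(1)[OF u] in \<open>auto simp: L_add L_zero subspace_0[OF subspace_H] intro: subspace_add[OF subspace_H]\<close>)
  from this[of "{..<j}"] show ?thesis
    by (simp add: rot_average_def L_scaleR subspace_scale[OF subspace_H])
qed

lemma Linv_rot_average: "Linv (rot_average j y) = rot_average j (Linv y)"
  by (rule L_inj) (simp_all add: Linv L_rot_average)

text \<open>Equivariance moves the base point together with the direction; the base point returns to
  itself because w is symmetric.\<close>

lemma DG_rot_average:
  assumes w: "w \<in> H" "w \<in> L2_sym (dihedral j)" and v: "v \<in> H"
  shows "DG w (rot_average j v) = rot_average j (DG w v)"
proof -
  have p: "DG w (pullback (rotk j k) v) = pullback (rotk j k) (DG w v)" for k
    using DG_pullback(1)[OF w(1) v] by (metis pullback_rotk_dihedral[OF w(2)])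
  have z: "DG w 0 = 0" using DG_linear(2)[OF w(1), of 0 0] subspace_0[OF subspace_H] by simp
  have "(\<Sum>k\<in>I. pullback (rotk j k) v) \<in> H \<and> DG w (\<Sum>k\<in>I. pullback (rotk j k) v) = (\<Sum>k\<in>I. pullback (rotk j k) (DG w v))"
    if "finite I" for I
    using that
    by (induction I) (use v L_pullback(1)[OF v] in
      \<open>auto simp: DG_linear(1)[OF w(1)] z p subspace_0[OF subspace_H] intro: subspace_add[OF subspace_H]\<close>)
  from this[of "{..<j}"] show ?thesis
    by (simp add: rot_average_def DG_linear(2)[OF w(1)])
qed

lemma L_sym:
  "u \<in> H \<Longrightarrow> u \<in> L2_sym Z2Z1 \<Longrightarrow> L u \<in> L2_sym Z2Z1"
  "u \<in> H \<Longrightarrow> u \<in> L2_sym (dihedral j) \<Longrightarrow> L u \<in> L2_sym (dihedral j)"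
  using L_pullback[of u] by (metis Z2Z1_iff, metis dihedral_iff)

lemma G_sym:
  "u \<in> H \<Longrightarrow> u \<in> L2_sym Z2Z1 \<Longrightarrow> G u \<in> L2_sym Z2Z1"
  "u \<in> H \<Longrightarrow> u \<in> L2_sym (dihedral j) \<Longrightarrow> G u \<in> L2_sym (dihedral j)"
  using G_pullback[of u] by (metis Z2Z1_iff, metis dihedral_iff)

lemma DG_sym:
  "u \<in> H \<Longrightarrow> v \<in> H \<Longrightarrow> u \<in> L2_sym Z2Z1 \<Longrightarrow> v \<in> L2_sym Z2Z1 \<Longrightarrow> DG u v \<in> L2_sym Z2Z1"
  "u \<in> H \<Longrightarrow> v \<in> H \<Longrightarrow> u \<in> L2_sym (dihedral j) \<Longrightarrow> v \<in> L2_sym (dihedral j) \<Longrightarrow> DG u v \<in> L2_sym (dihedral j)"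
  using DG_pullback[of u v] by (metis Z2Z1_iff, metis dihedral_iff)

lemma Linv_sym:
  "y \<in> L2_sym Z2Z1 \<Longrightarrow> Linv y \<in> L2_sym Z2Z1"
  "y \<in> L2_sym (dihedral j) \<Longrightarrow> Linv y \<in> L2_sym (dihedral j)"
  using Linv_pullback(1)[of _ y] Linv_pullback(2)[of y] by (metis Z2Z1_iff, metis dihedral_iff)

lemma aug_norm_eq: "aug_norm l x = norm (fst x, L (snd x))"
  by (simp add: aug_norm_def case_prod_beta H_norm_def norm_prod_def)

lemma aug_space_iff: "x \<in> aug_space l Z2Z1 \<longleftrightarrow> snd x \<in> H \<and> snd x \<in> L2_sym Z2Z1"
  by (cases x) (simp add: aug_space_def H_sym_def)

lemma subspace_aug_space: "subspace (aug_space l Z2Z1)"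
  unfolding aug_space_def H_sym_def
  by (intro subspace_Times subspace_UNIV subspace_inter subspace_H L2_sym_Z2Z1_subspace(1))

lemma aug_norm_scaleR: "x \<in> aug_space l Z2Z1 \<Longrightarrow> aug_norm l (t *\<^sub>R x) = \<bar>t\<bar> * aug_norm l x"
proof -
  assume "x \<in> aug_space l Z2Z1"
  then have "(fst (t *\<^sub>R x), L (snd (t *\<^sub>R x))) = t *\<^sub>R (fst x, L (snd x))"
    by (simp add: aug_space_iff L_scaleR)
  then show ?thesis by (simp only: aug_norm_eq norm_scaleR)
qed

lemma norm_L_le_aug_norm: "norm (L (snd x)) \<le> aug_norm l x"
  unfolding aug_norm_eq by (rule norm_snd_le)

lemma abs_fst_le_aug_norm: "\<bar>fst x\<bar> \<le> aug_norm l x"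
  unfolding aug_norm_eq real_norm_def[symmetric] by (rule norm_fst_le)

text \<open>\<open>DF_aug\<close> is a choice, but directional limits determine it on the subspace,
  so it suffices to exhibit one derivative there.\<close>

lemma DF_aug_eq:
  assumes w: "w \<in> H" and x: "x \<in> aug_space l Z2Z1" and w0: "w\<^sub>0 \<in> H"
  shows "DF_aug l N g \<rho> w\<^sub>0 (\<beta>, w) x
    = (1 / \<rho> * inner (L (snd x)) (deriv_x2 w\<^sub>0), L (snd x) + DG w (snd x) + fst x *\<^sub>R (deriv_x2 w\<^sub>0 /\<^sub>R \<rho>))"
proof -
  define D where "D x = (1 / \<rho> * inner (L (snd x)) (deriv_x2 w\<^sub>0), L (snd x) + DG w (snd x) + fst x *\<^sub>R (deriv_x2 w\<^sub>0 /\<^sub>R \<rho>))"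
    for x :: "real \<times> real L2"
  let ?V = "aug_space l Z2Z1" and ?d = "deriv_x2 w\<^sub>0"
  obtain C where C: "\<And>v. v \<in> H \<Longrightarrow> norm (DG w v) \<le> C * norm (L v)" using DG_linear(3)[OF w] by blast
  have "has_fderiv_on ?V (aug_norm l) (F_aug l N g \<rho> w\<^sub>0) (\<beta>, w) D"
    unfolding has_fderiv_on_def
  proof
    show "bounded_linear_between ?V (aug_norm l) UNIV norm D"
      unfolding bounded_linear_between_def
    proof (intro conjI ballI allI)
      fix u v :: "real \<times> real L2" and a :: real
      assume u: "u \<in> ?V"
      show "D u \<in> UNIV" by simp
      show "D (a *\<^sub>R u) = a *\<^sub>R D u"
        using u by (simp add: D_def aug_space_iff L_scaleR DG_linear(2)[OF w] scaleR_add_right)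
      assume v: "v \<in> ?V"
      show "D (u + v) = D u + D v"
        using u v by (simp add: D_def aug_space_iff L_add DG_linear(1)[OF w] scaleR_add_left inner_add_left distrib_left distrib_right)
    next
      show "\<exists>C. \<forall>u\<in>?V. norm (D u) \<le> C * aug_norm l u"
      proof (intro exI ballI)
        fix u assume u: "u \<in> ?V"
        let ?n = "aug_norm l u"
        have n: "norm (L (snd u)) \<le> ?n" "\<bar>fst u\<bar> \<le> ?n" by (rule norm_L_le_aug_norm abs_fst_le_aug_norm)+
        have "norm (D u) \<le> \<bar>1 / \<rho> * inner (L (snd u)) ?d\<bar> + norm (L (snd u) + DG w (snd u) + fst u *\<^sub>R (?d /\<^sub>R \<rho>))"
          unfolding D_def by (rule order_trans[OF norm_Pair_le]) simp
        also have "\<dots> \<le> \<bar>1 / \<rho>\<bar> * (?n * norm ?d) + (?n + \<bar>C\<bar> * ?n + ?n * norm (?d /\<^sub>R \<rho>))"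
        proof (intro add_mono norm_triangle_le)
          show "\<bar>1 / \<rho> * inner (L (snd u)) ?d\<bar> \<le> \<bar>1 / \<rho>\<bar> * (?n * norm ?d)"
            unfolding abs_mult
            by (intro mult_left_mono order_trans[OF Cauchy_Schwarz_ineq2] mult_right_mono n) auto
          have "norm (DG w (snd u)) \<le> C * norm (L (snd u))" using C u by (simp add: aug_space_iff)
          also have "\<dots> \<le> \<bar>C\<bar> * ?n" using n by (intro mult_mono) auto
          finally show "norm (DG w (snd u)) \<le> \<bar>C\<bar> * ?n" .
          show "norm (fst u *\<^sub>R (?d /\<^sub>R \<rho>)) \<le> ?n * norm (?d /\<^sub>R \<rho>)"
            unfolding norm_scaleR[of "fst u"] by (intro mult_right_mono n) auto
        qed (rule n)
        also have "\<dots> = (\<bar>1 / \<rho>\<bar> * norm ?d + (1 + \<bar>C\<bar> + norm (?d /\<^sub>R \<rho>))) * ?n" by (simp add: algebra_simps)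
        finally show "norm (D u) \<le> (\<bar>1 / \<rho>\<bar> * norm ?d + (1 + \<bar>C\<bar> + norm (?d /\<^sub>R \<rho>))) * ?n" .
      qed
    qed
    show "\<forall>\<epsilon>>0. \<exists>\<delta>>0. \<forall>v\<in>?V. aug_norm l v < \<delta> \<longrightarrow>
        norm (F_aug l N g \<rho> w\<^sub>0 ((\<beta>, w) + v) - F_aug l N g \<rho> w\<^sub>0 (\<beta>, w) - D v) \<le> \<epsilon> * aug_norm l v"
    proof (intro allI impI)
      fix \<epsilon> :: real assume \<epsilon>: "\<epsilon> > 0"
      obtain \<delta> where \<delta>: "\<delta> > 0" "\<And>v. v \<in> H \<Longrightarrow> norm (L v) < \<delta> \<Longrightarrow> norm (G (w + v) - G w - DG w v) \<le> \<epsilon> * norm (L v)"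
        using DG_has_fderiv[OF w] \<epsilon> unfolding has_fderiv_on_def H_norm_def by blast
      have "norm (F_aug l N g \<rho> w\<^sub>0 ((\<beta>, w) + v) - F_aug l N g \<rho> w\<^sub>0 (\<beta>, w) - D v) \<le> \<epsilon> * aug_norm l v"
        if v: "v \<in> ?V" "aug_norm l v < \<delta>" for v
      proof -
        obtain b z where bz: "v = (b, z)" by (cases v)
        have z: "z \<in> H" using v by (simp add: bz aug_space_iff)
        \<comment> \<open>Everything except G is affine in the pair, so the remainder of F is the
          remainder of G.\<close>
        have "F_aug l N g \<rho> w\<^sub>0 ((\<beta>, w) + v) - F_aug l N g \<rho> w\<^sub>0 (\<beta>, w) - D v = (0, G (w + z) - G w - DG w z)"
          using w z w0 subspace_add[OF subspace_H w z]
          by (simp add: bz F_aug_def f_aug_def D_def L_diff L_add inner_add_left inner_diff_left add_divide_distrib diff_divide_distrib algebra_simps)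
        moreover have "norm (L z) < \<delta>" using norm_L_le_aug_norm[of v] v by (simp add: bz)
        moreover have "\<epsilon> * norm (L z) \<le> \<epsilon> * aug_norm l v"
          using norm_L_le_aug_norm[of v] \<epsilon> by (intro mult_left_mono) (auto simp: bz)
        ultimately show ?thesis using \<delta>(2)[OF z] by (simp add: norm_Pair)
      qed
      then show "\<exists>\<delta>>0. \<forall>v\<in>?V. aug_norm l v < \<delta> \<longrightarrow>
        norm (F_aug l N g \<rho> w\<^sub>0 ((\<beta>, w) + v) - F_aug l N g \<rho> w\<^sub>0 (\<beta>, w) - D v) \<le> \<epsilon> * aug_norm l v"
        using \<delta>(1) by blast
    qed
  qed
  then have D: "has_fderiv_on ?V (aug_norm l) (F_aug l N g \<rho> w\<^sub>0) (\<beta>, w) D"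
    and DF: "has_fderiv_on ?V (aug_norm l) (F_aug l N g \<rho> w\<^sub>0) (\<beta>, w) (DF_aug l N g \<rho> w\<^sub>0 (\<beta>, w))"
    unfolding DF_aug_def fderiv_on_def by (auto intro: someI[where P="has_fderiv_on _ _ _ _"])
  have "DF_aug l N g \<rho> w\<^sub>0 (\<beta>, w) x = D x"
    by (rule tendsto_unique[OF _ has_fderiv_on_tendsto[OF DF subspace_aug_space x]
          has_fderiv_on_tendsto[OF D subspace_aug_space x]]) (auto simp: aug_norm_scaleR[OF x])
  then show ?thesis by (simp add: D_def)
qed

end

section \<open>The derivative in the coordinates (beta, L w)\<close>

context pattern_equation
begin

text \<open>An isometric isomorphism of the augmented space onto a closed subspace of the Hilbert
  space of pairs, where the Fredholm argument takes place.\<close>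

definition J :: "real \<times> real L2 \<Rightarrow> real \<times> real L2" where "J x = (fst x, L (snd x))"

lemma norm_J: "norm (J x) = aug_norm l x"
  by (simp add: J_def aug_norm_eq)

lemma J_add: "x \<in> aug_space l Z2Z1 \<Longrightarrow> y \<in> aug_space l Z2Z1 \<Longrightarrow> J (x + y) = J x + J y"
  and J_diff: "x \<in> aug_space l Z2Z1 \<Longrightarrow> y \<in> aug_space l Z2Z1 \<Longrightarrow> J (x - y) = J x - J y"
  and J_scaleR: "x \<in> aug_space l Z2Z1 \<Longrightarrow> J (c *\<^sub>R x) = c *\<^sub>R J x"
  by (simp_all add: J_def aug_space_iff L_add L_diff L_scaleR)

abbreviation "SZ \<equiv> UNIV \<times> L2_sym Z2Z1 :: (real \<times> real L2) set"

lemma SZ_subspace: "subspace SZ" "closed SZ"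
  by (intro subspace_Times subspace_UNIV closed_Times closed_UNIV L2_sym_Z2Z1_subspace)+

lemma J_in_SZ: "x \<in> aug_space l Z2Z1 \<Longrightarrow> J x \<in> SZ"
  by (simp add: J_def aug_space_iff L_sym)

lemma J_surj: 
  assumes "x \<in> SZ"
  obtains v where "v \<in> aug_space l Z2Z1" "J v = x"
  using assms Linv Linv_sym(1)[of "snd x"] 
  by (intro that[of "(fst x, Linv (snd x))"]) (auto simp: J_def aug_space_iff)

text \<open>In the coordinates \<open>(\<beta>, L w)\<close>, both \<open>Q(0, u)\<close> and \<open>DF(0, u)\<close> have this form.\<close>

definition bordered :: "real L2 \<Rightarrow> real L2 \<Rightarrow> real \<times> real L2 \<Rightarrow> real \<times> real L2" where
  "bordered p u x = (inner p (snd x), fst x *\<^sub>R p + snd x + DG u (Linv (snd x)))"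

lemma Q_aug_bordered:
  assumes "v \<in> aug_space l Z2Z1"
  shows "Q_aug l N g \<rho> u v = bordered (deriv_x2 u /\<^sub>R \<rho>) u (J v)"
  using assms by (simp add: Q_aug_def bordered_def J_def case_prod_beta aug_space_iff Linv_L)

lemma DF_aug_bordered:
  assumes "v \<in> aug_space l Z2Z1" "w \<in> H" "w\<^sub>0 \<in> H"
  shows "DF_aug l N g \<rho> w\<^sub>0 (\<beta>, w) v = bordered (deriv_x2 w\<^sub>0 /\<^sub>R \<rho>) w (J v)"
  unfolding DF_aug_eq[OF assms(2,1,3)] using assms
  by (simp add: bordered_def J_def aug_space_iff Linv_L inner_commute divide_inverse add_ac)

context
  fixes p u :: "real L2"
  assumes p: "p \<in> L2_sym Z2Z1" and u: "u \<in> H" "u \<in> L2_sym Z2Z1"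
begin

lemma bordered_SZ: "x \<in> SZ \<Longrightarrow> bordered p u x \<in> SZ"
  using p u Linv DG_sym(1)[OF u(1) Linv(1) u(2) Linv_sym(1)] L2_sym_Z2Z1_subspace(1)
  by (auto simp: bordered_def intro!: subspace_add subspace_scale)

lemma bordered_add: "bordered p u (x + y) = bordered p u x + bordered p u y"
  by (simp add: bordered_def Linv_add DG_linear(1)[OF u(1)] Linv inner_add_right scaleR_add_left)

lemma bordered_scaleR: "bordered p u (c *\<^sub>R x) = c *\<^sub>R bordered p u x"
  by (simp add: bordered_def Linv_scaleR DG_linear(2)[OF u(1)] Linv scaleR_add_right)

lemma bordered_bound: "\<exists>C\<ge>0. \<forall>x. norm (bordered p u x) \<le> C * norm x"
proof -
  obtain C where C: "\<And>v. v \<in> H \<Longrightarrow> norm (DG u v) \<le> C * norm (L v)" using DG_linear(3)[OF u(1)] by blast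
  have "norm (bordered p u x) \<le> (norm p + (norm p + 1 + \<bar>C\<bar>)) * norm x" for x
  proof -
    have n: "norm (snd x) \<le> norm x" "\<bar>fst x\<bar> \<le> norm x"
      using norm_snd_le[of "snd x" "fst x"] norm_fst_le[of "fst x" "snd x"] by simp_all
    have "norm (bordered p u x) \<le> \<bar>inner p (snd x)\<bar> + norm (fst x *\<^sub>R p + snd x + DG u (Linv (snd x)))"
      unfolding bordered_def by (rule order_trans[OF norm_Pair_le]) simp
    also have "\<dots> \<le> norm p * norm x + (norm x * norm p + norm x + \<bar>C\<bar> * norm x)"
    proof (intro add_mono norm_triangle_le)
      show "\<bar>inner p (snd x)\<bar> \<le> norm p * norm x"
        by (rule order_trans[OF Cauchy_Schwarz_ineq2]) (intro mult_left_mono n norm_ge_zero)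
      show "norm (fst x *\<^sub>R p) \<le> norm x * norm p"
        unfolding norm_scaleR by (intro mult_right_mono n norm_ge_zero)
      have "norm (DG u (Linv (snd x))) \<le> C * norm (snd x)" using C[OF Linv(1)] by (simp add: Linv)
      also have "\<dots> \<le> \<bar>C\<bar> * norm x" using n by (intro mult_mono) auto
      finally show "norm (DG u (Linv (snd x))) \<le> \<bar>C\<bar> * norm x" .
    qed (rule n)
    finally show ?thesis by (simp add: algebra_simps)
  qed
  then show ?thesis by (intro exI[of _ "norm p + (norm p + 1 + \<bar>C\<bar>)"]) simp
qed

end

text \<open>The border has finite rank and the rest is DG, so weak convergence of an orthonormal
  sequence suffices. The test vectors (1, 0) and (0, p) settle the border.\<close>

lemma bordered_compact:
  assumes u: "u \<in> H"
    and ortho: "\<And>m n. inner (e m) (e n :: real \<times> real L2) = (if m = n then 1 else 0)"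
  shows "(\<lambda>n. bordered p u (e n) - e n) \<longlonglongrightarrow> 0"
proof -
  have b: "(\<lambda>n. fst (e n)) \<longlonglongrightarrow> 0"
    using bessel_tendsto[OF ortho, of "(1, 0)"] by (simp add: inner_prod_def)
  have i: "(\<lambda>n. inner p (snd (e n))) \<longlonglongrightarrow> 0"
    using bessel_tendsto[OF ortho, of "(0, p)"] by (simp add: inner_prod_def)
  have D: "(\<lambda>n. DG u (Linv (snd (e n)))) \<longlonglongrightarrow> 0"
  proof (rule DG_compact[OF u])
    fix n
    have "inner (e n) (e n) = 1" using ortho by simp
    then have "norm (e n) = 1" by (simp add: norm_eq_1)
    then show "norm (snd (e n)) \<le> 1" using norm_snd_le[of "snd (e n)" "fst (e n)"] by simp
  next
    fix c
    \<comment> \<open>The kernels are complex functions on the Fourier side. By Parseval,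
      transforming the second components gives an orthonormal sequence there, to which Bessel
      applies again.\<close>
    let ?f = "\<lambda>n. (fst (e n), fourier_L2 (snd (e n)))"
    have "inner (?f m) (?f n) = (if m = n then 1 else 0)" for m n
      using ortho[of m n] by (simp add: inner_prod_def inner_fourier_L2)
    from bessel_tendsto[OF this, of "(0, c)"] show "(\<lambda>n. inner c (fourier_L2 (snd (e n)))) \<longlonglongrightarrow> 0"
      by (simp add: inner_prod_def)
  qed
  have "(\<lambda>n. (inner p (snd (e n)) - fst (e n), fst (e n) *\<^sub>R p + DG u (Linv (snd (e n))))) \<longlonglongrightarrow> (0 - 0, 0 *\<^sub>R p + 0)"
    by (intro tendsto_intros b i D)
  then show ?thesis by (simp add: bordered_def minus_prod_def zero_prod_def add.commute add.left_commute)
qed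

end

section \<open>The radii polynomial argument\<close>

locale radii_problem = pattern_equation +
  fixes j :: nat and \<rho> :: real and u\<^sub>0 w\<^sub>0 :: "real L2"
    and A :: "real \<times> real L2 \<Rightarrow> real \<times> real L2"
    and Y\<^sub>0 Y\<^sub>s Z\<^sub>1 Z\<^sub>s :: real and Z\<^sub>2 :: "real \<Rightarrow> real" and r :: real
  assumes j_ge_2: "j \<ge> 2"
    and u0_H: "u\<^sub>0 \<in> H_sym l Z2Z1"
    and w0_def: "w\<^sub>0 = rot_average j u\<^sub>0"
    and A_bounded: "bounded_linear_between (UNIV \<times> L2_sym Z2Z1) norm
                      (aug_space l Z2Z1) (aug_norm l) A"
    and nonneg: "Y\<^sub>0 \<ge> 0" "Y\<^sub>s \<ge> 0" "Z\<^sub>1 \<ge> 0" "Z\<^sub>s \<ge> 0"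
    and Z2_pos: "\<forall>s\<ge>0. Z\<^sub>2 s > 0"
    and Y0: "aug_norm l (A (0, f_aug l N g \<rho> w\<^sub>0 (0, u\<^sub>0))) \<le> Y\<^sub>0"
    and Ys: "aug_norm l (A (0, G_tilde N g j u\<^sub>0)) \<le> Y\<^sub>s"
    and Z1: "aug_onorm l (\<lambda>v. v - A (Q_aug l N g \<rho> u\<^sub>0 v)) \<le> Z\<^sub>1"
    and Zs: "aug_onorm l (\<lambda>v. A (Q_aug l N g \<rho> u\<^sub>0 v - DF_aug l N g \<rho> w\<^sub>0 (0, w\<^sub>0) v)) \<le> Z\<^sub>s"
    and Z2: "\<forall>s>0. \<forall>h\<in>H1_ball l j (0, w\<^sub>0) s.
               aug_onorm l (\<lambda>v. A (DF_aug l N g \<rho> w\<^sub>0 (0, w\<^sub>0) v - DF_aug l N g \<rho> w\<^sub>0 h v))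
                 \<le> Z\<^sub>2 s * aug_norm l (h - (0, w\<^sub>0))"
    and r_pos: "r > 0"
    and radius1: "1/2 * Z\<^sub>2 r * r\<^sup>2 - (1 - Z\<^sub>1 - Z\<^sub>s) * r + Y\<^sub>0 + Y\<^sub>s < 0"
    and radius2: "Z\<^sub>2 r * r < 1 - Z\<^sub>1 - Z\<^sub>s"
begin

abbreviation "YD \<equiv> L2_sym (dihedral j)"

definition \<kappa> :: real where "\<kappa> = 1 - Z\<^sub>1 - Z\<^sub>s"
definition \<psi> :: "real L2" where "\<psi> = deriv_x2 w\<^sub>0 /\<^sub>R \<rho>"
definition y\<^sub>0 :: "real L2" where "y\<^sub>0 = L w\<^sub>0"

lemma Z2r: "Z\<^sub>2 r > 0" using Z2_pos r_pos by simp

lemma \<kappa>_pos: "\<kappa> > 0"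
proof -
  have "0 < Z\<^sub>2 r * r" using Z2r r_pos by simp
  then show ?thesis using radius2 by (simp add: \<kappa>_def)
qed

lemma u0: "u\<^sub>0 \<in> H" "u\<^sub>0 \<in> L2_sym Z2Z1" using u0_H by (auto simp: H_sym_def)

lemma w0: "w\<^sub>0 \<in> H" "w\<^sub>0 \<in> YD" "w\<^sub>0 \<in> L2_sym Z2Z1"
proof -
  show "w\<^sub>0 \<in> H" using L_rot_average[OF u0(1)] by (simp add: w0_def)
  show "w\<^sub>0 \<in> YD" unfolding w0_def by (rule rot_average_in_dihedral[OF u0(2)]) (use j_ge_2 in simp)
  then show "w\<^sub>0 \<in> L2_sym Z2Z1" by (rule dihedral_Z2Z1)
qed

lemma y0: "y\<^sub>0 \<in> YD" "Linv y\<^sub>0 = w\<^sub>0"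
  unfolding y\<^sub>0_def using L_sym(2)[OF w0(1,2)] Linv_L[OF w0(1)] by auto

lemma \<psi>_Z2Z1: "\<psi> \<in> L2_sym Z2Z1"
  unfolding \<psi>_def by (intro subspace_scale[OF L2_sym_Z2Z1_subspace(1)] deriv_x2_Z2Z1 w0)

lemma \<psi>_u0_Z2Z1: "deriv_x2 u\<^sub>0 /\<^sub>R \<rho> \<in> L2_sym Z2Z1"
  by (intro subspace_scale[OF L2_sym_Z2Z1_subspace(1)] deriv_x2_Z2Z1 u0)

lemma \<psi>_orthogonal: "y \<in> YD \<Longrightarrow> inner \<psi> y = 0"
  using inner_deriv_x2_dihedral[OF w0(2) _ j_ge_2] by (simp add: \<psi>_def inner_commute)

lemma rot_average_\<psi>: "rot_average j \<psi> = 0"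
  using rot_average_deriv_x2[OF w0(2) j_ge_2] linear_scale[OF bounded_linear.linear[OF bounded_linear_rot_average]]
  by (simp add: \<psi>_def)

definition A' :: "real \<times> real L2 \<Rightarrow> real \<times> real L2" where "A' x = J (A x)"

lemma A_aug: "x \<in> SZ \<Longrightarrow> A x \<in> aug_space l Z2Z1"
  and A_add: "x \<in> SZ \<Longrightarrow> y \<in> SZ \<Longrightarrow> A (x + y) = A x + A y"
  and A_scaleR: "x \<in> SZ \<Longrightarrow> A (c *\<^sub>R x) = c *\<^sub>R A x"
  using A_bounded unfolding bounded_linear_between_def by blast+

lemma A'_add: "x \<in> SZ \<Longrightarrow> y \<in> SZ \<Longrightarrow> A' (x + y) = A' x + A' y"
  by (simp only: A'_def A_add J_add A_aug)

lemma A'_scaleR: "x \<in> SZ \<Longrightarrow> A' (c *\<^sub>R x) = c *\<^sub>R A' x"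
  by (simp only: A'_def A_scaleR J_scaleR A_aug)

lemma A'_diff: "x \<in> SZ \<Longrightarrow> y \<in> SZ \<Longrightarrow> A' (x - y) = A' x - A' y"
  using A'_add[of x "(-1) *\<^sub>R y"] A'_scaleR[of y "-1"] subspace_scale[OF SZ_subspace(1), of y "-1"] by simp

lemma A'_bound: "\<exists>a>0. \<forall>x\<in>SZ. norm (A' x) \<le> a * norm x"
proof -
  obtain a where a: "\<And>x. x \<in> SZ \<Longrightarrow> aug_norm l (A x) \<le> a * norm x"
    using A_bounded unfolding bounded_linear_between_def by blast
  have "norm (A' x) \<le> (\<bar>a\<bar> + 1) * norm x" if "x \<in> SZ" for x
  proof -
    have "a * norm x \<le> (\<bar>a\<bar> + 1) * norm x" by (intro mult_right_mono) auto
    then show ?thesis using a[OF that] by (simp add: A'_def norm_J)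
  qed
  then show ?thesis by (intro exI[of _ "\<bar>a\<bar> + 1"]) auto
qed

text \<open>Only certifies finiteness: it makes suprema meaningful, \<open>A\<close> continuous and
  the lower bound of T positive. The radius conditions never see it.\<close>

definition A_const :: real where "A_const = (SOME c. c > 0 \<and> (\<forall>x\<in>SZ. norm (A' x) \<le> c * norm x))"

lemma A_const_pos: "A_const > 0" and A'_le: "x \<in> SZ \<Longrightarrow> norm (A' x) \<le> A_const * norm x"
  using someI_ex[OF A'_bound[unfolded Bex_def[symmetric]], folded A_const_def] by auto

abbreviation "T \<equiv> bordered \<psi> w\<^sub>0"

lemmas T_SZ = bordered_SZ[OF \<psi>_Z2Z1 w0(1,3)]

lemma aug_onorm_le:
  assumes b: "\<And>v. v \<in> aug_space l Z2Z1 \<Longrightarrow> aug_norm l (S v) \<le> C * aug_norm l v"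
    and Z: "aug_onorm l S \<le> Z" and v: "v \<in> aug_space l Z2Z1"
  shows "aug_norm l (S v) \<le> Z * aug_norm l v"
proof -
  have nn: "0 \<le> aug_norm l v" for v by (simp add: norm_J[symmetric])
  have "aug_norm l (S v) \<le> aug_onorm l S * aug_norm l v"
    unfolding aug_onorm_def by (rule onorm_on_bound[where V="aug_space l Z2Z1" and nW="aug_norm l" and nV="aug_norm l" and T=S and C=C, OF b nn v])
  also have "\<dots> \<le> Z * aug_norm l v" using Z nn by (rule mult_right_mono)
  finally show ?thesis .
qed

text \<open>Turns an operator-norm hypothesis on a difference of two derivatives into a vector
  estimate in the coordinates of \<open>J\<close>. The operator \<open>S\<close> is left abstract so
  that both the Z_s and the Z_2 bound fit.\<close>

lemma A_difference_estimate:
  assumes u: "u \<in> H" "u \<in> L2_sym Z2Z1" and p: "p \<in> L2_sym Z2Z1"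
    and v: "v \<in> H" "v \<in> L2_sym Z2Z1" and q: "q \<in> L2_sym Z2Z1"
    and S: "\<And>z. z \<in> aug_space l Z2Z1 \<Longrightarrow> S z = A (bordered p u (J z) - bordered q v (J z))"
    and Z: "aug_onorm l S \<le> Z" and x: "x \<in> SZ"
  shows "norm (A' (bordered p u x - bordered q v x)) \<le> Z * norm x"
proof -
  obtain C D where C: "\<And>x. norm (bordered p u x) \<le> C * norm x" and D: "\<And>x. norm (bordered q v x) \<le> D * norm x"
    using bordered_bound[OF p u] bordered_bound[OF q v] by blast
  have inSZ: "bordered p u (J z) - bordered q v (J z) \<in> SZ" if "z \<in> aug_space l Z2Z1" for z
    by (intro subspace_diff[OF SZ_subspace(1)] bordered_SZ p u q v J_in_SZ that)
  obtain z where z: "z \<in> aug_space l Z2Z1" "J z = x" using J_surj[OF x] .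
  have "aug_norm l (S z) \<le> Z * aug_norm l z"
  proof (rule aug_onorm_le[OF _ Z z(1)])
    fix z assume z: "z \<in> aug_space l Z2Z1"
    have "aug_norm l (S z) \<le> A_const * norm (bordered p u (J z) - bordered q v (J z))"
      using A'_le[OF inSZ[OF z]] by (simp add: S[OF z] A'_def norm_J)
    also have "\<dots> \<le> A_const * (C * norm (J z) + D * norm (J z))"
      using A_const_pos C D by (intro mult_left_mono order_trans[OF norm_triangle_ineq4] add_mono) auto
    finally show "aug_norm l (S z) \<le> (A_const * (C + D)) * aug_norm l z" by (simp add: norm_J algebra_simps)
  qed
  then show ?thesis using S[OF z(1)] z(2) by (simp add: A'_def norm_J[symmetric])
qed

text \<open>Write x as (x - A Q x) + A (Q x - T x) + A T x. The first two terms are at most (Z_1 +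
  Z_s) |x|, which leaves \<kappa> |x| for the last.\<close>

lemma T_lower:
  assumes x: "x \<in> SZ"
  shows "\<kappa> * norm x \<le> norm (A' (T x))"
proof -
  let ?q = "deriv_x2 u\<^sub>0 /\<^sub>R \<rho>"
  let ?Q = "bordered ?q u\<^sub>0"
  note QSZ = bordered_SZ[OF \<psi>_u0_Z2Z1 u0]
  obtain C where C: "\<And>x. norm (?Q x) \<le> C * norm x" using bordered_bound[OF \<psi>_u0_Z2Z1 u0] by blast
  obtain z where z: "z \<in> aug_space l Z2Z1" "J z = x" using J_surj[OF x] .
  have Jm: "J (v - A (Q_aug l N g \<rho> u\<^sub>0 v)) = J v - A' (?Q (J v))" if "v \<in> aug_space l Z2Z1" for v
    by (simp only: Q_aug_bordered[OF that] A'_def J_diff[OF that A_aug] QSZ J_in_SZ that)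
  have "aug_norm l (z - A (Q_aug l N g \<rho> u\<^sub>0 z)) \<le> Z\<^sub>1 * aug_norm l z"
  proof (rule aug_onorm_le[OF _ Z1 z(1)])
    fix v assume v: "v \<in> aug_space l Z2Z1"
    have "norm (J v - A' (?Q (J v))) \<le> norm (J v) + A_const * norm (?Q (J v))"
      by (intro order_trans[OF norm_triangle_ineq4] add_left_mono A'_le QSZ J_in_SZ v)
    also have "\<dots> \<le> norm (J v) + A_const * (C * norm (J v))"
      using C A_const_pos by (intro add_left_mono mult_left_mono) auto
    finally show "aug_norm l (v - A (Q_aug l N g \<rho> u\<^sub>0 v)) \<le> (1 + A_const * C) * aug_norm l v"
      by (simp add: norm_J[symmetric] Jm[OF v] algebra_simps)
  qed
  then have 1: "norm (x - A' (?Q x)) \<le> Z\<^sub>1 * norm x"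
    by (simp add: norm_J[symmetric] Jm[OF z(1)] z(2))
  have 2: "norm (A' (?Q x - T x)) \<le> Z\<^sub>s * norm x"
  proof (rule A_difference_estimate[OF u0 \<psi>_u0_Z2Z1 w0(1,3) \<psi>_Z2Z1 _ Zs x])
    fix z assume "z \<in> aug_space l Z2Z1"
    then show "A (Q_aug l N g \<rho> u\<^sub>0 z - DF_aug l N g \<rho> w\<^sub>0 (0, w\<^sub>0) z) = A (?Q (J z) - T (J z))"
      by (simp add: Q_aug_bordered DF_aug_bordered w0 \<psi>_def)
  qed
  have eq: "x - A' (?Q x) + A' (?Q x - T x) + A' (T x) = x"
    using A'_diff[OF QSZ[OF x] T_SZ[OF x]] by simp
  have "norm (x - A' (?Q x) + A' (?Q x - T x) + A' (T x))
      \<le> norm (x - A' (?Q x)) + norm (A' (?Q x - T x)) + norm (A' (T x))"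
    by (rule order_trans[OF norm_triangle_ineq add_right_mono[OF norm_triangle_ineq]])
  then have "norm x \<le> norm (x - A' (?Q x)) + norm (A' (?Q x - T x)) + norm (A' (T x))"
    unfolding eq .
  then show ?thesis using 1 2 by (simp add: \<kappa>_def algebra_simps)
qed

lemma T_surj: "T ` SZ = SZ"
proof -
  obtain C where C: "\<And>x. norm (T x) \<le> C * norm x" using bordered_bound[OF \<psi>_Z2Z1 w0(1,3)] by blast
  show ?thesis
  proof (rule compact_perturbation_surj[OF SZ_subspace])
    \<comment> \<open>Dividing by the bound for \<open>A'\<close> spoils the constant, but
      surjectivity only asks that it be positive.\<close>
    show "\<kappa> / A_const > 0" using \<kappa>_pos A_const_pos by simp
    fix x assume x: "x \<in> SZ"
    have "\<kappa> * norm x \<le> A_const * norm (T x)" using T_lower[OF x] A'_le[OF T_SZ[OF x]] by simp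
    then show "\<kappa> / A_const * norm x \<le> norm (T x)" using A_const_pos by (simp add: field_simps)
  next
    fix e :: "nat \<Rightarrow> real \<times> real L2"
    assume "\<And>m n. inner (e m) (e n) = (if m = n then 1 else 0)"
    then show "(\<lambda>n. T (e n) - e n) \<longlonglongrightarrow> 0" by (rule bordered_compact[OF w0(1)])
  qed (use T_SZ C bordered_add[OF \<psi>_Z2Z1 w0(1,3)] bordered_scaleR[OF \<psi>_Z2Z1 w0(1,3)] in auto)
qed

definition M :: "real L2 \<Rightarrow> real L2" where "M y = y + DG w\<^sub>0 (Linv y)"

text \<open>The border row vanishes because \<open>\<psi>\<close> is orthogonal to symmetric
  functions, so on them T reduces to L + DG(w0) in the coordinate y.\<close>

lemma T_YD: "y \<in> YD \<Longrightarrow> T (0, y) = (0, M y)"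
  by (simp add: bordered_def \<psi>_orthogonal M_def)

lemma SZ_0: "\<eta> \<in> L2_sym Z2Z1 \<Longrightarrow> (0, \<eta>) \<in> SZ" by simp

lemma M_lower: "y \<in> YD \<Longrightarrow> \<kappa> * norm y \<le> norm (A' (0, M y))"
  using T_lower[of "(0, y)"] dihedral_Z2Z1[of y] by (simp add: T_YD norm_Pair)

lemma M_diff: "M (x - y) = M x - M y"
proof -
  have "DG w\<^sub>0 (Linv x - Linv y) = DG w\<^sub>0 (Linv x) - DG w\<^sub>0 (Linv y)"
    using DG_linear(1)[OF w0(1) Linv(1)[of x], of "(-1) *\<^sub>R Linv y"] DG_linear(2)[OF w0(1) Linv(1)[of y], of "-1"]
      subspace_scale[OF subspace_H Linv(1)[of y], of "-1"] by simp
  then show ?thesis by (simp add: M_def Linv_diff)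
qed

text \<open>\<open>T\<close> commutes with the symmetrization, so its inverse is block diagonal and symmetrizing the
  right-hand side only decreases the norm of the solution.\<close>

lemma M_solve:
  assumes \<eta>: "\<eta> \<in> L2_sym Z2Z1"
  shows "\<exists>y\<in>YD. M y = rot_average j \<eta> \<and> \<kappa> * norm y \<le> norm (A' (0, \<eta>))"
proof -
  interpret P: bounded_linear "rot_average j" by (rule bounded_linear_rot_average)
  have "(0, \<eta>) \<in> T ` SZ" using \<eta> T_surj by simp
  then obtain x where x: "x \<in> SZ" "T x = (0, \<eta>)" by auto
  let ?y = "rot_average j (snd x)"
  have y: "?y \<in> YD" using x(1) j_ge_2 by (intro rot_average_in_dihedral) auto
  have "\<eta> = fst x *\<^sub>R \<psi> + snd x + DG w\<^sub>0 (Linv (snd x))" using x(2) by (simp add: bordered_def)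
  then have "rot_average j \<eta> = M ?y"
    by (simp add: P.add P.scaleR rot_average_\<psi> M_def Linv_rot_average DG_rot_average[OF w0(1,2) Linv(1)])
  moreover have "\<kappa> * norm ?y \<le> norm (A' (0, \<eta>))"
  proof -
    have "norm ?y \<le> norm (snd x)" by (rule norm_rot_average_le)
    also have "\<dots> \<le> norm x" using norm_snd_le[of "snd x" "fst x"] by simp
    finally have "\<kappa> * norm ?y \<le> \<kappa> * norm x" using \<kappa>_pos by simp
    then show ?thesis using T_lower[OF x(1)] x(2) by simp
  qed
  ultimately show ?thesis using y by metis
qed

definition B :: "real L2 \<Rightarrow> real L2" where "B \<eta> = (SOME y. y \<in> YD \<and> M y = \<eta>)"

text \<open>A symmetric right-hand side is its own average, so the symmetrized equation is the
  equation itself. The last bound lets the true inverse replace \<open>A\<close> in every estimate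
  at the price of the factor 1/\<kappa>.\<close>

lemma B: 
  assumes \<eta>: "\<eta> \<in> YD"
  shows "B \<eta> \<in> YD" "M (B \<eta>) = \<eta>" "\<kappa> * norm (B \<eta>) \<le> norm (A' (0, \<eta>))"
proof -
  have "\<exists>y. y \<in> YD \<and> M y = \<eta>"
  proof -
    obtain y where "y \<in> YD" "M y = rot_average j \<eta>" using M_solve[OF dihedral_Z2Z1[OF \<eta>]] by blast
    moreover have "rot_average j \<eta> = \<eta>" by (rule rot_average_dihedral[OF \<eta>]) (use j_ge_2 in simp)
    ultimately show ?thesis by metis
  qed
  then have "B \<eta> \<in> YD \<and> M (B \<eta>) = \<eta>" unfolding B_def by (rule someI_ex)
  then show "B \<eta> \<in> YD" "M (B \<eta>) = \<eta>" "\<kappa> * norm (B \<eta>) \<le> norm (A' (0, \<eta>))"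
    using M_lower[of "B \<eta>"] by auto
qed

lemma M_inj:
  assumes "x \<in> YD" "y \<in> YD" "M x = M y"
  shows "x = y"
proof -
  have "A' (0, 0) = 0" using A'_scaleR[of "(0, 0)" 0] subspace_0[OF L2_sym_Z2Z1_subspace(1)] by (simp add: zero_prod_def)
  then have "\<kappa> * norm (x - y) \<le> 0"
    using M_lower[of "x - y"] assms subspace_diff[OF L2_sym_dihedral_subspace(1), of x j y] by (simp add: M_diff)
  then have "norm (x - y) \<le> 0" using \<kappa>_pos by (simp add: mult_le_0_iff)
  then show ?thesis by simp
qed

end

section \<open>Contraction of the Newton map\<close>

context radii_problem
begin

definition \<Phi> :: "real L2 \<Rightarrow> real L2" where "\<Phi> y = y + G (Linv y)"

lemma \<Phi>_YD: "y \<in> YD \<Longrightarrow> \<Phi> y \<in> YD"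
  unfolding \<Phi>_def
  by (intro subspace_add[OF L2_sym_dihedral_subspace(1)] G_sym(2) Linv Linv_sym(2))

text \<open>Nothing is known about \<open>A\<close> outside the symmetric functions; symmetrizing the argument makes it
  bounded linear on all of \<open>L\<^sup>2\<close>.\<close>

definition A2 :: "real L2 \<Rightarrow> real \<times> real L2" where
  "A2 \<eta> = A' (0, (1/2) *\<^sub>R (\<eta> + pullback refl_x1 \<eta>))"

lemma A2_eq: "\<eta> \<in> L2_sym Z2Z1 \<Longrightarrow> A2 \<eta> = A' (0, \<eta>)"
  by (simp add: A2_def Z2Z1_iff flip: scaleR_2)

lemma symmetrized: "(0, (1/2) *\<^sub>R (\<eta> + pullback refl_x1 \<eta>)) \<in> SZ"
proof -
  interpret bounded_linear "pullback refl_x1" by (rule bounded_linear_pullback[OF orthogonal_transformation_refl])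
  have "pullback refl_x1 (pullback refl_x1 \<eta>) = \<eta>"
    by (subst pullback_pullback) (auto simp: orthogonal_transformation_refl o_def refl_refl pullback_id)
  then show ?thesis by (simp add: Z2Z1_iff add scaleR add.commute)
qed

lemma bounded_linear_A2: "bounded_linear A2"
proof (rule bounded_linear_intro)
  interpret bounded_linear "pullback refl_x1" by (rule bounded_linear_pullback[OF orthogonal_transformation_refl])
  fix x y :: "real L2" and c :: real
  have "(0, (1/2) *\<^sub>R ((x + y) + pullback refl_x1 (x + y)))
      = (0::real, (1/2) *\<^sub>R (x + pullback refl_x1 x)) + (0, (1/2) *\<^sub>R (y + pullback refl_x1 y))"
    by (simp add: add scaleR_add_right)
  then show "A2 (x + y) = A2 x + A2 y"
    unfolding A2_def by (simp only: A'_add[OF symmetrized symmetrized])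
  have "(0, (1/2) *\<^sub>R (c *\<^sub>R x + pullback refl_x1 (c *\<^sub>R x))) = c *\<^sub>R (0::real, (1/2) *\<^sub>R (x + pullback refl_x1 x))"
    by (simp add: scaleR scaleR_add_right)
  then show "A2 (c *\<^sub>R x) = c *\<^sub>R A2 x"
    unfolding A2_def by (simp only: A'_scaleR[OF symmetrized])
  have "norm (x + pullback refl_x1 x) \<le> norm x + norm x"
    using norm_triangle_ineq[of x "pullback refl_x1 x"] by (simp add: norm_pullback orthogonal_transformation_refl)
  then have "norm (0::real, (1/2) *\<^sub>R (x + pullback refl_x1 x)) \<le> norm x" by (simp add: norm_Pair)
  then have "A_const * norm (0::real, (1/2) *\<^sub>R (x + pullback refl_x1 x)) \<le> A_const * norm x" using A_const_pos by simp
  then show "norm (A2 x) \<le> norm x * A_const"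
    unfolding A2_def using A'_le[OF symmetrized[of x]] by (simp add: mult.commute)
qed

text \<open>The border comes from w0 and not from the base point, so it cancels in the difference of
  the two derivatives and only the difference of the DG terms is left.\<close>

lemma Z2_estimate:
  assumes y: "y \<in> YD" "norm (y - y\<^sub>0) < r" and z: "z \<in> YD"
  shows "norm (A2 (DG w\<^sub>0 (Linv z) - DG (Linv y) (Linv z))) \<le> Z\<^sub>2 r * norm (y - y\<^sub>0) * norm z"
proof -
  let ?w = "Linv y"
  have w: "?w \<in> H" "?w \<in> YD" "?w \<in> L2_sym Z2Z1"
    using Linv(1)[of y] Linv_sym(2)[OF y(1)] dihedral_Z2Z1[OF Linv_sym(2)[OF y(1)]] by simp_all
  have zZ: "z \<in> L2_sym Z2Z1" using z by (rule dihedral_Z2Z1)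
  have n: "aug_norm l ((0, ?w) - (0, w\<^sub>0)) = norm (y - y\<^sub>0)"
    by (simp add: aug_norm_eq L_diff w w0 Linv y\<^sub>0_def norm_Pair)
  have ball: "(0, ?w) \<in> H1_ball l j (0, w\<^sub>0) r"
    unfolding H1_ball_def using w y(2) n by (simp add: aug_space_def H_sym_def)
  have Z: "aug_onorm l (\<lambda>v. A (DF_aug l N g \<rho> w\<^sub>0 (0, w\<^sub>0) v - DF_aug l N g \<rho> w\<^sub>0 (0, ?w) v)) \<le> Z\<^sub>2 r * norm (y - y\<^sub>0)"
    using Z2[rule_format, OF r_pos ball] unfolding n .
  have "norm (A' (T (0, z) - bordered \<psi> ?w (0, z))) \<le> Z\<^sub>2 r * norm (y - y\<^sub>0) * norm (0 :: real, z)"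
  proof (rule A_difference_estimate[OF w0(1,3) \<psi>_Z2Z1 w(1,3) \<psi>_Z2Z1 _ Z SZ_0[OF zZ]])
    fix x assume "x \<in> aug_space l Z2Z1"
    then show "A (DF_aug l N g \<rho> w\<^sub>0 (0, w\<^sub>0) x - DF_aug l N g \<rho> w\<^sub>0 (0, ?w) x) = A (T (J x) - bordered \<psi> ?w (J x))"
      by (simp add: DF_aug_bordered w0 w \<psi>_def)
  qed
  moreover have "T (0, z) - bordered \<psi> ?w (0, z) = (0, DG w\<^sub>0 (Linv z) - DG ?w (Linv z))"
    by (simp add: bordered_def)
  moreover have "DG w\<^sub>0 (Linv z) - DG ?w (Linv z) \<in> L2_sym Z2Z1"
    by (intro subspace_diff[OF L2_sym_Z2Z1_subspace(1)] DG_sym(1) w w0 Linv Linv_sym(1) zZ)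
  ultimately show ?thesis by (simp add: A2_eq norm_Pair)
qed

text \<open>The path records the deviation of G from its linearization at w0; its derivative is the
  very difference that the Z_2 bound controls.\<close>

lemma path_derivative:
  "((\<lambda>t. t *\<^sub>R DG w\<^sub>0 (Linv z) - G (Linv (y + t *\<^sub>R z))) has_vector_derivative
    DG w\<^sub>0 (Linv z) - DG (Linv (y + t *\<^sub>R z)) (Linv z)) (at t)"
proof -
  have e: "Linv (y + (t + s) *\<^sub>R z) = Linv (y + t *\<^sub>R z) + s *\<^sub>R Linv z" for s
    by (simp add: Linv_add Linv_scaleR scaleR_add_left add.assoc)
  have "((\<lambda>t. G (Linv (y + t *\<^sub>R z))) has_vector_derivative DG (Linv (y + t *\<^sub>R z)) (Linv z)) (at t)"
    by (rule has_vector_derivative_difference_quotient) (unfold e, rule DG_tendsto[OF Linv(1) Linv(1)])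
  moreover have "((\<lambda>t. t *\<^sub>R DG w\<^sub>0 (Linv z)) has_vector_derivative DG w\<^sub>0 (Linv z)) (at t)"
    using has_vector_derivative_scaleR[OF DERIV_ident has_vector_derivative_const] by simp
  ultimately show ?thesis by (rule has_vector_derivative_diff[rotated])
qed

text \<open>Mean value inequality with a comparison function \<phi>. Membership in the ball is asked
  only for 0 < t < 1, since the Z_2 bound speaks of the open ball while an endpoint may lie on the
  sphere.\<close>

lemma path_estimate:
  assumes x: "x \<in> YD" and y: "y \<in> YD"
    and inside: "\<And>t. 0 < t \<Longrightarrow> t < 1 \<Longrightarrow> norm (y + t *\<^sub>R (x - y) - y\<^sub>0) < r"
    and \<phi>: "\<And>t. (\<phi> has_real_derivative \<phi>' t) (at t)"
    and le: "\<And>t. 0 < t \<Longrightarrow> t < 1 \<Longrightarrow> Z\<^sub>2 r * norm (y + t *\<^sub>R (x - y) - y\<^sub>0) * norm (x - y) \<le> \<phi>' t"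
  shows "norm (A' (0, M (x - y) - (\<Phi> x - \<Phi> y))) \<le> \<phi> 1 - \<phi> 0"
proof -
  let ?z = "x - y"
  let ?\<gamma> = "\<lambda>t. t *\<^sub>R DG w\<^sub>0 (Linv ?z) - G (Linv (y + t *\<^sub>R ?z))"
  let ?\<gamma>' = "\<lambda>t. DG w\<^sub>0 (Linv ?z) - DG (Linv (y + t *\<^sub>R ?z)) (Linv ?z)"
  interpret A2: bounded_linear A2 by (rule bounded_linear_A2)
  have z: "?z \<in> YD" by (intro subspace_diff[OF L2_sym_dihedral_subspace(1)] x y)
  have yt: "y + t *\<^sub>R ?z \<in> YD" for t
    by (intro subspace_add[OF L2_sym_dihedral_subspace(1)] subspace_scale[OF L2_sym_dihedral_subspace(1)] y z)
  have d: "((\<lambda>t. A2 (?\<gamma> t)) has_vector_derivative A2 (?\<gamma>' t)) (at t)" for t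
    by (rule A2.has_vector_derivative[OF path_derivative])
  have "norm (A2 (?\<gamma> 1) - A2 (?\<gamma> 0)) \<le> \<phi> 1 - \<phi> 0"
  proof (rule differentiable_bound_general[where f'="\<lambda>t. A2 (?\<gamma>' t)" and \<phi>'=\<phi>'])
    show "continuous_on {0..1} (\<lambda>t. A2 (?\<gamma> t))"
      by (intro continuous_at_imp_continuous_on ballI has_vector_derivative_continuous[OF d])
    show "continuous_on {0..1} \<phi>"
      by (intro continuous_at_imp_continuous_on ballI DERIV_isCont[OF \<phi>])
    show "(\<phi> has_vector_derivative \<phi>' t) (at t)" for t
      using \<phi> by (simp add: has_real_derivative_iff_has_vector_derivative)
    show "norm (A2 (?\<gamma>' t)) \<le> \<phi>' t" if "0 < t" "t < 1" for t
      by (rule order_trans[OF Z2_estimate[OF yt inside[OF that] z] le[OF that]])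
  qed (use d in auto)
  \<comment> \<open>The linear parts of \<open>M\<close> and \<open>\<Phi>\<close> are both the
    identity and cancel.\<close>
  moreover have "?\<gamma> 1 - ?\<gamma> 0 = M ?z - (\<Phi> x - \<Phi> y)"
    by (simp add: M_def \<Phi>_def)
  moreover have "M ?z - (\<Phi> x - \<Phi> y) \<in> L2_sym Z2Z1"
  proof -
    have "M ?z \<in> YD" unfolding M_def
      by (intro subspace_add[OF L2_sym_dihedral_subspace(1)] z DG_sym(2) w0 Linv Linv_sym(2))
    then have "M ?z - (\<Phi> x - \<Phi> y) \<in> YD"
      by (intro subspace_diff[OF L2_sym_dihedral_subspace(1)] \<Phi>_YD x y)
    then show ?thesis by (rule dihedral_Z2Z1)
  qed
  ultimately show ?thesis by (simp add: A2.diff[symmetric] A2_eq)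
qed

text \<open>One point may lie on the sphere as long as the other is inside: by convexity the open
  segment stays in the open ball. Uniqueness in the closed ball relies on this asymmetry.\<close>

lemma lipschitz_estimate:
  assumes x: "x \<in> YD" "norm (x - y\<^sub>0) \<le> r" and y: "y \<in> YD" "norm (y - y\<^sub>0) < r"
  shows "norm (A' (0, M (x - y) - (\<Phi> x - \<Phi> y))) \<le> Z\<^sub>2 r * r * norm (x - y)"
proof -
  have inside: "norm (y + t *\<^sub>R (x - y) - y\<^sub>0) < r" if t: "0 < t" "t < 1" for t
  proof -
    have "y + t *\<^sub>R (x - y) - y\<^sub>0 = (1 - t) *\<^sub>R (y - y\<^sub>0) + t *\<^sub>R (x - y\<^sub>0)"
      by (simp add: scaleR_diff_left scaleR_diff_right)
    then have "norm (y + t *\<^sub>R (x - y) - y\<^sub>0) \<le> (1 - t) * norm (y - y\<^sub>0) + t * norm (x - y\<^sub>0)"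
      using norm_triangle_ineq[of "(1 - t) *\<^sub>R (y - y\<^sub>0)" "t *\<^sub>R (x - y\<^sub>0)"] t by simp
    also have "\<dots> < (1 - t) * r + t * r"
      using t x y by (intro add_less_le_mono mult_strict_left_mono mult_left_mono) auto
    finally show ?thesis by (simp add: algebra_simps)
  qed
  have "norm (A' (0, M (x - y) - (\<Phi> x - \<Phi> y))) \<le> Z\<^sub>2 r * r * norm (x - y) * 1 - Z\<^sub>2 r * r * norm (x - y) * 0"
  proof (rule path_estimate[OF x(1) y(1) inside, where \<phi>="\<lambda>t. Z\<^sub>2 r * r * norm (x - y) * t" and \<phi>'="\<lambda>_. Z\<^sub>2 r * r * norm (x - y)"])
    show "((\<lambda>t. Z\<^sub>2 r * r * norm (x - y) * t) has_real_derivative Z\<^sub>2 r * r * norm (x - y)) (at t)" for t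
      by (auto intro!: derivative_eq_intros)
    fix t :: real assume "0 < t" "t < 1"
    then show "Z\<^sub>2 r * norm (y + t *\<^sub>R (x - y) - y\<^sub>0) * norm (x - y) \<le> Z\<^sub>2 r * r * norm (x - y)"
      using inside[of t] Z2r by (intro mult_right_mono mult_left_mono) auto
  qed
  then show ?thesis by simp
qed

text \<open>Starting at the centre, the distance to it grows like t along the segment; comparison
  with t^2/2 produces the factor 1/2 of the radii polynomial.\<close>

lemma quadratic_estimate:
  assumes x: "x \<in> YD" "norm (x - y\<^sub>0) \<le> r"
  shows "norm (A' (0, M (x - y\<^sub>0) - (\<Phi> x - \<Phi> y\<^sub>0))) \<le> 1/2 * Z\<^sub>2 r * r\<^sup>2"
proof -
  let ?c = "Z\<^sub>2 r * (norm (x - y\<^sub>0))\<^sup>2"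
  have inside: "norm (y\<^sub>0 + t *\<^sub>R (x - y\<^sub>0) - y\<^sub>0) < r" if t: "0 < t" "t < 1" for t
  proof -
    have "t * norm (x - y\<^sub>0) \<le> t * r" by (intro mult_left_mono x(2)) (use t in simp)
    also have "\<dots> < r" using mult_strict_right_mono[OF t(2) r_pos] by simp
    finally have "norm (t *\<^sub>R (x - y\<^sub>0)) < r" using t by simp
    moreover have "y\<^sub>0 + t *\<^sub>R (x - y\<^sub>0) - y\<^sub>0 = t *\<^sub>R (x - y\<^sub>0)" by simp
    ultimately show ?thesis by (simp only:)
  qed
  have "norm (A' (0, M (x - y\<^sub>0) - (\<Phi> x - \<Phi> y\<^sub>0))) \<le> ?c * (1\<^sup>2 / 2) - ?c * (0\<^sup>2 / 2)"
  proof (rule path_estimate[OF x(1) y0(1) inside, where \<phi>="\<lambda>t. ?c * (t\<^sup>2 / 2)" and \<phi>'="\<lambda>t. ?c * t"])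
    show "((\<lambda>t. ?c * (t\<^sup>2 / 2)) has_real_derivative ?c * t) (at t)" for t
      by (auto intro!: derivative_eq_intros)
  qed (auto simp: power2_eq_square)
  also have "\<dots> \<le> 1/2 * Z\<^sub>2 r * r\<^sup>2"
    using x Z2r by (simp add: power_mono)
  finally show ?thesis .
qed

text \<open>The residual at w0 is the average of the residual at u0 plus \<open>G_tilde\<close>. The
  residual at u0 is symmetric under the reflection only, so \<open>M_solve\<close> handles its
  average without loss and gives Y_0; \<open>G_tilde\<close> is dihedrally symmetric and
  \<open>B\<close> gives Y_s.\<close>

lemma residual_estimate: "\<kappa> * norm (B (\<Phi> y\<^sub>0)) \<le> Y\<^sub>0 + Y\<^sub>s"
proof -
  interpret P: bounded_linear "rot_average j" by (rule bounded_linear_rot_average)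
  let ?f = "L u\<^sub>0 + G u\<^sub>0" and ?g = "G_tilde N g j u\<^sub>0"
  have f: "?f \<in> L2_sym Z2Z1"
    by (intro subspace_add[OF L2_sym_Z2Z1_subspace(1)] L_sym(1) G_sym(1) u0)
  have Gu: "rot_average j (G u\<^sub>0) \<in> YD"
    by (rule rot_average_in_dihedral[OF G_sym(1)[OF u0]]) (use j_ge_2 in simp)
  have g: "?g \<in> YD"
    unfolding G_tilde_def w0_def[symmetric]
    by (intro subspace_diff[OF L2_sym_dihedral_subspace(1)] G_sym(2) w0 Gu)
  obtain y where y: "y \<in> YD" "M y = rot_average j ?f" "\<kappa> * norm y \<le> norm (A' (0, ?f))"
    using M_solve[OF f] by blast
  have "L w\<^sub>0 = rot_average j (L u\<^sub>0)" using L_rot_average[OF u0(1)] by (simp add: w0_def)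
  moreover have "\<Phi> y\<^sub>0 = L w\<^sub>0 + G w\<^sub>0"
    unfolding \<Phi>_def y0(2) unfolding y\<^sub>0_def ..
  ultimately have split: "\<Phi> y\<^sub>0 = rot_average j ?f + ?g"
    by (simp add: G_tilde_def w0_def[symmetric] P.add)
  have "M (y + B ?g) = M y + M (B ?g)"
    using M_diff[of y "0 - B ?g"] M_diff[of 0 "B ?g"] M_diff[of 0 0] by simp
  then have "M (B (\<Phi> y\<^sub>0)) = M (y + B ?g)"
    using B(2)[OF \<Phi>_YD[OF y0(1)]] B(2)[OF g] y(2) split by simp
  then have "B (\<Phi> y\<^sub>0) = y + B ?g"
    by (rule M_inj[rotated 2])
      (intro B \<Phi>_YD y0 g y subspace_add[OF L2_sym_dihedral_subspace(1)])+
  then have "\<kappa> * norm (B (\<Phi> y\<^sub>0)) \<le> \<kappa> * (norm y + norm (B ?g))"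
    using \<kappa>_pos by (simp add: norm_triangle_ineq)
  also have "\<dots> \<le> norm (A' (0, ?f)) + norm (A' (0, ?g))"
    using y(3) B(3)[OF g] by (simp add: distrib_left)
  also have "\<dots> \<le> Y\<^sub>0 + Y\<^sub>s"
    using Y0 Ys by (simp add: A'_def norm_J f_aug_def)
  finally show ?thesis .
qed

definition newton :: "real L2 \<Rightarrow> real L2" where "newton y = y - B (\<Phi> y)"

lemma newton_YD: "y \<in> YD \<Longrightarrow> newton y \<in> YD"
  unfolding newton_def by (intro subspace_diff[OF L2_sym_dihedral_subspace(1)] B \<Phi>_YD)

text \<open>Applying \<open>M\<close> removes the inverse from both Newton steps, leaving the
  deviation of \<open>\<Phi>\<close> from its linearization; the lower bound for \<open>M\<close>
  then returns to the norm.\<close>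

lemma newton_diff:
  assumes x: "x \<in> YD" and y: "y \<in> YD"
  shows "\<kappa> * norm (newton x - newton y) \<le> norm (A' (0, M (x - y) - (\<Phi> x - \<Phi> y)))"
proof -
  have "M (newton x - newton y) = M (x - y) - (\<Phi> x - \<Phi> y)"
    unfolding newton_def M_diff B(2)[OF \<Phi>_YD[OF x]] B(2)[OF \<Phi>_YD[OF y]] by simp
  moreover have "newton x - newton y \<in> YD"
    by (intro subspace_diff[OF L2_sym_dihedral_subspace(1)] newton_YD x y)
  ultimately show ?thesis using M_lower by metis
qed

lemma newton_fixed_iff:
  assumes y: "y \<in> YD"
  shows "newton y = y \<longleftrightarrow> \<Phi> y = 0"
proof -
  have z: "0 \<in> YD" by (rule subspace_0[OF L2_sym_dihedral_subspace(1)])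
  have M0: "M 0 = 0" using M_diff[of 0 0] by simp
  have "B (\<Phi> y) = 0 \<longleftrightarrow> \<Phi> y = 0"
  proof
    assume "B (\<Phi> y) = 0"
    then show "\<Phi> y = 0" using B(2)[OF \<Phi>_YD[OF y]] M0 by simp
  next
    assume "\<Phi> y = 0"
    then have "M (B (\<Phi> y)) = M 0" using B(2)[OF \<Phi>_YD[OF y]] M0 by simp
    then show "B (\<Phi> y) = 0" by (rule M_inj[OF B(1)[OF \<Phi>_YD[OF y]] z])
  qed
  then show ?thesis by (simp add: newton_def)
qed

text \<open>The contraction is run on a ball smaller than the given one, so the fixed point lies
  strictly inside. Any other zero in the closed ball of radius r, even on its sphere, can then be
  compared with it.\<close>

lemma unique_zero: "\<exists>!y. y \<in> YD \<and> norm (y - y\<^sub>0) \<le> r \<and> \<Phi> y = 0"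
proof -
  \<comment> \<open>Quadratic error plus residual, divided by \<kappa>: a bound for the distance of
    a Newton image from the centre. The first radius condition says that it is below r, and the
    second that q < 1.\<close>
  define r' where "r' = (1/2 * Z\<^sub>2 r * r\<^sup>2 + Y\<^sub>0 + Y\<^sub>s) / \<kappa>"
  define q where "q = Z\<^sub>2 r * r / \<kappa>"
  have r': "0 \<le> r'" "r' < r" "\<kappa> * r' = 1/2 * Z\<^sub>2 r * r\<^sup>2 + Y\<^sub>0 + Y\<^sub>s"
    using radius1 \<kappa>_pos Z2r nonneg by (auto simp: r'_def \<kappa>_def[symmetric] pos_divide_less_eq mult.commute)
  have q: "0 \<le> q" "q < 1"
    using radius2 \<kappa>_pos Z2r r_pos by (auto simp: q_def \<kappa>_def[symmetric] pos_divide_less_eq)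
  have lip: "norm (newton x - newton y) \<le> q * norm (x - y)"
    if "x \<in> YD" "norm (x - y\<^sub>0) \<le> r" "y \<in> YD" "norm (y - y\<^sub>0) < r" for x y
  proof -
    have "\<kappa> * norm (newton x - newton y) \<le> Z\<^sub>2 r * r * norm (x - y)"
      by (rule order_trans[OF newton_diff[OF that(1,3)] lipschitz_estimate[OF that]])
    then show ?thesis using \<kappa>_pos by (simp add: q_def field_simps)
  qed
  let ?D = "YD \<inter> cball y\<^sub>0 r'"
  have "\<exists>!y. y \<in> ?D \<and> newton y = y"
  proof (rule Banach_fix)
    show "newton ` ?D \<subseteq> ?D"
    proof safe
      fix y assume y: "y \<in> YD" "y \<in> cball y\<^sub>0 r'"
      show "newton y \<in> YD" by (rule newton_YD[OF y(1)])
      have "norm (y - y\<^sub>0) \<le> r" using y(2) r' by (simp add: dist_norm norm_minus_commute)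
      then have 1: "\<kappa> * norm (newton y - newton y\<^sub>0) \<le> 1/2 * Z\<^sub>2 r * r\<^sup>2"
        by (rule order_trans[OF newton_diff[OF y(1) y0(1)] quadratic_estimate[OF y(1)]])
      have "norm (newton y - y\<^sub>0) \<le> norm (newton y - newton y\<^sub>0) + norm (B (\<Phi> y\<^sub>0))"
        using norm_triangle_ineq4[of "newton y - newton y\<^sub>0" "B (\<Phi> y\<^sub>0)"] by (simp add: newton_def)
      then have "\<kappa> * norm (newton y - y\<^sub>0) \<le> \<kappa> * (norm (newton y - newton y\<^sub>0) + norm (B (\<Phi> y\<^sub>0)))"
        using \<kappa>_pos by simp
      also have "\<dots> \<le> \<kappa> * r'" using 1 residual_estimate by (simp add: distrib_left r'(3))
      finally show "newton y \<in> cball y\<^sub>0 r'" using \<kappa>_pos by (simp add: dist_norm norm_minus_commute)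
    qed
    show "dist (newton x) (newton y) \<le> q * dist x y" if "x \<in> ?D" "y \<in> ?D" for x y
      using lip[of x y] that r' by (simp add: dist_norm norm_minus_commute)
    show "?D \<noteq> {}" using y0(1) r'(1) by auto
  qed (use q L2_sym_dihedral_subspace(2) in \<open>auto simp: complete_eq_closed\<close>)
  then obtain y where y: "y \<in> YD" "y \<in> cball y\<^sub>0 r'" "newton y = y" by auto
  \<comment> \<open>Strictness places y in the admissible position for the Lipschitz estimate, which
    in turn forces every zero of the closed ball to equal y.\<close>
  have yr: "norm (y - y\<^sub>0) < r" using y(2) r' by (simp add: dist_norm norm_minus_commute)
  show ?thesis
  proof (rule ex1I)
    show "y \<in> YD \<and> norm (y - y\<^sub>0) \<le> r \<and> \<Phi> y = 0" using y yr newton_fixed_iff by auto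
    fix x assume x: "x \<in> YD \<and> norm (x - y\<^sub>0) \<le> r \<and> \<Phi> x = 0"
    then have "newton x = x" using newton_fixed_iff by blast
    then have "norm (x - y) \<le> q * norm (x - y)" using lip[of x y] x y yr by simp
    then have "(1 - q) * norm (x - y) \<le> 0" by (simp add: algebra_simps)
    then have "norm (x - y) \<le> 0" using q by (simp add: mult_le_0_iff)
    then show "x = y" by simp
  qed
qed

section \<open>Return to the augmented problem\<close>

lemma H1_cball_iff: "(0, w) \<in> H1_cball l j (0, w\<^sub>0) r \<longleftrightarrow> w \<in> H \<and> w \<in> YD \<and> norm (L w - y\<^sub>0) \<le> r"
proof (cases "w \<in> H")
  case True
  then have "aug_norm l (0, w - w\<^sub>0) = norm (L w - y\<^sub>0)"
    by (simp add: aug_norm_eq L_diff w0 y\<^sub>0_def norm_Pair)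
  then show ?thesis by (simp add: H1_cball_def aug_space_def H_sym_def)
qed (simp add: H1_cball_def aug_space_def H_sym_def)

lemma F_aug_zero_iff:
  assumes w: "w \<in> H" "w \<in> YD"
  shows "F_aug l N g \<rho> w\<^sub>0 (0, w) = 0 \<longleftrightarrow> \<Phi> (L w) = 0"
proof -
  have "L (w - w\<^sub>0) \<in> YD"
    by (intro L_sym(2) subspace_diff[OF subspace_H] subspace_diff[OF L2_sym_dihedral_subspace(1)] w w0)
  then have "inner (L (w - w\<^sub>0)) (deriv_x2 w\<^sub>0) = 0"
    by (rule inner_deriv_x2_dihedral[OF w0(2) _ j_ge_2])
  then show ?thesis by (simp add: F_aug_def f_aug_def \<Phi>_def Linv_L[OF w(1)] zero_prod_def)
qed

lemma unique_solution: "\<exists>!w. (0, w) \<in> H1_cball l j (0, w\<^sub>0) r \<and> F_aug l N g \<rho> w\<^sub>0 (0, w) = 0"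
proof -
  obtain y where y': "y \<in> YD \<and> norm (y - y\<^sub>0) \<le> r \<and> \<Phi> y = 0"
    and uniq: "\<forall>x. x \<in> YD \<and> norm (x - y\<^sub>0) \<le> r \<and> \<Phi> x = 0 \<longrightarrow> x = y"
    using unique_zero by (elim ex1E) (rule that)
  have y: "y \<in> YD" "norm (y - y\<^sub>0) \<le> r" "\<Phi> y = 0" using y' by simp_all
  show ?thesis
  proof (rule ex1I)
    have "Linv y \<in> YD" by (rule Linv_sym(2)[OF y(1)])
    then show "(0, Linv y) \<in> H1_cball l j (0, w\<^sub>0) r \<and> F_aug l N g \<rho> w\<^sub>0 (0, Linv y) = 0"
      using y by (simp add: H1_cball_iff F_aug_zero_iff Linv)
    fix w assume w: "(0, w) \<in> H1_cball l j (0, w\<^sub>0) r \<and> F_aug l N g \<rho> w\<^sub>0 (0, w) = 0"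
    then have wH: "w \<in> H" "w \<in> YD" "norm (L w - y\<^sub>0) \<le> r" by (simp_all add: H1_cball_iff)
    then have "L w = y" using uniq L_sym(2)[OF wH(1,2)] w F_aug_zero_iff[OF wH(1,2)] by simp
    then show "w = Linv y" using Linv_L[OF wH(1)] by simp
  qed
qed

end

theorem theorem3p7:
  fixes l :: "real^2 \<Rightarrow> complex" and N :: nat and g :: "nat \<Rightarrow> nat \<Rightarrow> real^2 \<Rightarrow> complex"
    and j :: nat and d \<rho> :: real and u\<^sub>0 w\<^sub>0 :: "real L2"
    and A :: "real \<times> real L2 \<Rightarrow> real \<times> real L2"
    and Y\<^sub>0 Y\<^sub>s Z\<^sub>1 Z\<^sub>s :: real and Z\<^sub>2 :: "real \<Rightarrow> real" and r :: real
  assumes l_symbol: "diffop_symbol l" and l_nonzero: "\<forall>\<xi>. cmod (l \<xi>) > 0"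
    and N_ge: "N \<ge> 2"
    and g_symbol: "\<forall>i\<in>{2..N}. \<forall>p\<in>{1..i}. diffop_symbol (g i p)"
    and g_integrable: "\<forall>i\<in>{2..N}. \<forall>p\<in>{1..i}. integrable lborel (\<lambda>\<xi>. g i p \<xi> / l \<xi>)"
    and G_smooth: "smooth_on_normed (H_space l) (H_norm l) (nonlin N g)"
    and L_equivariant: "euclidean_equivariant l (diffop l)"
    and G_equivariant: "euclidean_equivariant l (nonlin N g)"
    and d_pos: "d > 0" and rho_pos: "\<rho> > 0"
    and u0_H: "u\<^sub>0 \<in> H_sym l Z2Z1"
    and u0_support: "supported_in_square d u\<^sub>0"
    and u0_trig: "trig_poly_on_square d u\<^sub>0"
    and w0_def: "w\<^sub>0 = rot_average j u\<^sub>0"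
    and j_prime: "prime j" and j_odd: "odd j" and j_not_3: "j \<noteq> 3"
    and A_bounded: "bounded_linear_between (UNIV \<times> L2_sym Z2Z1) norm
                      (aug_space l Z2Z1) (aug_norm l) A"
    and nonneg: "Y\<^sub>0 \<ge> 0" "Y\<^sub>s \<ge> 0" "Z\<^sub>1 \<ge> 0" "Z\<^sub>s \<ge> 0"
    and Z2_pos: "\<forall>s\<ge>0. Z\<^sub>2 s > 0"
    and Y0: "aug_norm l (A (0, f_aug l N g \<rho> w\<^sub>0 (0, u\<^sub>0))) \<le> Y\<^sub>0"
    and Ys: "aug_norm l (A (0, G_tilde N g j u\<^sub>0)) \<le> Y\<^sub>s"
    and Z1: "aug_onorm l (\<lambda>v. v - A (Q_aug l N g \<rho> u\<^sub>0 v)) \<le> Z\<^sub>1"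
    and Zs: "aug_onorm l (\<lambda>v. A (Q_aug l N g \<rho> u\<^sub>0 v - DF_aug l N g \<rho> w\<^sub>0 (0, w\<^sub>0) v)) \<le> Z\<^sub>s"
    and Z2: "\<forall>s>0. \<forall>h\<in>H1_ball l j (0, w\<^sub>0) s.
               aug_onorm l (\<lambda>v. A (DF_aug l N g \<rho> w\<^sub>0 (0, w\<^sub>0) v - DF_aug l N g \<rho> w\<^sub>0 h v))
                 \<le> Z\<^sub>2 s * aug_norm l (h - (0, w\<^sub>0))"
    and r_pos: "r > 0"
    and radius1: "1/2 * Z\<^sub>2 r * r\<^sup>2 - (1 - Z\<^sub>1 - Z\<^sub>s) * r + Y\<^sub>0 + Y\<^sub>s < 0"
    and radius2: "Z\<^sub>2 r * r < 1 - Z\<^sub>1 - Z\<^sub>s"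
  shows "\<exists>!w. (0, w) \<in> H1_cball l j (0, w\<^sub>0) r \<and> F_aug l N g \<rho> w\<^sub>0 (0, w) = 0"
proof -
  have "j \<ge> 2" using j_prime by (rule prime_ge_2_nat)
  interpret radii_problem l N g j \<rho> u\<^sub>0 w\<^sub>0 A Y\<^sub>0 Y\<^sub>s Z\<^sub>1 Z\<^sub>s Z\<^sub>2 r
    by (unfold_locales; fact)
  show ?thesis by (rule unique_solution)
qed

end
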